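(* Let $\delta>0$ be a fixed small constant and $B>0$ a constant. There are constants $c_1,c_2,C>0$ depending only on $\delta$ and $B$ such that the following holds. Let $H_N$ be a deterministic nonzero positive semi-definite $N\times N$ real symmetric (resp. complex Hermitian) matrix, and let $P_N$ be a deterministic $N\times N$ real symmetric (resp. complex Hermitian) matrix of rank $M=o(N)$ all of whose eigenvalues are larger than $-1$, with $\|H_N\|\le B$ and $\|P_N\|\le B$. Let the nonzero eigenvalues of $P_N$ be $\theta_1\ge\dots\ge\theta_{M_1}>0>\theta_{M_1+1}\ge\dots\ge\theta_M$. Let $U$ be a Haar-distributed $N\times N$ orthogonal (resp. unitary) matrix, let $$\tilde W_N=(I_N+P_N)^{1/2}U^*H_NU(I_N+P_N)^{1/2},$$ and denote its eigenvalues by $\lambda_1(\tilde W_N)\ge\dots\ge\lambda_N(\tilde W_N)$. Let $0<\epsilon\le\delta$ ($\epsilon$ may depend on $M$ and $N$) and let $1\le i\le M$ be such that $$T_N^{-1}\Big(\frac1{\theta_i}\Big)\ge\lambda_1(H_N)+2\delta\ \text{ if }\theta_i>0,\qquad T_N^{-1}\Big(\frac1{\theta_i}\Big)\le\lambda_N(H_N)-2\delta\ \text{ if }\theta_i<0 .$$ Set $\tilde\lambda_i=\lambda_i(\tilde W_N)$ if $\theta_i>0$ and $\tilde\lambda_i=\lambda_{N-M+i}(\tilde W_N)$ if $\theta_i<0$. Then $$\mathbb P\left(T_N^{-1}\Big(\frac1{\theta_i}\Big)-\epsilon\le\tilde\lambda_i\le T_N^{-1}\Big(\frac1{\theta_i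}\Big)+\epsilon\right)\ge1-Ce^{-c_1N\epsilon^2+c_2M}.$$
   Context: $\|\cdot\|$ is the operator norm. The ordered eigenvalues of $H_N$ are $\lambda_1(H_N)\ge\dots\ge\lambda_N(H_N)\ge0$. The T-transform of the empirical eigenvalue distribution of $H_N$ is $$T_N(z)=\frac1N\sum_{k=1}^N\frac{\lambda_k(H_N)}{z-\lambda_k(H_N)},\qquad z\in(-\infty,\lambda_N(H_N))\cup(\lambda_1(H_N),\infty).$$ It is strictly decreasing on each of the two intervals; $T_N^{-1}$ denotes its inverse, mapping $(0,\infty)$ onto $(\lambda_1(H_N),\infty)$ and $(-\infty,0)$ onto $(-\infty,\lambda_N(H_N))$ (for negative arguments this requires $\lambda_N(H_N)>0$; for $\theta_i<0$ the separation condition is understood to include that $1/\theta_i$ lies in the range of $T_N$ on $(-\infty,\lambda_N(H_N))$). The rank $M=M(N)$ may grow with $N$; the assumption $M=o(N)$ refers to the sequence $N\to\infty$, and the constants do not depend on $N$, $M$, $\epsilon$, $i$ or on the matrices. *)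

theory Defs
  imports
    "HOL-Probability.Probability"
    "HOL-Library.Landau_Symbols"
    "Jordan_Normal_Form.Schur_Decomposition"
    "Jordan_Normal_Form.DL_Rank"
begin

no_notation Finite_Cartesian_Product.vec.vec_nth (infixl \<open>$\<close> 90)
hide_type (open) Finite_Cartesian_Product.vec
hide_const (open) Finite_Cartesian_Product.vec Finite_Cartesian_Product.mat

text \<open>
  The definitions are polymorphic in the scalar type and are meant for \<^typ>\<open>real\<close> and
  \<^typ>\<open>complex\<close>. On \<^typ>\<open>real\<close> the conjugation is the identity, so that there
  \<open>hermitian\<close> means symmetric and \<open>unitary_group\<close> is the orthogonal group.
\<close>

definition hermitian :: "'a :: conjugatable_field mat \<Rightarrow> bool" where
  "hermitian A \<longleftrightarrow> mat_adjoint A = A"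

text \<open>
  In the order on \<^typ>\<open>complex\<close> used here, \<open>0 \<le> z\<close> means that \<open>z\<close> is real and nonnegative.
\<close>

definition psd :: "'a :: conjugatable_ordered_field mat \<Rightarrow> bool" where
  "psd A \<longleftrightarrow> hermitian A \<and> (\<forall>v \<in> carrier_vec (dim_row A). 0 \<le> (A *\<^sub>v v) \<bullet>c v)"

definition mat_sqrt :: "'a :: conjugatable_ordered_field mat \<Rightarrow> 'a mat" where
  "mat_sqrt A = (THE S. psd S \<and> S * S = A)"

definition vec_norm2 :: "'a :: real_normed_vector vec \<Rightarrow> real" where
  "vec_norm2 v = L2_set (\<lambda>i. norm (v $ i)) {..<dim_vec v}"

definition op_norm :: "'a :: real_normed_field mat \<Rightarrow> real" where
  "op_norm A = (SUP v \<in> {v \<in> carrier_vec (dim_col A). vec_norm2 v \<le> 1}. vec_norm2 (A *\<^sub>v v))"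

text \<open>
  The eigenvalues of a Hermitian matrix as a list of real numbers, in decreasing order and
  repeated according to multiplicity; \<open>eig k A\<close> is the \<open>k\<close>-th largest one, counted from
  \<open>k = 1\<close>.
\<close>

definition eigs :: "'a :: real_normed_field mat \<Rightarrow> real list" where
  "eigs A = (THE es. sorted_wrt (\<ge>) es \<and> char_poly A = (\<Prod>e\<leftarrow>es. [:- of_real e, 1:]))"

definition eig :: "nat \<Rightarrow> 'a :: real_normed_field mat \<Rightarrow> real" where
  "eig k A = eigs A ! (k - 1)"

text \<open>The nonzero eigenvalues, again in decreasing order and counted from 1.\<close>

definition nonzero_eig :: "nat \<Rightarrow> 'a :: real_normed_field mat \<Rightarrow> real" where
  "nonzero_eig i A = filter (\<lambda>x. x \<noteq> 0) (eigs A) ! (i - 1)"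

definition T_transform :: "'a :: real_normed_field mat \<Rightarrow> real \<Rightarrow> real" where
  "T_transform H z = 1 / real (dim_row H) * (\<Sum>k=1..dim_row H. eig k H / (z - eig k H))"

definition T_inv :: "'a :: real_normed_field mat \<Rightarrow> real \<Rightarrow> real" where
  "T_inv H = the_inv_into ({..<eig (dim_row H) H} \<union> {eig 1 H<..}) (T_transform H)"

text \<open>
  For positive \<open>\<theta>\<close> the number \<open>1 / \<theta>\<close> always lies in the range of the T-transform of a
  nonzero positive semidefinite matrix; for negative \<open>\<theta>\<close> this has to be required.
\<close>

definition separated :: "real \<Rightarrow> 'a :: real_normed_field mat \<Rightarrow> real \<Rightarrow> bool" where
  "separated \<delta> H \<theta> \<longleftrightarrow>
     (\<theta> > 0 \<longrightarrow> T_inv H (1 / \<theta>) \<ge> eig 1 H + 2 * \<delta>) \<and>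
     (\<theta> < 0 \<longrightarrow> 1 / \<theta> \<in> T_transform H ` {..<eig (dim_row H) H} \<and>
               T_inv H (1 / \<theta>) \<le> eig (dim_row H) H - 2 * \<delta>)"

definition unitary_group :: "nat \<Rightarrow> 'a :: conjugatable_field mat set" where
  "unitary_group n = {U \<in> carrier_mat n n. mat_adjoint U * U = 1\<^sub>m n}"

definition mat_borel :: "nat \<Rightarrow> 'a :: {zero, topological_space} mat measure" where
  "mat_borel n =
     vimage_algebra (carrier_mat n n) (\<lambda>A. \<lambda>ij\<in>{..<n} \<times> {..<n}. A $$ ij)
       (PiM ({..<n} \<times> {..<n}) (\<lambda>_. borel))"

text \<open>
  The law of a Haar-distributed random matrix: the translation-invariant probability measure
  on the orthogonal or unitary group.
\<close>

definition haar_law :: "nat \<Rightarrow> 'a :: {conjugatable_field, topological_space} mat measure \<Rightarrow> bool"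
  where
  "haar_law n \<mu> \<longleftrightarrow>
     prob_space \<mu> \<and>
     sets \<mu> = sets (restrict_space (mat_borel n) (unitary_group n)) \<and>
     (\<forall>V \<in> unitary_group n. distr \<mu> \<mu> (\<lambda>U. V * U) = \<mu>)"

definition W_tilde ::
  "'a :: conjugatable_ordered_field mat \<Rightarrow> 'a mat \<Rightarrow> 'a mat \<Rightarrow> 'a mat" where
  "W_tilde H P U =
     (let S = mat_sqrt (1\<^sub>m (dim_row P) + P) in S * mat_adjoint U * H * U * S)"

definition spiked_model ::
  "real \<Rightarrow> nat \<Rightarrow> nat \<Rightarrow>
     'a :: {conjugatable_ordered_field, real_normed_field} mat \<Rightarrow> 'a mat \<Rightarrow> bool" where
  "spiked_model B N M H P \<longleftrightarrow>
     H \<in> carrier_mat N N \<and> psd H \<and> H \<noteq> 0\<^sub>m N N \<and> op_norm H \<le> B \<and>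
     P \<in> carrier_mat N N \<and> hermitian P \<and> vec_space.rank N P = M \<and>
     (\<forall>k \<in> {1..N}. eig k P > -1) \<and> op_norm P \<le> B"

text \<open>
  The eigenvalue of \<open>W\<close> attached to the \<open>i\<close>-th of the \<open>M\<close> nonzero eigenvalues of \<open>P\<close>:
  counted from the top for a positive one, from the bottom for a negative one.
\<close>

definition outlier_eig ::
  "nat \<Rightarrow> nat \<Rightarrow> 'a :: real_normed_field mat \<Rightarrow> 'a mat \<Rightarrow> real" where
  "outlier_eig M i P W =
     (if nonzero_eig i P > 0 then eig i W else eig (dim_row W - M + i) W)"

end

theory Submission
  imports Defs
begin

text \<open>An eigenvalue of \<open>W_tilde H P U\<close> is compared with \<open>z\<close> by Courant-Fischer. After diagonalising
  \<open>H\<close> and \<open>P\<close>, the form of \<open>W_tilde H P U - z\<close> becomes a diagonal form with weights \<open>h\<^sub>l - z\<close> plus a form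
  supported on the \<open>M\<close> spike directions, and Cauchy-Schwarz with these weights determines its sign once the
  \<open>M\<close>-dimensional compression of \<open>H (z - H)\<^sup>-\<^sup>1\<close> to the rotated spike directions is close to
  \<open>T_transform H z\<close> times the identity.

  That compression concentrates because each of its vectors is uniform on the sphere: a small rotation in a
  random coordinate plane gives an exchangeable pair, from which a centred quadratic form \<open>q\<close> with
  coefficients bounded by \<open>D\<close> satisfies \<open>E (q e\<^bsup>tq\<^esup>) \<le> (12 t D\<^sup>2 / n) E e\<^bsup>tq\<^esup>\<close>, hence is sub-Gaussian.
  A union bound over integer points of a ball of radius of order \<open>\<surd>M\<close> makes this uniform over the spike
  directions, at the price of the factor \<open>e\<^bsup>517 M\<^esup>\<close>.\<close>

section \<open>Real and complex matrices\<close>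

text \<open>The critical z solves p / (1 + p) * (1 + T(z)) = 1, that is T(z) = 1/p: the form of z (z
  - H)^(-1) on the spike directions is close to 1 + T(z), because z / (z - h) = 1 + h / (z - h), and
  a spike p enters with the factor p / (1 + p). Since T(z) is the mean of the weights h / (z - h),
  subtracting it centres the coefficients, as the concentration bound requires. Moving z by
  \<epsilon> moves T by at least a constant times \<epsilon>; this margin is the error granted to
  the compression and produces the exponent N \<epsilon>^2. The obstacle is that M may grow and that
  spikes may be close to each other or coincide. Hence the compression is controlled on all vectors
  of the M-dimensional space at once, and eigenvalues are compared by index through trial spaces; of
  the other spikes only their order matters. Negative spikes are covered by a sign \<sigma>. The
  argument needs z > 0, and the limiting location is positive because the eigenvalues of P exceed
  -1.\<close>

class real_or_complex = conjugatable_ordered_field + real_normed_field + second_countable_topology +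
  fixes to_complex :: "'a \<Rightarrow> complex"
  assumes to_complex_add: "to_complex (x + y) = to_complex x + to_complex y"
    and to_complex_mult: "to_complex (x * y) = to_complex x * to_complex y"
    and to_complex_scaleR: "to_complex (r *\<^sub>R x) = r *\<^sub>R to_complex x"
    and to_complex_1: "to_complex 1 = 1"
    and to_complex_conjugate: "to_complex (conjugate x) = cnj (to_complex x)"
    and norm_to_complex: "norm (to_complex x) = norm x"
    and to_complex_le_iff: "to_complex x \<le> to_complex y \<longleftrightarrow> x \<le> y"
    and ex_imaginary_unit: "\<exists>J. norm J \<le> 1 \<and> (\<forall>x. x = Re (to_complex x) *\<^sub>R 1 + Im (to_complex x) *\<^sub>R J)"

text \<open>Both scalar fields share one proof. The embedding into the complex numbers supplies real
  parts and the fundamental theorem of algebra; the last axiom splits a scalar into two real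
  coordinates, which the integer grid of the net argument needs. Its witness is 0 here and the
  imaginary unit for \<open>complex\<close>.\<close>

instantiation real :: real_or_complex
begin
definition "to_complex_real = complex_of_real"
instance
proof
  show "\<exists>J. norm J \<le> 1 \<and> (\<forall>x::real. x = Re (to_complex x) *\<^sub>R 1 + Im (to_complex x) *\<^sub>R J)"
    by (rule exI[of _ 0]) (simp add: to_complex_real_def)
qed (auto simp: to_complex_real_def scaleR_conv_of_real less_eq_complex_def)
end

instantiation complex :: real_or_complex
begin
definition "to_complex_complex = (\<lambda>z::complex. z)"
instance
proof
  show "\<exists>J. norm J \<le> 1 \<and> (\<forall>x::complex. x = Re (to_complex x) *\<^sub>R 1 + Im (to_complex x) *\<^sub>R J)"
    by (rule exI[of _ \<i>]) (simp add: to_complex_complex_def complex_eq_iff)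
qed (auto simp: to_complex_complex_def)
end

lemma to_complex_of_real [simp]: "to_complex (of_real r :: 'a::real_or_complex) = of_real r"
  by (simp add: of_real_def to_complex_scaleR to_complex_1)

lemma to_complex_0 [simp]: "to_complex (0 :: 'a::real_or_complex) = 0"
  using to_complex_of_real[of 0] by simp

lemma to_complex_minus: "to_complex (- x :: 'a::real_or_complex) = - to_complex x"
  using to_complex_scaleR[of "-1" x] by simp

lemma to_complex_diff: "to_complex (x - y :: 'a::real_or_complex) = to_complex x - to_complex y"
  using to_complex_add[of x "- y"] by (simp add: to_complex_minus)

lemma to_complex_eq_0_iff [simp]: "to_complex (x :: 'a::real_or_complex) = 0 \<longleftrightarrow> x = 0"
  by (metis norm_eq_zero norm_to_complex)

lemma to_complex_eq_iff: "to_complex (x :: 'a::real_or_complex) = to_complex y \<longleftrightarrow> x = y"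
  using to_complex_eq_0_iff[of "x - y"] by (simp add: to_complex_diff)

interpretation to_complex: inj_comm_ring_hom "to_complex :: 'a::real_or_complex \<Rightarrow> complex"
  by unfold_locales (auto simp: to_complex_add to_complex_mult to_complex_1 to_complex_eq_iff)

lemma conjugate_of_real [simp]: "conjugate (of_real r :: 'a::real_or_complex) = of_real r"
  by (subst to_complex_eq_iff[symmetric]) (simp add: to_complex_conjugate)

lemma conjugate_1 [simp]: "conjugate (1 :: 'a::real_or_complex) = 1"
  using conjugate_of_real[of 1] by simp

lemma conjugate_diff: "conjugate (x - y :: 'a::real_or_complex) = conjugate x - conjugate y"
  using conjugate_dist_add[of x "- y"] by (simp add: conjugate_neg)

lemma norm_conjugate [simp]: "norm (conjugate x :: 'a::real_or_complex) = norm x"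
  by (metis complex_mod_cnj norm_to_complex to_complex_conjugate)

lemma mult_conjugate: "x * conjugate x = (of_real ((norm x)\<^sup>2) :: 'a::real_or_complex)"
  by (subst to_complex_eq_iff[symmetric])
    (simp only: to_complex_mult to_complex_conjugate to_complex_of_real complex_norm_square
      norm_to_complex[of x, symmetric])

lemma of_real_nonneg_iff [simp]: "(0 :: 'a::real_or_complex) \<le> of_real r \<longleftrightarrow> 0 \<le> r"
  by (subst to_complex_le_iff[symmetric]) (simp add: less_eq_complex_def)

definition re :: "'a::real_or_complex \<Rightarrow> real" where
  "re x = Re (to_complex x)"

lemma re_add: "re (x + y) = re x + re y"
  and re_diff: "re (x - y) = re x - re y"
  and re_minus: "re (- x) = - re x"
  and re_of_real [simp]: "re (of_real r) = r"
  and re_0 [simp]: "re 0 = 0"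
  and re_conjugate [simp]: "re (conjugate x) = re x"
  by (auto simp: re_def to_complex_add to_complex_diff to_complex_minus to_complex_conjugate)

lemma re_of_real_mult [simp]: "re (of_real r * x) = r * re x"
  by (simp add: re_def to_complex_mult)

lemma abs_re_le_norm: "\<bar>re x\<bar> \<le> norm x"
  unfolding re_def by (metis abs_Re_le_cmod norm_to_complex)

lemma norm_add_sq: "(norm (x + y :: 'a::real_or_complex))\<^sup>2
    = (norm x)\<^sup>2 + (norm y)\<^sup>2 + 2 * re (x * conjugate y)"
proof -
  have "of_real ((norm (x + y))\<^sup>2) = (x + y) * conjugate (x + y)"
    by (simp only: mult_conjugate)
  also have "\<dots> = x * conjugate x + y * conjugate y + (x * conjugate y + conjugate (x * conjugate y))"
    by (simp add: conjugate_dist_add conjugate_dist_mul algebra_simps)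
  finally have "re (of_real ((norm (x + y))\<^sup>2) :: 'a) = re (x * conjugate x + y * conjugate y
      + (x * conjugate y + conjugate (x * conjugate y)))" by simp
  then show ?thesis
    unfolding mult_conjugate by (simp only: re_add re_of_real re_conjugate)
qed

section \<open>Adjoints, the unitary group and real diagonal matrices\<close>

lemma dim_mat_adjoint [simp]:
  "dim_row (mat_adjoint A) = dim_col A" "dim_col (mat_adjoint A) = dim_row A"
  by (auto simp: mat_adjoint_def)

lemma mat_adjoint_carrier [simp]: "A \<in> carrier_mat n m \<Longrightarrow> mat_adjoint A \<in> carrier_mat m n"
  by (auto intro!: carrier_matI)

lemma index_mat_adjoint [simp]:
  "i < dim_col A \<Longrightarrow> j < dim_row A \<Longrightarrow> mat_adjoint A $$ (i, j) = conjugate (A $$ (j, i))"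
  by (simp add: mat_adjoint_def mat_of_rows_def)

lemma mat_adjoint_adjoint [simp]: "mat_adjoint (mat_adjoint A) = A"
  by (rule eq_matI) auto

lemma mat_adjoint_mult:
  fixes A B :: "'a::conjugatable_field mat"
  assumes "A \<in> carrier_mat n m" "B \<in> carrier_mat m k"
  shows "mat_adjoint (A * B) = mat_adjoint B * mat_adjoint A"
proof (rule eq_matI)
  fix i j assume "i < dim_row (mat_adjoint B * mat_adjoint A)"
    "j < dim_col (mat_adjoint B * mat_adjoint A)"
  with assms show "mat_adjoint (A * B) $$ (i, j) = (mat_adjoint B * mat_adjoint A) $$ (i, j)"
    by (auto simp: scalar_prod_def sum_conjugate conjugate_dist_mul mult.commute)
qed (use assms in auto)

lemma mat_adjoint_1 [simp]: "mat_adjoint (1\<^sub>m n :: 'a::real_or_complex mat) = 1\<^sub>m n"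
  by (rule eq_matI) auto

lemma cscalar_mult_mat_vec:
  fixes A :: "'a::conjugatable_field mat"
  assumes "A \<in> carrier_mat n m" "v \<in> carrier_vec m" "w \<in> carrier_vec n"
  shows "(A *\<^sub>v v) \<bullet>c w = v \<bullet>c (mat_adjoint A *\<^sub>v w)"
proof -
  have "(A *\<^sub>v v) \<bullet>c w = (\<Sum>i<n. (\<Sum>j<m. A $$ (i,j) * v $ j) * conjugate (w $ i))"
    using assms by (auto simp: scalar_prod_def lessThan_atLeast0 intro!: sum.cong)
  also have "\<dots> = (\<Sum>i<n. \<Sum>j<m. A $$ (i,j) * v $ j * conjugate (w $ i))"
    by (simp only: sum_distrib_right)
  also have "\<dots> = (\<Sum>j<m. \<Sum>i<n. A $$ (i,j) * v $ j * conjugate (w $ i))"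
    by (rule sum.swap)
  also have "\<dots> = (\<Sum>j<m. v $ j * conjugate (\<Sum>i<n. conjugate (A $$ (i,j)) * w $ i))"
    by (simp only: sum_conjugate[OF finite_lessThan] conjugate_dist_mul conjugate_id sum_distrib_left mult_ac)
  also have "\<dots> = v \<bullet>c (mat_adjoint A *\<^sub>v w)"
    using assms by (auto simp: scalar_prod_def lessThan_atLeast0 intro!: sum.cong arg_cong[of _ _ conjugate])
  finally show ?thesis .
qed

definition norm_sq :: "'a::real_normed_vector vec \<Rightarrow> real" where
  "norm_sq v = (\<Sum>i<dim_vec v. (norm (v $ i))\<^sup>2)"

lemma norm_sq_nonneg [simp]: "0 \<le> norm_sq v"
  by (simp add: norm_sq_def sum_nonneg)

lemma norm_sq_eq_0_iff:
  assumes "v \<in> carrier_vec n"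
  shows "norm_sq v = 0 \<longleftrightarrow> v = 0\<^sub>v n"
  using assms by (auto simp: norm_sq_def sum_nonneg_eq_0_iff intro!: eq_vecI)

lemma cscalar_self:
  fixes v :: "'a::real_or_complex vec"
  shows "v \<bullet>c v = of_real (norm_sq v)"
  by (auto simp: scalar_prod_def norm_sq_def mult_conjugate lessThan_atLeast0
      simp flip: of_real_power intro!: sum.cong)

lemma unitary_groupD:
  fixes U :: "'a::real_or_complex mat"
  assumes "U \<in> unitary_group n"
  shows "U \<in> carrier_mat n n" "mat_adjoint U * U = 1\<^sub>m n" "U * mat_adjoint U = 1\<^sub>m n"
    "mat_adjoint U \<in> carrier_mat n n"
proof -
  show *: "U \<in> carrier_mat n n" "mat_adjoint U * U = 1\<^sub>m n"
    using assms by (simp_all add: unitary_group_def)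
  show **: "mat_adjoint U \<in> carrier_mat n n" using * by simp
  show "U * mat_adjoint U = 1\<^sub>m n"
    by (rule mat_mult_left_right_inverse[OF ** *])
qed

lemma unitary_group_cancel:
  fixes U :: "'a::real_or_complex mat"
  assumes "U \<in> unitary_group n" "X \<in> carrier_mat n m"
  shows "mat_adjoint U * (U * X) = X" "U * (mat_adjoint U * X) = X"
  using unitary_groupD[OF assms(1)] assms(2)
  by (simp_all flip: assoc_mult_mat[of _ n n _ n _ m])

lemma unitary_group_cancel_vec:
  fixes U :: "'a::real_or_complex mat"
  assumes "U \<in> unitary_group n" "v \<in> carrier_vec n"
  shows "mat_adjoint U *\<^sub>v (U *\<^sub>v v) = v" "U *\<^sub>v (mat_adjoint U *\<^sub>v v) = v"
  using unitary_groupD[OF assms(1)] assms(2)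
  by (simp_all flip: assoc_mult_mat_vec[of _ n n _ n])

lemma unitary_group_mult:
  fixes U :: "'a::real_or_complex mat"
  assumes "U \<in> unitary_group n" "V \<in> unitary_group n"
  shows "U * V \<in> unitary_group n"
proof -
  note U = unitary_groupD[OF assms(1)] and V = unitary_groupD[OF assms(2)]
  have "mat_adjoint (U * V) * (U * V) = mat_adjoint V * mat_adjoint U * (U * V)"
    using mat_adjoint_mult[OF U(1) V(1)] by simp
  also have "\<dots> = mat_adjoint V * (mat_adjoint U * (U * V))"
    using U V by (intro assoc_mult_mat[of _ n n _ n _ n]) auto
  also have "\<dots> = 1\<^sub>m n"
    using unitary_group_cancel(1)[OF assms(1) V(1)] V by simp
  finally show ?thesis using U V by (simp add: unitary_group_def)
qed

lemma unitary_group_adjoint: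
  fixes U :: "'a::real_or_complex mat"
  assumes "U \<in> unitary_group n"
  shows "mat_adjoint U \<in> unitary_group n"
  using unitary_groupD[OF assms] by (simp add: unitary_group_def)

lemma norm_sq_isometry:
  fixes U :: "'a::real_or_complex mat"
  assumes "U \<in> unitary_group n" "v \<in> carrier_vec n"
  shows "norm_sq (U *\<^sub>v v) = norm_sq v"
proof -
  note U = unitary_groupD[OF assms(1)]
  have "(of_real (norm_sq (U *\<^sub>v v)) :: 'a) = (U *\<^sub>v v) \<bullet>c (U *\<^sub>v v)"
    by (simp add: cscalar_self)
  also have "\<dots> = v \<bullet>c (mat_adjoint U *\<^sub>v (U *\<^sub>v v))"
    by (rule cscalar_mult_mat_vec[of _ n n]) (use U assms in auto)
  also have "mat_adjoint U *\<^sub>v (U *\<^sub>v v) = v"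
    by (rule unitary_group_cancel_vec) (use assms in auto)
  finally show ?thesis by (simp add: cscalar_self)
qed

definition diag_real :: "nat \<Rightarrow> (nat \<Rightarrow> real) \<Rightarrow> 'a::real_or_complex mat" where
  "diag_real n d = mat n n (\<lambda>(i, j). if i = j then of_real (d i) else 0)"

lemma diag_real_carrier [simp]: "diag_real n d \<in> carrier_mat n n"
  and dim_diag_real [simp]: "dim_row (diag_real n d) = n" "dim_col (diag_real n d) = n"
  and index_diag_real [simp]: "i < n \<Longrightarrow> j < n \<Longrightarrow>
    diag_real n d $$ (i, j) = (if i = j then of_real (d i) else 0)"
  by (auto simp: diag_real_def)

lemma diag_real_mult_vec:
  assumes "v \<in> carrier_vec n"
  shows "diag_real n d *\<^sub>v v = vec n (\<lambda>i. of_real (d i) * v $ i)"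
  using assms
  by (intro eq_vecI) (auto simp: scalar_prod_def if_distrib[of "\<lambda>x. x * _"] sum.delta cong: if_cong)

lemma diag_real_mult_left:
  assumes "A \<in> carrier_mat n m"
  shows "diag_real n a * A = mat n m (\<lambda>(i, j). of_real (a i) * A $$ (i, j))"
  using assms
  by (intro eq_matI) (auto simp: scalar_prod_def if_distrib[of "\<lambda>x. x * _"] sum.delta cong: if_cong)

lemma diag_real_mult_right:
  assumes "A \<in> carrier_mat m n"
  shows "A * diag_real n a = mat m n (\<lambda>(i, j). A $$ (i, j) * of_real (a j))"
  using assms
  by (intro eq_matI) (auto simp: scalar_prod_def if_distrib[of "\<lambda>x. _ * x"] sum.delta' cong: if_cong)

lemma diag_real_mult: "diag_real n a * diag_real n b = diag_real n (\<lambda>i. a i * b i)"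
  by (subst diag_real_mult_left[of _ n n]) (auto intro!: eq_matI)

lemma mat_adjoint_diag_real [simp]: "mat_adjoint (diag_real n d) = diag_real n d"
  by (rule eq_matI) auto

text \<open>A real characteristic polynomial need not split a priori, so the root is taken over the
  complex numbers. Being an eigenvalue of a Hermitian matrix it is real, hence the image of a
  scalar, and injectivity of \<open>to_complex\<close> carries the root back.\<close>

lemma hermitian_eigenvalue:
  fixes A :: "'a::real_or_complex mat"
  assumes A: "A \<in> carrier_mat n n" and n: "n > 0" and h: "hermitian A"
  shows "\<exists>e::real. eigenvalue A (of_real e)"
proof -
  define C where "C = map_mat to_complex A"
  have C: "C \<in> carrier_mat n n" using A by (simp add: C_def)
  have adj: "mat_adjoint C = C"
  proof (rule eq_matI)
    fix i j assume ij: "i < dim_row C" "j < dim_col C"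
    then have ij': "i < n" "j < n" using C by auto
    have "mat_adjoint A $$ (i, j) = A $$ (i, j)" using h by (simp add: hermitian_def)
    then have "to_complex (conjugate (A $$ (j, i))) = to_complex (A $$ (i, j))"
      using A ij' by simp
    then show "mat_adjoint C $$ (i, j) = C $$ (i, j)"
      using ij' A C by (simp add: C_def to_complex_conjugate)
  qed (use C in auto)
  have "degree (char_poly C) = n" using degree_monic_char_poly[OF C] by simp
  then obtain z where z: "poly (char_poly C) z = 0"
    using fundamental_theorem_of_algebra[of "char_poly C"] n by (auto simp: constant_degree)
  then obtain v where v: "v \<in> carrier_vec n" "v \<noteq> 0\<^sub>v n" "C *\<^sub>v v = z \<cdot>\<^sub>v v"
    using C unfolding eigenvalue_root_char_poly[OF C, symmetric]
    by (auto simp: eigenvalue_def eigenvector_def)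
  \<comment> \<open>Moving \<open>C\<close> to the other factor gives z <v,v> = cnj z <v,v>, so z is
    real.\<close>
  have "z * (v \<bullet>c v) = (C *\<^sub>v v) \<bullet>c v" using v by simp
  also have "\<dots> = v \<bullet>c (C *\<^sub>v v)"
    using cscalar_mult_mat_vec[OF C v(1) v(1)] adj by simp
  also have "\<dots> = cnj z * (v \<bullet>c v)"
    using v by (simp add: conjugate_smult_vec)
  finally have "z = cnj z" using v by simp
  then have "z = to_complex (of_real (Re z) :: 'a)"
    by (metis Reals_cnj_iff of_real_Re to_complex_of_real)
  with z have "poly (map_poly to_complex (char_poly A)) (to_complex (of_real (Re z) :: 'a)) = 0"
    using to_complex.char_poly_hom[OF A] by (simp add: C_def)
  then have "poly (char_poly A) (of_real (Re z)) = 0"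
    unfolding to_complex.poly_map_poly by simp
  then show ?thesis using eigenvalue_root_char_poly[OF A] by blast
qed

text \<open>Complete v to a basis, orthogonalise by Gram-Schmidt, which keeps the first vector, and
  normalise the columns. The normalisation is why column 0 is only a multiple of v.\<close>

lemma unitary_completion:
  fixes v :: "'a::real_or_complex vec"
  assumes v: "v \<in> carrier_vec n" "v \<noteq> 0\<^sub>v n"
  shows "\<exists>W\<in>unitary_group n. \<exists>c. col W 0 = c \<cdot>\<^sub>v v"
proof -
  interpret cof_vec_space n "TYPE('a)" .
  define b where "b = basis_completion v"
  note b = basis_completion[OF v, folded b_def]
  define ws where "ws = gram_schmidt n b"
  note gs = gram_schmidt_result[OF b(2) b(4) b(5) ws_def]
  have n: "n > 0" using v by (cases n) auto
  have len: "length ws = n" using gs(4) b(6) by simp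
  have ws: "ws ! i \<in> carrier_vec n" if "i < n" for i using gs(3) len that by (auto simp: subset_iff)
  have hd: "ws ! 0 = v"
  proof -
    have "b \<noteq> []" using b(6) n by auto
    then have "b = v # tl b" using b(7) by (metis list.collapse)
    then have "hd ws = v" unfolding ws_def using gram_schmidt_hd[OF v(1)] by metis
    then show ?thesis using len n by (cases ws) auto
  qed
  define r where "r = (\<lambda>j. 1 / sqrt (norm_sq (ws ! j)))"
  define W where "W = mat n n (\<lambda>(i, j). of_real (r j) * ws ! j $ i)"
  have W: "W \<in> carrier_mat n n" by (simp add: W_def)
  have "mat_adjoint W * W = 1\<^sub>m n"
  proof (rule eq_matI)
    fix i j assume "i < dim_row (1\<^sub>m n :: 'a mat)" "j < dim_col (1\<^sub>m n :: 'a mat)"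
    then have ij: "i < n" "j < n" by auto
    have "(mat_adjoint W * W) $$ (i, j) = (\<Sum>k<n. conjugate (W $$ (k, i)) * W $$ (k, j))"
      using ij W by (auto simp: scalar_prod_def lessThan_atLeast0 intro!: sum.cong)
    also have "\<dots> = (\<Sum>k<n. of_real (r i * r j) * (ws ! j $ k * conjugate (ws ! i $ k)))"
      using ij by (intro sum.cong) (auto simp: W_def conjugate_dist_mul)
    also have "\<dots> = of_real (r i * r j) * (ws ! j \<bullet>c ws ! i)"
      using carrier_vecD[OF ws[OF ij(1)]] carrier_vecD[OF ws[OF ij(2)]]
      by (simp add: scalar_prod_def sum_distrib_left lessThan_atLeast0)
    also have "\<dots> = (if i = j then 1 else 0)"
    proof (cases "i = j")
      case True
      have "norm_sq (ws ! i) \<noteq> 0"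
      proof
        assume "norm_sq (ws ! i) = 0"
        then have "ws ! i \<bullet>c ws ! i = 0" by (simp add: cscalar_self)
        then show False using corthogonalD[OF gs(2)] len ij by auto
      qed
      then have "r i * r i * norm_sq (ws ! i) = 1"
        by (simp add: r_def)
      then have "(of_real (r i * r i) * of_real (norm_sq (ws ! i)) :: 'a) = 1"
        by (metis of_real_1 of_real_mult)
      then show ?thesis using True by (simp add: cscalar_self)
    qed (use corthogonalD[OF gs(2)] len ij in auto)
    finally show "(mat_adjoint W * W) $$ (i, j) = 1\<^sub>m n $$ (i, j)" using ij by simp
  qed (use W in auto)
  moreover have "col W 0 = of_real (r 0) \<cdot>\<^sub>v v"
    using n v by (intro eq_vecI) (auto simp: W_def hd)
  ultimately show ?thesis using W by (auto simp: unitary_group_def)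
qed

lemma hermitian_congruence:
  fixes A :: "'a::real_or_complex mat"
  assumes "A \<in> carrier_mat n n" "hermitian A" "W \<in> carrier_mat n m"
  shows "hermitian (mat_adjoint W * A * W)"
proof -
  have "mat_adjoint (mat_adjoint W * A * W) = mat_adjoint W * (mat_adjoint A * W)"
    using assms mat_adjoint_mult[of "mat_adjoint W * A" m n W m] mat_adjoint_mult[of "mat_adjoint W" m n A n]
      mult_carrier_mat[of "mat_adjoint W" m n A n]
    by simp
  then show ?thesis
    using assms assoc_mult_mat[of "mat_adjoint W" m n A n W m] by (simp add: hermitian_def)
qed

lemma mult_carrier_mat_square [simp]:
  "A \<in> carrier_mat n n \<Longrightarrow> B \<in> carrier_mat n n \<Longrightarrow> A * B \<in> carrier_mat n n"
  by (rule mult_carrier_mat)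

lemma one_eq_diag_real: "1\<^sub>m n = diag_real n (\<lambda>_. 1)"
  by (rule eq_matI) auto

section \<open>The spectral theorem\<close>

text \<open>Deflation by induction on the dimension: in an orthonormal basis starting with an
  eigenvector the matrix is block diagonal, and the induction hypothesis diagonalises the remaining
  Hermitian block.\<close>

lemma hermitian_unitarily_diagonalizable:
  fixes A :: "'a::real_or_complex mat"
  assumes "A \<in> carrier_mat n n" "hermitian A"
  shows "\<exists>Q\<in>unitary_group n. \<exists>d. A = Q * diag_real n d * mat_adjoint Q"
  using assms
proof (induction n arbitrary: A)
  case 0
  then have "A = 1\<^sub>m 0 * diag_real 0 (\<lambda>_. 0) * mat_adjoint (1\<^sub>m 0)"
    by (intro eq_matI) auto
  moreover have "1\<^sub>m 0 \<in> (unitary_group 0 :: 'a mat set)"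
    by (simp add: unitary_group_def)
  ultimately show ?case by blast
next
  case (Suc n)
  note A = Suc.prems(1)
  obtain e v where ev: "eigenvector A v (of_real e :: 'a)"
    using hermitian_eigenvalue[OF Suc.prems(1) _ Suc.prems(2)] by (auto simp: eigenvalue_def)
  then have v: "v \<in> carrier_vec (Suc n)" "v \<noteq> 0\<^sub>v (Suc n)" "A *\<^sub>v v = of_real e \<cdot>\<^sub>v v"
    using A by (auto simp: eigenvector_def)
  obtain W c where W: "W \<in> unitary_group (Suc n)" and c: "col W 0 = c \<cdot>\<^sub>v v"
    using unitary_completion[OF v(1,2)] by blast
  note WD = unitary_groupD[OF W]
  define B where "B = mat_adjoint W * A * W"
  have B: "B \<in> carrier_mat (Suc n) (Suc n)" using WD A by (simp add: B_def)
  have hB: "hermitian B" unfolding B_def using hermitian_congruence[OF A Suc.prems(2) WD(1)] .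
  have Bsym: "conjugate (B $$ (j, i)) = B $$ (i, j)" if "i < Suc n" "j < Suc n" for i j
    using hB that B by (metis carrier_matD hermitian_def index_mat_adjoint)
  have B0: "B $$ (i, 0) = (if i = 0 then of_real e else 0)" if i: "i < Suc n" for i
  proof -
    have "A *\<^sub>v col W 0 = of_real e \<cdot>\<^sub>v col W 0"
      using v A unfolding c by (simp add: mult_mat_vec[of _ "Suc n" "Suc n"] smult_smult_assoc mult.commute)
    then have colAW: "col (A * W) 0 = of_real e \<cdot>\<^sub>v col W 0"
      using col_mult2[OF A WD(1), of 0] by simp
    have "B $$ (i, 0) = (mat_adjoint W * (A * W)) $$ (i, 0)"
      using A WD by (simp add: B_def assoc_mult_mat[of _ "Suc n" "Suc n" _ "Suc n" _ "Suc n"])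
    also have "\<dots> = row (mat_adjoint W) i \<bullet> col (A * W) 0"
      using A WD i by simp
    also have "\<dots> = of_real e * (row (mat_adjoint W) i \<bullet> col W 0)"
      unfolding colAW using WD i col_carrier_vec[of 0 "Suc n" W "Suc n"] by (intro scalar_prod_smult_distrib[of _ "Suc n"]) auto
    also have "row (mat_adjoint W) i \<bullet> col W 0 = (mat_adjoint W * W) $$ (i, 0)"
      using WD(1) i by simp
    finally show ?thesis using WD(2) i by simp
  qed
  define A3 where "A3 = mat n n (\<lambda>(i, j). B $$ (Suc i, Suc j))"
  have A3: "A3 \<in> carrier_mat n n" by (simp add: A3_def)
  have "hermitian A3"
    unfolding hermitian_def by (rule eq_matI) (auto simp: A3_def Bsym)
  then obtain Q3 d3 where Q3: "Q3 \<in> unitary_group n" "A3 = Q3 * diag_real n d3 * mat_adjoint Q3"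
    using Suc.IH[OF A3] by blast
  note Q3D = unitary_groupD[OF Q3(1)]
  define Q' where "Q' = four_block_mat (1\<^sub>m 1) (0\<^sub>m 1 n) (0\<^sub>m n 1) Q3"
  define d where "d = (\<lambda>i. case i of 0 \<Rightarrow> e | Suc j \<Rightarrow> d3 j)"
  have Q': "Q' \<in> carrier_mat (Suc n) (Suc n)"
    using four_block_carrier_mat[of "1\<^sub>m 1" 1 1 Q3 n n] Q3D by (simp add: Q'_def)
  have adjQ': "mat_adjoint Q' = four_block_mat (1\<^sub>m 1) (0\<^sub>m 1 n) (0\<^sub>m n 1) (mat_adjoint Q3)"
    unfolding Q'_def by (rule eq_matI) (use Q3D in auto)
  have D: "diag_real (Suc n) d = four_block_mat (diag_real 1 (\<lambda>_. e)) (0\<^sub>m 1 n) (0\<^sub>m n 1) (diag_real n d3)"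
    by (rule eq_matI) (auto simp: d_def split: nat.split)
  have "mat_adjoint Q' * Q' = four_block_mat (1\<^sub>m 1) (0\<^sub>m 1 n) (0\<^sub>m n 1) (1\<^sub>m n)"
    unfolding adjQ' unfolding Q'_def
    by (subst mult_four_block_mat[of _ 1 1 _ n _ n _ _ 1 _ n]) (use Q3D in auto)
  then have Q'U: "Q' \<in> unitary_group (Suc n)" using Q' by (simp add: unitary_group_def)
  \<comment> \<open>The first column is known from \<open>B0\<close>; Hermitian symmetry then clears
    the first row as well.\<close>
  have "B = four_block_mat (diag_real 1 (\<lambda>_. e)) (0\<^sub>m 1 n) (0\<^sub>m n 1) A3"
  proof (rule eq_matI)
    fix i j assume "i < dim_row (four_block_mat (diag_real 1 (\<lambda>_. e)) (0\<^sub>m 1 n) (0\<^sub>m n 1) A3)"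
      "j < dim_col (four_block_mat (diag_real 1 (\<lambda>_. e)) (0\<^sub>m 1 n) (0\<^sub>m n 1) A3)"
    then have ij: "i < Suc n" "j < Suc n" using A3 by auto
    then show "B $$ (i, j) = four_block_mat (diag_real 1 (\<lambda>_. e)) (0\<^sub>m 1 n) (0\<^sub>m n 1) A3 $$ (i, j)"
      using B0[of i] B0[of j] Bsym[of 0 j] A3 B by (cases i; cases j) (auto simp: A3_def)
  qed (use A3 B in auto)
  also have "\<dots> = Q' * diag_real (Suc n) d * mat_adjoint Q'"
    unfolding adjQ' D unfolding Q'_def
    apply (subst mult_four_block_mat[of _ 1 1 _ n _ n _ _ 1 _ n]; (use Q3D in simp)?)
    apply (subst mult_four_block_mat[of _ 1 1 _ n _ n _ _ 1 _ n]; (use Q3D in simp)?)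
    using Q3D Q3(2) by (auto intro!: cong_four_block_mat)
  finally have B': "B = Q' * diag_real (Suc n) d * mat_adjoint Q'" .
  have D': "diag_real (Suc n) d \<in> carrier_mat (Suc n) (Suc n)" by simp
  have "A = W * B * mat_adjoint W"
  proof -
    have "W * B = W * (mat_adjoint W * (A * W))"
      using A WD by (simp add: B_def assoc_mult_mat[of _ "Suc n" "Suc n" _ "Suc n" _ "Suc n"])
    also have "\<dots> = A * W"
      by (rule unitary_group_cancel(2)[OF W, where m = "Suc n"]) (use A WD in simp)
    finally have "W * B * mat_adjoint W = A * (W * mat_adjoint W)"
      using A WD by (simp add: assoc_mult_mat[of _ "Suc n" "Suc n" _ "Suc n" _ "Suc n"])
    then show ?thesis using A WD by simp
  qed
  also have "\<dots> = (W * Q') * diag_real (Suc n) d * mat_adjoint (W * Q')"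
    unfolding B' mat_adjoint_mult[OF WD(1) Q']
    using WD Q' mat_adjoint_carrier[OF Q'] D'
    by (simp add: assoc_mult_mat[of _ "Suc n" "Suc n" _ "Suc n" _ "Suc n"])
  finally show ?case using unitary_group_mult[OF W Q'U] by blast
qed

lemma char_poly_unitary_diag:
  fixes Q :: "'a::real_or_complex mat"
  assumes "Q \<in> unitary_group n"
  shows "char_poly (Q * diag_real n d * mat_adjoint Q) = (\<Prod>e\<leftarrow>map d [0..<n]. [:- of_real e, 1:])"
proof -
  note Q = unitary_groupD[OF assms]
  have "similar_mat (Q * diag_real n d * mat_adjoint Q) (diag_real n d)"
    by (rule similar_matI[of _ _ Q "mat_adjoint Q" n]) (use Q in auto)
  then have "char_poly (Q * diag_real n d * mat_adjoint Q) = char_poly (diag_real n d :: 'a mat)"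
    by (rule char_poly_similar)
  also have "\<dots> = (\<Prod>a\<leftarrow>diag_mat (diag_real n d). [:- a, 1:])"
    by (rule char_poly_upper_triangular[of _ n]) (auto simp: upper_triangular_def)
  also have "diag_mat (diag_real n d :: 'a mat) = map of_real (map d [0..<n])"
    by (auto simp: diag_mat_def)
  finally show ?thesis by (simp add: o_def)
qed

text \<open>Both sides have the same multiset of roots, and \<open>of_real\<close> is injective.
  Together with sortedness this makes the list described by \<open>THE\<close> in
  \<open>eigs\<close> unique.\<close>

lemma linear_factors_unique:
  assumes "(\<Prod>e\<leftarrow>es. [:- of_real e, 1 :: 'a::real_normed_field:]) = (\<Prod>e\<leftarrow>fs. [:- of_real e, 1:])"
  shows "mset es = mset fs"
proof -
  have *: "proots (\<Prod>e\<leftarrow>es. [:- of_real e, 1 :: 'a:]) = image_mset of_real (mset es)" for es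
  proof (induction es)
    case (Cons e es)
    have "(\<Prod>e\<leftarrow>es. [:- of_real e, 1 :: 'a:]) \<noteq> 0" by (auto simp: prod_list_zero_iff)
    then show ?case
      using Cons by (simp add: proots_mult del: mult_pCons_left)
  qed simp
  have "image_mset (of_real :: _ \<Rightarrow> 'a) (mset es) = image_mset of_real (mset fs)"
    using assms * by metis
  then show ?thesis
    by (rule multiset.inj_map_strong[rotated]) auto
qed

lemma eigs_eqI:
  fixes A :: "'a::real_normed_field mat"
  assumes "sorted_wrt (\<ge>) es" "char_poly A = (\<Prod>e\<leftarrow>es. [:- of_real e, 1:])"
  shows "eigs A = es"
  unfolding eigs_def
proof (rule the_equality)
  fix fs assume fs: "sorted_wrt (\<ge>) fs \<and> char_poly A = (\<Prod>e\<leftarrow>fs. [:- of_real e, 1:])"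
  then have "mset fs = mset es" using linear_factors_unique assms(2) by metis
  moreover have "sorted (rev fs)" "sorted (rev es)"
    using fs assms(1) by (auto simp: sorted_wrt_rev)
  ultimately have "rev fs = rev es"
    by (metis mset_rev properties_for_sort)
  then show "fs = es" by simp
qed (use assms in auto)

text \<open>The diagonalisation found before has its entries in arbitrary order, whereas
  \<open>eigs\<close> is sorted. The permutation that sorts the diagonal is applied to the columns
  of the eigenvector matrix.\<close>

theorem hermitian_spectral:
  fixes A :: "'a::real_or_complex mat"
  assumes "A \<in> carrier_mat n n" "hermitian A"
  obtains Q where "Q \<in> unitary_group n" "A = Q * diag_real n (\<lambda>i. eig (Suc i) A) * mat_adjoint Q"
proof -
  obtain Q d where Q: "Q \<in> unitary_group n" and A: "A = Q * diag_real n d * mat_adjoint Q"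
    using hermitian_unitarily_diagonalizable[OF assms] by blast
  note QD = unitary_groupD[OF Q]
  define es where "es = rev (sort (map d [0..<n]))"
  have len: "length es = n" by (simp add: es_def)
  have "mset es = mset (map d [0..<n])" by (simp add: es_def)
  then obtain p where p: "p permutes {..<n}" "permute_list p (map d [0..<n]) = es"
    using mset_eq_permutation[of es "map d [0..<n]"] by auto
  have es_nth: "es ! i = d (p i)" if "i < n" for i
    using p that permute_list_nth[of p "map d [0..<n]" i] permutes_in_image[OF p(1), of i] by auto
  have eigs: "eigs A = es"
  proof (rule eigs_eqI)
    show "sorted_wrt (\<ge>) es" unfolding es_def by (simp add: sorted_wrt_rev)
    have "mset (map (\<lambda>e. [:- of_real e, 1 :: 'a:]) es) = mset (map (\<lambda>e. [:- of_real e, 1:]) (map d [0..<n]))"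
      unfolding mset_map by (simp add: es_def)
    then show "char_poly A = (\<Prod>e\<leftarrow>es. [:- of_real e, 1:])"
      unfolding A char_poly_unitary_diag[OF Q] by (metis prod_mset_prod_list)
  qed
  have eig: "eig (Suc i) A = d (p i)" if "i < n" for i
    using es_nth[OF that] by (simp add: eig_def eigs)
  define R where "R = mat n n (\<lambda>(i, j). Q $$ (i, p j))"
  have pn: "p i < n" if "i < n" for i using permutes_in_image[OF p(1), of i] that by auto
  have R: "R \<in> carrier_mat n n" by (simp add: R_def)
  have "mat_adjoint R * R = 1\<^sub>m n"
  proof (rule eq_matI)
    fix i j assume "i < dim_row (1\<^sub>m n :: 'a mat)" "j < dim_col (1\<^sub>m n :: 'a mat)"
    then have ij: "i < n" "j < n" by auto
    have "(mat_adjoint R * R) $$ (i, j) = (mat_adjoint Q * Q) $$ (p i, p j)"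
      using ij pn QD(1) R by (simp add: scalar_prod_def) (simp add: R_def)
    also have "\<dots> = 1\<^sub>m n $$ (i, j)"
      unfolding QD(2) using ij pn permutes_inj[OF p(1)] by (simp add: inj_eq)
    finally show "(mat_adjoint R * R) $$ (i, j) = 1\<^sub>m n $$ (i, j)" .
  qed (use R in auto)
  then have RU: "R \<in> unitary_group n" using R by (simp add: unitary_group_def)
  have "A = R * diag_real n (\<lambda>i. eig (Suc i) A) * mat_adjoint R"
  proof (rule eq_matI)
    fix i j assume "i < dim_row (R * diag_real n (\<lambda>i. eig (Suc i) A) * mat_adjoint R)"
      "j < dim_col (R * diag_real n (\<lambda>i. eig (Suc i) A) * mat_adjoint R)"
    then have ij: "i < n" "j < n" using R by auto
    have "(Q * diag_real n d * mat_adjoint Q) $$ (i, j)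
        = (\<Sum>k<n. Q $$ (i, k) * of_real (d k) * conjugate (Q $$ (j, k)))"
      unfolding diag_real_mult_right[OF QD(1)]
      using ij QD by (auto simp: scalar_prod_def lessThan_atLeast0)
    also have "\<dots> = (\<Sum>k<n. Q $$ (i, p k) * of_real (d (p k)) * conjugate (Q $$ (j, p k)))"
      by (rule sum.permute[OF p(1), unfolded o_def])
    also have "\<dots> = (R * diag_real n (\<lambda>i. eig (Suc i) A) * mat_adjoint R) $$ (i, j)"
      unfolding diag_real_mult_right[OF R]
      using ij R by (auto simp: scalar_prod_def lessThan_atLeast0 eig R_def intro!: sum.cong)
    finally show "A $$ (i, j) = (R * diag_real n (\<lambda>i. eig (Suc i) A) * mat_adjoint R) $$ (i, j)"
      using A by metis
  qed (use R assms in auto)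
  with RU show ?thesis by (rule that)
qed

lemma
  fixes A :: "'a::real_or_complex mat"
  assumes "A \<in> carrier_mat n n" "hermitian A"
  shows length_eigs: "length (eigs A) = n" and eig_antimono: "i \<le> j \<Longrightarrow> j < n \<Longrightarrow> eig (Suc j) A \<le> eig (Suc i) A"
proof -
  obtain Q d where Q: "Q \<in> unitary_group n" and A: "A = Q * diag_real n d * mat_adjoint Q"
    using hermitian_unitarily_diagonalizable[OF assms] by blast
  define es where "es = rev (sort (map d [0..<n]))"
  have s: "sorted_wrt (\<ge>) es" unfolding es_def by (simp add: sorted_wrt_rev)
  have eigs: "eigs A = es"
  proof (rule eigs_eqI[OF s])
    have "mset (map (\<lambda>e. [:- of_real e, 1 :: 'a:]) es) = mset (map (\<lambda>e. [:- of_real e, 1:]) (map d [0..<n]))"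
      unfolding mset_map by (simp add: es_def)
    then show "char_poly A = (\<Prod>e\<leftarrow>es. [:- of_real e, 1:])"
      unfolding A char_poly_unitary_diag[OF Q] by (metis prod_mset_prod_list)
  qed
  show "length (eigs A) = n" by (simp add: eigs es_def)
  show "i \<le> j \<Longrightarrow> j < n \<Longrightarrow> eig (Suc j) A \<le> eig (Suc i) A"
    using s unfolding eig_def eigs by (cases "i = j") (auto simp: sorted_wrt_iff_nth_less es_def)
qed

lemma mult_mat_vec_carrier_square [simp]:
  "A \<in> carrier_mat n n \<Longrightarrow> v \<in> carrier_vec n \<Longrightarrow> A *\<^sub>v v \<in> carrier_vec n"
  by (rule mult_mat_vec_carrier)

section \<open>Quadratic forms and the Courant-Fischer principle\<close>

definition quad_form :: "'a::real_or_complex mat \<Rightarrow> 'a vec \<Rightarrow> real" where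
  "quad_form A x = re ((A *\<^sub>v x) \<bullet>c x)"

lemma diag_real_form:
  assumes "u \<in> carrier_vec n"
  shows "(diag_real n d *\<^sub>v u) \<bullet>c u = of_real (\<Sum>k<n. d k * (norm (u $ k))\<^sup>2)"
proof -
  have "(diag_real n d *\<^sub>v u) \<bullet>c u = (\<Sum>k<n. of_real (d k) * (u $ k * conjugate (u $ k)))"
    using assms unfolding diag_real_mult_vec[OF assms]
    by (auto simp: scalar_prod_def lessThan_atLeast0 mult.assoc intro!: sum.cong)
  then show ?thesis by (simp add: mult_conjugate)
qed

lemma unitary_diag_form:
  fixes Q :: "'a::real_or_complex mat"
  assumes Q: "Q \<in> unitary_group n" and x: "x \<in> carrier_vec n"
  shows "((Q * diag_real n d * mat_adjoint Q) *\<^sub>v x) \<bullet>c x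
      = of_real (\<Sum>k<n. d k * (norm ((mat_adjoint Q *\<^sub>v x) $ k))\<^sup>2)"
proof -
  note QD = unitary_groupD[OF Q]
  have D: "(diag_real n d :: 'a mat) \<in> carrier_mat n n" by simp
  have u: "mat_adjoint Q *\<^sub>v x \<in> carrier_vec n" using QD x by simp
  have "(Q * diag_real n d * mat_adjoint Q) *\<^sub>v x = Q *\<^sub>v (diag_real n d *\<^sub>v (mat_adjoint Q *\<^sub>v x))"
    using QD x u by (simp add: assoc_mult_mat_vec[of _ n n _ n])
  then show ?thesis
    using cscalar_mult_mat_vec[OF QD(1), of "diag_real n d *\<^sub>v (mat_adjoint Q *\<^sub>v x)" x]
      diag_real_form[OF u] u x mult_mat_vec_carrier[OF D u] by simp
qed

lemma quad_form_unitary_diag: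
  fixes Q :: "'a::real_or_complex mat"
  assumes "Q \<in> unitary_group n" and "x \<in> carrier_vec n"
  shows "quad_form (Q * diag_real n d * mat_adjoint Q) x
      = (\<Sum>k<n. d k * (norm ((mat_adjoint Q *\<^sub>v x) $ k))\<^sup>2)"
  unfolding quad_form_def unitary_diag_form[OF assms] by (simp only: re_of_real)

lemma norm_sq_unitary_coords:
  fixes Q :: "'a::real_or_complex mat"
  assumes Q: "Q \<in> unitary_group n" and x: "x \<in> carrier_vec n"
  shows "(\<Sum>k<n. (norm ((mat_adjoint Q *\<^sub>v x) $ k))\<^sup>2) = norm_sq x"
  using norm_sq_isometry[OF unitary_group_adjoint[OF Q] x] unitary_groupD[OF Q]
  by (simp add: norm_sq_def)

text \<open>Padding \<open>C\<close> with zero rows gives a square matrix whose transpose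
  annihilates the unit vector \<open>r\<close>; so its determinant vanishes and it has a kernel
  vector, which lies in the kernel of \<open>C\<close>.\<close>

lemma ex_nonzero_kernel_vec:
  fixes C :: "'a::field mat"
  assumes C: "C \<in> carrier_mat r m" and "r < m"
  obtains v where "v \<in> carrier_vec m" "v \<noteq> 0\<^sub>v m" "C *\<^sub>v v = 0\<^sub>v r"
proof -
  define G where "G = mat m m (\<lambda>(i, j). if i < r then C $$ (i, j) else 0)"
  have G: "G \<in> carrier_mat m m" by (simp add: G_def)
  have "transpose_mat G *\<^sub>v unit_vec m r = 0\<^sub>v m"
    using \<open>r < m\<close> by (intro eq_vecI) (auto simp: G_def)
  moreover have "unit_vec m r \<noteq> (0\<^sub>v m :: 'a vec)"
    using \<open>r < m\<close> by (metis index_unit_vec(2) index_zero_vec(1) zero_neq_one)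
  ultimately have "det (transpose_mat G) = 0"
    using det_0_iff_vec_prod_zero_field[of "transpose_mat G" m] G unit_vec_carrier[of m r]
    by (metis transpose_carrier_mat)
  then have "det G = 0" using det_transpose[OF G] by simp
  then obtain v where v: "v \<in> carrier_vec m" "v \<noteq> 0\<^sub>v m" "G *\<^sub>v v = 0\<^sub>v m"
    using det_0_iff_vec_prod_zero_field[OF G] by auto
  have "C *\<^sub>v v = 0\<^sub>v r"
  proof (rule eq_vecI)
    fix i assume "i < dim_vec (0\<^sub>v r :: 'a vec)"
    then have i: "i < r" by simp
    have "row G i = row C i" using i C \<open>r < m\<close> by (intro eq_vecI) (auto simp: G_def)
    then have "(C *\<^sub>v v) $ i = (G *\<^sub>v v) $ i" using i C G \<open>r < m\<close> by simp
    then show "(C *\<^sub>v v) $ i = 0\<^sub>v r $ i" using v i \<open>r < m\<close> by simp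
  qed (use C in simp)
  with v show ?thesis by (intro that)
qed

lemma ex_nonzero_kernel_vec2:
  fixes C :: "'a::field mat"
  assumes C: "C \<in> carrier_mat r m" and R: "R \<in> carrier_mat s m" and "r + s < m"
  obtains v where "v \<in> carrier_vec m" "v \<noteq> 0\<^sub>v m" "C *\<^sub>v v = 0\<^sub>v r" "R *\<^sub>v v = 0\<^sub>v s"
proof -
  have "C @\<^sub>r R \<in> carrier_mat (r + s) m"
    using C R by (rule carrier_append_rows)
  from ex_nonzero_kernel_vec[OF this \<open>r + s < m\<close>] obtain v where
    v: "v \<in> carrier_vec m" "v \<noteq> 0\<^sub>v m" "(C @\<^sub>r R) *\<^sub>v v = 0\<^sub>v (r + s)" by blast
  have "(C @\<^sub>r R) *\<^sub>v v = (C *\<^sub>v v) @\<^sub>v (R *\<^sub>v v)"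
    by (rule mat_mult_append[OF C R v(1)])
  moreover have "(0\<^sub>v (r + s) :: 'a vec) = 0\<^sub>v r @\<^sub>v 0\<^sub>v s" by auto
  ultimately have "(C *\<^sub>v v) @\<^sub>v (R *\<^sub>v v) = 0\<^sub>v r @\<^sub>v 0\<^sub>v s" using v by simp
  then have "C *\<^sub>v v = 0\<^sub>v r \<and> R *\<^sub>v v = 0\<^sub>v s"
    using append_vec_eq[of "C *\<^sub>v v" r "0\<^sub>v r"] C v by simp
  with v show ?thesis by (intro that) auto
qed

text \<open>Courant-Fischer, with the trial space presented as the image under \<open>L\<close> of
  the kernel of \<open>C\<close>. That kernel is cut out by \<open>r\<close> equations; the
  vanishing of the first \<open>k - 1\<close> coordinates in an eigenbasis of \<open>A\<close> adds
  \<open>k - 1\<close> more, fewer than \<open>m\<close> in total. On a common solution the form is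
  at most \<open>eig k A\<close> times the squared norm. The nonvanishing of
  \<open>L *\<^sub>v b\<close> ensures that the trial vector is usable.\<close>

lemma eig_ge:
  fixes A :: "'a::real_or_complex mat"
  assumes A: "A \<in> carrier_mat n n" "hermitian A" and k: "1 \<le> k" "k \<le> n"
    and L: "L \<in> carrier_mat n m" and C: "C \<in> carrier_mat r m" and "r + k \<le> m"
    and hyp: "\<And>b. b \<in> carrier_vec m \<Longrightarrow> b \<noteq> 0\<^sub>v m \<Longrightarrow> C *\<^sub>v b = 0\<^sub>v r \<Longrightarrow>
      L *\<^sub>v b \<noteq> 0\<^sub>v n \<and> t * norm_sq (L *\<^sub>v b) \<le> quad_form A (L *\<^sub>v b)"
  shows "t \<le> eig k A"
proof (rule ccontr)
  assume less: "\<not> t \<le> eig k A"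
  obtain Q where Q: "Q \<in> unitary_group n" and AQ: "A = Q * diag_real n (\<lambda>i. eig (Suc i) A) * mat_adjoint Q"
    using hermitian_spectral[OF A] .
  note QD = unitary_groupD[OF Q]
  define R where "R = mat (k - 1) m (\<lambda>(i, j). (mat_adjoint Q * L) $$ (i, j))"
  have R: "R \<in> carrier_mat (k - 1) m" by (simp add: R_def)
  obtain b where b: "b \<in> carrier_vec m" "b \<noteq> 0\<^sub>v m" "C *\<^sub>v b = 0\<^sub>v r" "R *\<^sub>v b = 0\<^sub>v (k - 1)"
    by (rule ex_nonzero_kernel_vec2[OF C R]) (use k \<open>r + k \<le> m\<close> in auto)
  define x where "x = L *\<^sub>v b"
  have x: "x \<in> carrier_vec n" using L b by (simp add: x_def)
  have QL: "mat_adjoint Q *\<^sub>v x = (mat_adjoint Q * L) *\<^sub>v b"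
    using QD L b by (simp add: x_def assoc_mult_mat_vec[of _ n n _ m])
  have zero: "(mat_adjoint Q *\<^sub>v x) $ i = 0" if "i < k - 1" for i
  proof -
    have "row R i = row (mat_adjoint Q * L) i"
      using that k QD L by (intro eq_vecI) (auto simp: R_def)
    moreover have "i < dim_row R" "i < dim_row (mat_adjoint Q * L)" using that R k QD by auto
    ultimately have "(R *\<^sub>v b) $ i = ((mat_adjoint Q * L) *\<^sub>v b) $ i"
      by (simp only: index_mult_mat_vec)
    then show ?thesis unfolding QL using b that by simp
  qed
  have "quad_form A x = (\<Sum>i<n. eig (Suc i) A * (norm ((mat_adjoint Q *\<^sub>v x) $ i))\<^sup>2)"
    using quad_form_unitary_diag[OF Q x] AQ by metis
  also have "\<dots> \<le> (\<Sum>i<n. eig k A * (norm ((mat_adjoint Q *\<^sub>v x) $ i))\<^sup>2)"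
  proof (rule sum_mono)
    fix i assume "i \<in> {..<n}"
    then show "eig (Suc i) A * (norm ((mat_adjoint Q *\<^sub>v x) $ i))\<^sup>2
        \<le> eig k A * (norm ((mat_adjoint Q *\<^sub>v x) $ i))\<^sup>2"
      using zero[of i] eig_antimono[OF A, of "k - 1" i] k
      by (cases "i < k - 1") (auto intro!: mult_right_mono)
  qed
  also have "\<dots> = eig k A * norm_sq x"
    by (simp add: norm_sq_unitary_coords[OF Q x] flip: sum_distrib_left)
  finally have "quad_form A x \<le> eig k A * norm_sq x" .
  moreover have "x \<noteq> 0\<^sub>v n" "t * norm_sq x \<le> quad_form A x"
    using hyp[OF b(1-3)] by (auto simp: x_def)
  moreover have "norm_sq x > 0"
    using norm_sq_eq_0_iff[OF x] \<open>x \<noteq> 0\<^sub>v n\<close> by (simp add: less_le)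
  ultimately have "norm_sq x > 0" "t * norm_sq x \<le> eig k A * norm_sq x"
    by (blast intro: order.trans)+
  then show False using less by simp
qed

text \<open>The mirror image of \<open>eig_ge\<close>: here the coordinates with zero-based index at
  least \<open>k\<close> are made to vanish, which costs \<open>n - k\<close> equations.\<close>

lemma eig_le:
  fixes A :: "'a::real_or_complex mat"
  assumes A: "A \<in> carrier_mat n n" "hermitian A" and k: "1 \<le> k" "k \<le> n"
    and L: "L \<in> carrier_mat n m" and C: "C \<in> carrier_mat r m" and "r + n < m + k"
    and hyp: "\<And>b. b \<in> carrier_vec m \<Longrightarrow> b \<noteq> 0\<^sub>v m \<Longrightarrow> C *\<^sub>v b = 0\<^sub>v r \<Longrightarrow>
      L *\<^sub>v b \<noteq> 0\<^sub>v n \<and> quad_form A (L *\<^sub>v b) \<le> t * norm_sq (L *\<^sub>v b)"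
  shows "eig k A \<le> t"
proof (rule ccontr)
  assume less: "\<not> eig k A \<le> t"
  obtain Q where Q: "Q \<in> unitary_group n" and AQ: "A = Q * diag_real n (\<lambda>i. eig (Suc i) A) * mat_adjoint Q"
    using hermitian_spectral[OF A] .
  note QD = unitary_groupD[OF Q]
  define R where "R = mat (n - k) m (\<lambda>(i, j). (mat_adjoint Q * L) $$ (k + i, j))"
  have R: "R \<in> carrier_mat (n - k) m" by (simp add: R_def)
  obtain b where b: "b \<in> carrier_vec m" "b \<noteq> 0\<^sub>v m" "C *\<^sub>v b = 0\<^sub>v r" "R *\<^sub>v b = 0\<^sub>v (n - k)"
    by (rule ex_nonzero_kernel_vec2[OF C R]) (use k \<open>r + n < m + k\<close> in auto)
  define x where "x = L *\<^sub>v b"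
  have x: "x \<in> carrier_vec n" using L b by (simp add: x_def)
  have QL: "mat_adjoint Q *\<^sub>v x = (mat_adjoint Q * L) *\<^sub>v b"
    using QD L b by (simp add: x_def assoc_mult_mat_vec[of _ n n _ m])
  have zero: "(mat_adjoint Q *\<^sub>v x) $ i = 0" if i: "k \<le> i" "i < n" for i
  proof -
    have "row R (i - k) = row (mat_adjoint Q * L) i"
      using i k QD L by (intro eq_vecI) (auto simp: R_def)
    moreover have "i - k < dim_row R" "i < dim_row (mat_adjoint Q * L)" using i R k QD by auto
    ultimately have "(R *\<^sub>v b) $ (i - k) = ((mat_adjoint Q * L) *\<^sub>v b) $ i"
      by (simp only: index_mult_mat_vec)
    then show ?thesis unfolding QL using b i by simp
  qed
  have "eig k A * norm_sq x = (\<Sum>i<n. eig k A * (norm ((mat_adjoint Q *\<^sub>v x) $ i))\<^sup>2)"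
    by (simp add: norm_sq_unitary_coords[OF Q x] flip: sum_distrib_left)
  also have "\<dots> \<le> (\<Sum>i<n. eig (Suc i) A * (norm ((mat_adjoint Q *\<^sub>v x) $ i))\<^sup>2)"
  proof (rule sum_mono)
    fix i assume "i \<in> {..<n}"
    then show "eig k A * (norm ((mat_adjoint Q *\<^sub>v x) $ i))\<^sup>2
        \<le> eig (Suc i) A * (norm ((mat_adjoint Q *\<^sub>v x) $ i))\<^sup>2"
      using zero[of i] eig_antimono[OF A, of i "k - 1"] k
      by (cases "k \<le> i") (auto intro!: mult_right_mono)
  qed
  also have "\<dots> = quad_form A x"
    using quad_form_unitary_diag[OF Q x] AQ by metis
  finally have "eig k A * norm_sq x \<le> quad_form A x" .
  moreover have "x \<noteq> 0\<^sub>v n" "quad_form A x \<le> t * norm_sq x"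
    using hyp[OF b(1-3)] by (auto simp: x_def)
  moreover have "norm_sq x > 0"
    using norm_sq_eq_0_iff[OF x] \<open>x \<noteq> 0\<^sub>v n\<close> by (simp add: less_le)
  ultimately have "norm_sq x > 0" "eig k A * norm_sq x \<le> t * norm_sq x"
    by (blast intro: order.trans)+
  then show False using less by simp
qed

text \<open>Weyl's inequality. The trial space is the orthogonal complement of the first
  \<open>k - 1\<close> eigenvectors of \<open>B\<close>, where the form of \<open>B\<close> is at
  most \<open>eig k B\<close>.\<close>

lemma eig_le_perturb:
  fixes A B :: "'a::real_or_complex mat"
  assumes A: "A \<in> carrier_mat n n" "hermitian A" and B: "B \<in> carrier_mat n n" "hermitian B"
    and k: "1 \<le> k" "k \<le> n"
    and le: "\<And>x. x \<in> carrier_vec n \<Longrightarrow> quad_form A x \<le> quad_form B x + c * norm_sq x"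
  shows "eig k A \<le> eig k B + c"
proof -
  obtain Q where Q: "Q \<in> unitary_group n" and BQ: "B = Q * diag_real n (\<lambda>i. eig (Suc i) B) * mat_adjoint Q"
    using hermitian_spectral[OF B] .
  note QD = unitary_groupD[OF Q]
  define R where "R = mat (k - 1) n (\<lambda>(i, j). mat_adjoint Q $$ (i, j))"
  have R: "R \<in> carrier_mat (k - 1) n" by (simp add: R_def)
  show ?thesis
  proof (rule eig_le[OF A k, of "1\<^sub>m n" n, OF _ R])
    fix x :: "'a vec" assume x: "x \<in> carrier_vec n" "x \<noteq> 0\<^sub>v n" "R *\<^sub>v x = 0\<^sub>v (k - 1)"
    have zero: "(mat_adjoint Q *\<^sub>v x) $ i = 0" if i: "i < k - 1" for i
    proof -
      have "row R i = row (mat_adjoint Q) i"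
        using i k QD by (intro eq_vecI) (auto simp: R_def)
      then have "(R *\<^sub>v x) $ i = (mat_adjoint Q *\<^sub>v x) $ i"
        using i R k QD by simp
      then show ?thesis using x i by simp
    qed
    have "quad_form B x = (\<Sum>i<n. eig (Suc i) B * (norm ((mat_adjoint Q *\<^sub>v x) $ i))\<^sup>2)"
      using quad_form_unitary_diag[OF Q x(1)] BQ by metis
    also have "\<dots> \<le> (\<Sum>i<n. eig k B * (norm ((mat_adjoint Q *\<^sub>v x) $ i))\<^sup>2)"
    proof (rule sum_mono)
      fix i assume "i \<in> {..<n}"
      then show "eig (Suc i) B * (norm ((mat_adjoint Q *\<^sub>v x) $ i))\<^sup>2
          \<le> eig k B * (norm ((mat_adjoint Q *\<^sub>v x) $ i))\<^sup>2"
        using zero[of i] eig_antimono[OF B, of "k - 1" i] k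
        by (cases "i < k - 1") (auto intro!: mult_right_mono)
    qed
    also have "\<dots> = eig k B * norm_sq x"
      by (simp add: norm_sq_unitary_coords[OF Q x(1)] flip: sum_distrib_left)
    finally show "1\<^sub>m n *\<^sub>v x \<noteq> 0\<^sub>v n \<and> quad_form A (1\<^sub>m n *\<^sub>v x) \<le> (eig k B + c) * norm_sq (1\<^sub>m n *\<^sub>v x)"
      using x le[OF x(1)] by (simp add: algebra_simps)
  qed (use k in auto)
qed

text \<open>The crude bound by the sum of the entries is chosen because it is visibly measurable in
  the matrix; its only purpose is continuity of the eigenvalues.\<close>

lemma abs_quad_form_le:
  fixes A :: "'a::real_or_complex mat"
  assumes A: "A \<in> carrier_mat n n" and x: "x \<in> carrier_vec n"
  shows "\<bar>quad_form A x\<bar> \<le> (\<Sum>i<n. \<Sum>j<n. norm (A $$ (i, j))) * norm_sq x"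
proof -
  have le: "norm (x $ i) * norm (x $ j) \<le> norm_sq x" if "i < n" "j < n" for i j
  proof -
    have i: "(norm (x $ i))\<^sup>2 \<le> norm_sq x" if "i < n" for i
      unfolding norm_sq_def using that x by (intro member_le_sum) auto
    have "norm (x $ i) * norm (x $ j) \<le> ((norm (x $ i))\<^sup>2 + (norm (x $ j))\<^sup>2) / 2"
      using sum_squares_bound[of "norm (x $ i)" "norm (x $ j)"] by simp
    also have "\<dots> \<le> (norm_sq x + norm_sq x) / 2"
      by (intro divide_right_mono add_mono i that) simp
    finally show ?thesis by simp
  qed
  have "\<bar>quad_form A x\<bar> \<le> norm ((A *\<^sub>v x) \<bullet>c x)"
    unfolding quad_form_def by (rule abs_re_le_norm)
  also have "(A *\<^sub>v x) \<bullet>c x = (\<Sum>i<n. (\<Sum>j<n. A $$ (i, j) * x $ j) * conjugate (x $ i))"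
    using A x by (auto simp: scalar_prod_def lessThan_atLeast0 intro!: sum.cong)
  also have "norm \<dots> \<le> (\<Sum>i<n. \<Sum>j<n. norm (A $$ (i, j)) * (norm (x $ j) * norm (x $ i)))"
  proof (rule order.trans[OF norm_sum], rule sum_mono)
    fix i assume "i \<in> {..<n}"
    show "norm ((\<Sum>j<n. A $$ (i, j) * x $ j) * conjugate (x $ i))
        \<le> (\<Sum>j<n. norm (A $$ (i, j)) * (norm (x $ j) * norm (x $ i)))"
      unfolding sum_distrib_right
      by (rule order.trans[OF norm_sum]) (simp add: norm_mult mult.assoc)
  qed
  also have "\<dots> \<le> (\<Sum>i<n. \<Sum>j<n. norm (A $$ (i, j)) * norm_sq x)"
    by (intro sum_mono mult_left_mono le) auto
  finally show ?thesis by (simp add: sum_distrib_right)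
qed

lemma quad_form_diff:
  fixes A B :: "'a::real_or_complex mat"
  assumes A: "A \<in> carrier_mat n n" and B: "B \<in> carrier_mat n n" and x: "x \<in> carrier_vec n"
  shows "quad_form (A - B) x = quad_form A x - quad_form B x"
proof -
  have "(A - B) *\<^sub>v x = A *\<^sub>v x - B *\<^sub>v x"
    using A B x by (rule minus_mult_distrib_mat_vec)
  then show ?thesis
    unfolding quad_form_def
    using A B x minus_scalar_prod_distrib[of "A *\<^sub>v x" n "B *\<^sub>v x" "conjugate x"] by (simp add: re_diff)
qed

lemma eig_diff_le:
  fixes A B :: "'a::real_or_complex mat"
  assumes A: "A \<in> carrier_mat n n" "hermitian A" and B: "B \<in> carrier_mat n n" "hermitian B"
    and k: "1 \<le> k" "k \<le> n"
  shows "eig k A \<le> eig k B + (\<Sum>i<n. \<Sum>j<n. norm (A $$ (i, j) - B $$ (i, j)))"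
proof (rule eig_le_perturb[OF A B k])
  fix x :: "'a vec" assume x: "x \<in> carrier_vec n"
  have "\<bar>quad_form (A - B) x\<bar> \<le> (\<Sum>i<n. \<Sum>j<n. norm ((A - B) $$ (i, j))) * norm_sq x"
    by (rule abs_quad_form_le) (use A B x in auto)
  also have "(\<Sum>i<n. \<Sum>j<n. norm ((A - B) $$ (i, j))) = (\<Sum>i<n. \<Sum>j<n. norm (A $$ (i, j) - B $$ (i, j)))"
    using A B by (intro sum.cong) auto
  finally show "quad_form A x \<le> quad_form B x + (\<Sum>i<n. \<Sum>j<n. norm (A $$ (i, j) - B $$ (i, j))) * norm_sq x"
    using quad_form_diff[OF A(1) B(1) x] by simp
qed

section \<open>Functional calculus: positivity and the square root\<close>

lemma unitary_diag_carrier [simp]: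
  fixes Q :: "'a::real_or_complex mat"
  shows "Q \<in> unitary_group n \<Longrightarrow> Q * diag_real n d * mat_adjoint Q \<in> carrier_mat n n"
  using unitary_groupD[of Q n] by simp

lemma hermitian_unitary_diag [simp]:
  fixes Q :: "'a::real_or_complex mat"
  assumes "Q \<in> unitary_group n"
  shows "hermitian (Q * diag_real n d * mat_adjoint Q)"
  using hermitian_congruence[of "diag_real n d" n "mat_adjoint Q" n] unitary_groupD[OF assms]
  by (simp add: hermitian_def)

lemma psd_unitary_diag:
  fixes Q :: "'a::real_or_complex mat"
  assumes Q: "Q \<in> unitary_group n" and d: "\<And>i. i < n \<Longrightarrow> 0 \<le> d i"
  shows "psd (Q * diag_real n d * mat_adjoint Q)"
proof -
  have "0 \<le> ((Q * diag_real n d * mat_adjoint Q) *\<^sub>v v) \<bullet>c v" if "v \<in> carrier_vec n" for v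
    unfolding unitary_diag_form[OF Q that] of_real_nonneg_iff using d by (intro sum_nonneg) auto
  then show ?thesis using hermitian_unitary_diag[OF Q] unitary_groupD(1)[OF Q] by (simp add: psd_def)
qed

lemma psd_quad_form_nonneg:
  fixes A :: "'a::real_or_complex mat"
  assumes "psd A" "A \<in> carrier_mat n n" "v \<in> carrier_vec n"
  shows "0 \<le> quad_form A v"
proof -
  have "0 \<le> (A *\<^sub>v v) \<bullet>c v" using assms by (auto simp: psd_def)
  then have "to_complex (0 :: 'a) \<le> to_complex ((A *\<^sub>v v) \<bullet>c v)" by (simp only: to_complex_le_iff)
  then show ?thesis by (simp add: quad_form_def re_def less_eq_complex_def)
qed

lemma eig_nonneg:
  fixes A :: "'a::real_or_complex mat"
  assumes A: "A \<in> carrier_mat n n" "hermitian A" and k: "1 \<le> k" "k \<le> n"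
    and nonneg: "\<And>x. x \<in> carrier_vec n \<Longrightarrow> 0 \<le> quad_form A x"
  shows "0 \<le> eig k A"
proof (rule eig_ge[OF A k, of "1\<^sub>m n" n "0\<^sub>m 0 n" 0])
  fix b :: "'a vec" assume "b \<in> carrier_vec n" "b \<noteq> 0\<^sub>v n"
  then show "1\<^sub>m n *\<^sub>v b \<noteq> 0\<^sub>v n \<and> 0 * norm_sq (1\<^sub>m n *\<^sub>v b) \<le> quad_form A (1\<^sub>m n *\<^sub>v b)"
    using nonneg by simp
qed (use k in auto)

lemma unitary_diag_mult:
  fixes Q :: "'a::real_or_complex mat"
  assumes Q: "Q \<in> unitary_group n"
  shows "(Q * diag_real n a * mat_adjoint Q) * (Q * diag_real n b * mat_adjoint Q)
      = Q * diag_real n (\<lambda>i. a i * b i) * mat_adjoint Q"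
proof -
  note QD = unitary_groupD[OF Q]
  have D: "(diag_real n a :: 'a mat) \<in> carrier_mat n n" "(diag_real n b :: 'a mat) \<in> carrier_mat n n" by auto
  have "(Q * diag_real n a * mat_adjoint Q) * (Q * diag_real n b * mat_adjoint Q)
      = Q * diag_real n a * (mat_adjoint Q * (Q * (diag_real n b * mat_adjoint Q)))"
    using QD D by (simp add: assoc_mult_mat[of _ n n _ n _ n])
  also have "mat_adjoint Q * (Q * (diag_real n b * mat_adjoint Q)) = diag_real n b * mat_adjoint Q"
    by (rule unitary_group_cancel(1)[OF Q, where m = n]) (use QD in simp)
  also have "Q * diag_real n a * (diag_real n b * mat_adjoint Q) = Q * (diag_real n a * diag_real n b) * mat_adjoint Q"
    using QD D by (simp add: assoc_mult_mat[of _ n n _ n _ n])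
  finally show ?thesis by (simp add: diag_real_mult)
qed

text \<open>With \<open>X\<close> the change of basis between the two eigenbases, equality of the
  squares says that t_i^2 X_ij = X_ij s_j^2. Where X_ij is nonzero, nonnegativity gives t_i = s_j,
  so the same relation holds without squares. This makes the \<open>THE\<close> in
  \<open>mat_sqrt\<close> well defined.\<close>

lemma psd_square_unique:
  fixes S T :: "'a::real_or_complex mat"
  assumes S: "S \<in> carrier_mat n n" "psd S" and T: "T \<in> carrier_mat n n" "psd T" and eq: "S * S = T * T"
  shows "S = T"
proof -
  have hS: "hermitian S" and hT: "hermitian T" using S T by (auto simp: psd_def)
  obtain F where F: "F \<in> unitary_group n" and S': "S = F * diag_real n (\<lambda>i. eig (Suc i) S) * mat_adjoint F"
    using hermitian_spectral[OF S(1) hS] .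
  obtain G where G: "G \<in> unitary_group n" and T': "T = G * diag_real n (\<lambda>i. eig (Suc i) T) * mat_adjoint G"
    using hermitian_spectral[OF T(1) hT] .
  define s where "s = (\<lambda>i. eig (Suc i) S)"
  define t where "t = (\<lambda>i. eig (Suc i) T)"
  note FD = unitary_groupD[OF F] and GD = unitary_groupD[OF G]
  have nn: "0 \<le> s i" "0 \<le> t i" if "i < n" for i
    unfolding s_def t_def using that
    by (auto intro!: eig_nonneg[OF S(1) hS] eig_nonneg[OF T(1) hT] psd_quad_form_nonneg[OF S(2,1)]
        psd_quad_form_nonneg[OF T(2,1)])
  define X where "X = mat_adjoint G * F"
  have X: "X \<in> carrier_mat n n" using FD GD by (simp add: X_def)
  have cancel: "mat_adjoint G * (G * diag_real n d * mat_adjoint G) * F = diag_real n d * X" for d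
  proof -
    have D: "(diag_real n d :: 'a mat) \<in> carrier_mat n n" by auto
    have "mat_adjoint G * (G * diag_real n d * mat_adjoint G) = mat_adjoint G * (G * (diag_real n d * mat_adjoint G))"
      using GD D by (simp add: assoc_mult_mat[of _ n n _ n _ n])
    also have "\<dots> = diag_real n d * mat_adjoint G"
      by (rule unitary_group_cancel(1)[OF G, where m = n]) (use GD in simp)
    finally show ?thesis using GD FD D by (simp add: X_def assoc_mult_mat[of _ n n _ n _ n])
  qed
  have cancel': "mat_adjoint G * (F * diag_real n d * mat_adjoint F) * F = X * diag_real n d" for d
  proof -
    have D: "(diag_real n d :: 'a mat) \<in> carrier_mat n n" by auto
    have "mat_adjoint G * (F * diag_real n d * mat_adjoint F) * F
        = mat_adjoint G * F * diag_real n d * (mat_adjoint F * F)"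
      using GD(1,4) FD(1,4) D by (simp add: assoc_mult_mat[of _ n n _ n _ n])
    also have "\<dots> = mat_adjoint G * F * diag_real n d"
      unfolding FD(2) by (rule right_mult_one_mat[of _ n n]) (use GD(1,4) FD(1,4) D in simp)
    finally show ?thesis by (simp only: X_def)
  qed
  have "diag_real n (\<lambda>i. t i * t i) * X = X * diag_real n (\<lambda>i. s i * s i)"
    using eq cancel[of "\<lambda>i. t i * t i"] cancel'[of "\<lambda>i. s i * s i"]
      unitary_diag_mult[OF F, of s s] unitary_diag_mult[OF G, of t t] S' T'
    unfolding s_def t_def by metis
  then have "(diag_real n (\<lambda>i. t i * t i) * X) $$ (i, j) = (X * diag_real n (\<lambda>i. s i * s i)) $$ (i, j)" for i j
    by simp
  have ent: "of_real (t i * t i) * X $$ (i, j) = X $$ (i, j) * of_real (s j * s j)" if "i < n" "j < n" for i j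
    using that \<open>\<And>i j. (diag_real n (\<lambda>i. t i * t i) * X) $$ (i, j) = (X * diag_real n (\<lambda>i. s i * s i)) $$ (i, j)\<close>[of i j]
    unfolding diag_real_mult_left[OF X] diag_real_mult_right[OF X] by simp
  have "diag_real n t * X = X * diag_real n s"
    unfolding diag_real_mult_left[OF X] diag_real_mult_right[OF X]
  proof (rule eq_matI)
    fix i j assume "i < dim_row (mat n n (\<lambda>(i, j). X $$ (i, j) * of_real (s j)))"
      "j < dim_col (mat n n (\<lambda>(i, j). X $$ (i, j) * of_real (s j)))"
    then have ij: "i < n" "j < n" by auto
    have "X $$ (i, j) = 0 \<or> t i = s j"
    proof (cases "X $$ (i, j) = 0")
      case False
      then have "(of_real (t i * t i) :: 'a) = of_real (s j * s j)" using ent[OF ij] by (simp add: mult.commute)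
      then have "t i * t i = s j * s j" by (simp only: of_real_eq_iff)
      then show ?thesis using nn[OF ij(1)] nn[OF ij(2)]
        by (simp add: power2_eq_iff_nonneg flip: power2_eq_square)
    qed simp
    then show "mat n n (\<lambda>(i, j). of_real (t i) * X $$ (i, j)) $$ (i, j)
        = mat n n (\<lambda>(i, j). X $$ (i, j) * of_real (s j)) $$ (i, j)"
      using ij by auto
  qed auto
  then have *: "mat_adjoint G * T * F = mat_adjoint G * S * F"
    using cancel[of t] cancel'[of s] S' T' unfolding s_def t_def by metis
  have "Z = G * (mat_adjoint G * Z * F) * mat_adjoint F" if Z: "Z \<in> carrier_mat n n" for Z
  proof -
    have "G * (mat_adjoint G * Z * F) = G * (mat_adjoint G * (Z * F))"
      using GD FD Z by (simp add: assoc_mult_mat[of _ n n _ n _ n])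
    also have "\<dots> = Z * F" by (rule unitary_group_cancel(2)[OF G, where m = n]) (use FD Z in simp)
    finally show ?thesis using FD Z by (simp add: assoc_mult_mat[of _ n n _ n _ n])
  qed
  then show ?thesis using * S(1) T(1) by metis
qed

lemma mat_sqrt_unitary_diag:
  fixes E :: "'a::real_or_complex mat"
  assumes E: "E \<in> unitary_group n" and d: "\<And>i. i < n \<Longrightarrow> 0 \<le> d i"
  shows "mat_sqrt (E * diag_real n d * mat_adjoint E) = E * diag_real n (\<lambda>i. sqrt (d i)) * mat_adjoint E"
proof -
  let ?S = "E * diag_real n (\<lambda>i. sqrt (d i)) * mat_adjoint E"
  have psd: "psd ?S" by (rule psd_unitary_diag[OF E]) (use d in auto)
  have "diag_real n (\<lambda>i. sqrt (d i) * sqrt (d i)) = (diag_real n d :: 'a mat)"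
    by (rule eq_matI) (use d in auto)
  then have sq: "?S * ?S = E * diag_real n d * mat_adjoint E"
    unfolding unitary_diag_mult[OF E] by simp
  show ?thesis
    unfolding mat_sqrt_def
  proof (rule the_equality)
    fix T assume T: "psd T \<and> T * T = E * diag_real n d * mat_adjoint E"
    then have "dim_row T = n" using unitary_diag_carrier[OF E, of d] by (metis carrier_matD(1) index_mult_mat(2))
    moreover have "dim_col T = dim_row T" using T by (metis psd_def hermitian_def dim_mat_adjoint(2))
    ultimately have "T \<in> carrier_mat n n" by auto
    then show "T = ?S"
      using psd_square_unique[of T n ?S] T psd sq unitary_diag_carrier[OF E] by metis
  qed (use psd sq in auto)
qed

section \<open>Concentration on the sphere\<close>

text \<open>The argument is a function instead of a \<open>vec\<close> because the law of a random
  vector is a measure on the product space \<open>PiM\<close>.\<close>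

definition weighted_norm_sq :: "nat \<Rightarrow> (nat \<Rightarrow> real) \<Rightarrow> (nat \<Rightarrow> 'a::real_normed_vector) \<Rightarrow> real" where
  "weighted_norm_sq n d v = (\<Sum>l<n. d l * (norm (v l))\<^sup>2)"

definition plane_rotation ::
  "nat \<Rightarrow> nat \<Rightarrow> nat \<Rightarrow> real \<Rightarrow> real \<Rightarrow> (nat \<Rightarrow> 'a::real_vector) \<Rightarrow> nat \<Rightarrow> 'a" where
  "plane_rotation n j k c s v = (\<lambda>l\<in>{..<n}. if l = j then c *\<^sub>R v j + s *\<^sub>R v k
     else if l = k then c *\<^sub>R v k - s *\<^sub>R v j else v l)"

text \<open>The part of uniformity on the sphere that the exchangeable pairs use: invariance under
  rotations in two coordinate axes, and unit norm almost surely. It passes easily from Haar measure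
  to its columns.\<close>

definition rotation_invariant :: "nat \<Rightarrow> (nat \<Rightarrow> 'a::real_or_complex) measure \<Rightarrow> bool" where
  "rotation_invariant n \<nu> \<longleftrightarrow> prob_space \<nu> \<and> sets \<nu> = sets (PiM {..<n} (\<lambda>_. borel)) \<and>
     (\<forall>j<n. \<forall>k<n. \<forall>c s. j \<noteq> k \<longrightarrow> c\<^sup>2 + s\<^sup>2 = 1 \<longrightarrow> distr \<nu> \<nu> (plane_rotation n j k c s) = \<nu>) \<and>
     (AE v in \<nu>. (\<Sum>l<n. (norm (v l))\<^sup>2) = 1)"

lemma re_mult_conjugate_commute: "re (x * conjugate y) = re (y * conjugate x)"
  using re_conjugate[of "x * conjugate y"] by (simp add: conjugate_dist_mul mult.commute)

lemma norm_rotation_sq: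
  fixes x y :: "'a::real_or_complex"
  shows "(norm (c *\<^sub>R x + s *\<^sub>R y))\<^sup>2
    = c\<^sup>2 * (norm x)\<^sup>2 + s\<^sup>2 * (norm y)\<^sup>2 + 2 * c * s * re (x * conjugate y)"
proof -
  have "(c *\<^sub>R x) * conjugate (s *\<^sub>R y) = of_real (c * s) * (x * conjugate y)"
    by (simp add: scaleR_conv_of_real conjugate_dist_mul)
  then have "re ((c *\<^sub>R x) * conjugate (s *\<^sub>R y)) = c * s * re (x * conjugate y)"
    by (simp only: re_of_real_mult)
  then show ?thesis unfolding norm_add_sq by (simp add: power_mult_distrib)
qed

text \<open>Only the coordinates \<open>j\<close> and \<open>k\<close> move. The result has a part
  even in \<open>s\<close> and a cross term odd in \<open>s\<close>; adding the rotations by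
  opposite angles will cancel the latter.\<close>

lemma weighted_norm_sq_rotation:
  fixes v :: "nat \<Rightarrow> 'a::real_or_complex"
  assumes "j < n" "k < n" "j \<noteq> k" and cs: "c\<^sup>2 + s\<^sup>2 = 1"
  shows "weighted_norm_sq n d (plane_rotation n j k c s v) - weighted_norm_sq n d v
    = (d j - d k) * (s\<^sup>2 * ((norm (v k))\<^sup>2 - (norm (v j))\<^sup>2) + 2 * c * s * re (v j * conjugate (v k)))"
proof -
  let ?R = "plane_rotation n j k c s v"
  have c2: "c\<^sup>2 = 1 - s\<^sup>2" using cs by simp
  have "weighted_norm_sq n d ?R - weighted_norm_sq n d v
      = (\<Sum>l<n. d l * ((norm (?R l))\<^sup>2 - (norm (v l))\<^sup>2))"
    by (simp add: weighted_norm_sq_def algebra_simps sum_subtractf)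
  also have "\<dots> = (\<Sum>l\<in>{j, k}. d l * ((norm (?R l))\<^sup>2 - (norm (v l))\<^sup>2))"
    using assms by (intro sum.mono_neutral_right) (auto simp: plane_rotation_def)
  also have "\<dots> = d j * ((norm (?R j))\<^sup>2 - (norm (v j))\<^sup>2) + d k * ((norm (?R k))\<^sup>2 - (norm (v k))\<^sup>2)"
    using assms by simp
  also have "(norm (?R j))\<^sup>2 = c\<^sup>2 * (norm (v j))\<^sup>2 + s\<^sup>2 * (norm (v k))\<^sup>2 + 2 * c * s * re (v j * conjugate (v k))"
    using assms norm_rotation_sq[of c "v j" s "v k"] by (simp add: plane_rotation_def)
  also have "(norm (?R k))\<^sup>2 = c\<^sup>2 * (norm (v k))\<^sup>2 + s\<^sup>2 * (norm (v j))\<^sup>2 - 2 * c * s * re (v j * conjugate (v k))"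
    using assms norm_rotation_sq[of c "v k" "- s" "v j"] re_mult_conjugate_commute[of "v j" "v k"]
    by (simp add: plane_rotation_def)
  finally show ?thesis
    by (simp add: algebra_simps c2)
qed

lemma plane_rotation_inverse:
  assumes "j < n" "k < n" "j \<noteq> k" "c\<^sup>2 + s\<^sup>2 = 1" "l < n"
  shows "plane_rotation n j k c s (plane_rotation n j k c (- s) v) l = v l"
proof -
  have *: "c *\<^sub>R (c *\<^sub>R x) + s *\<^sub>R (s *\<^sub>R x) = (c\<^sup>2 + s\<^sup>2) *\<^sub>R x" for x :: 'a
    by (simp add: scaleR_add_left power2_eq_square)
  show ?thesis
    using assms *[of "v j"] *[of "v k"] by (auto simp: plane_rotation_def algebra_simps)
qed

lemma weighted_norm_sq_cong:
  "(\<And>l. l < n \<Longrightarrow> v l = w l) \<Longrightarrow> weighted_norm_sq n d v = weighted_norm_sq n d w"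
  by (simp add: weighted_norm_sq_def)

lemma measurable_weighted_norm_sq [measurable]:
  "weighted_norm_sq n d \<in> borel_measurable (PiM {..<n} (\<lambda>_. borel :: 'a::{second_countable_topology, real_normed_vector} measure))"
  unfolding weighted_norm_sq_def by measurable

lemma measurable_plane_rotation:
  assumes "j < n" "k < n"
  shows "plane_rotation n j k c s \<in> measurable (PiM {..<n} (\<lambda>_. borel :: 'a::{second_countable_topology, real_normed_vector} measure))
    (PiM {..<n} (\<lambda>_. borel))"
  unfolding plane_rotation_def
proof (rule measurable_restrict)
  fix l assume l: "l \<in> {..<n}"
  have *: "(\<lambda>v. v i) \<in> borel_measurable (PiM {..<n} (\<lambda>_. borel :: 'a measure))" if "i < n" for i
    using that by simp
  note [measurable] = *[OF assms(1)] *[OF assms(2)]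
  show "(\<lambda>v. if l = j then c *\<^sub>R v j + s *\<^sub>R v k else if l = k then c *\<^sub>R v k - s *\<^sub>R v j else v l)
      \<in> measurable (PiM {..<n} (\<lambda>_. borel :: 'a measure)) borel"
    using *[of l] l by (cases "l = j"; cases "l = k") simp_all
qed

lemma abs_weighted_norm_sq_le:
  assumes "\<And>l. l < n \<Longrightarrow> \<bar>d l\<bar> \<le> D"
  shows "\<bar>weighted_norm_sq n d v\<bar> \<le> D * (\<Sum>l<n. (norm (v l))\<^sup>2)"
proof -
  have "\<bar>weighted_norm_sq n d v\<bar> \<le> (\<Sum>l<n. \<bar>d l * (norm (v l))\<^sup>2\<bar>)"
    unfolding weighted_norm_sq_def by (rule sum_abs)
  also have "\<dots> \<le> (\<Sum>l<n. D * (norm (v l))\<^sup>2)"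
    using assms by (intro sum_mono) (auto simp: abs_mult intro!: mult_right_mono)
  finally show ?thesis by (simp add: sum_distrib_left)
qed

text \<open>The tangent inequality 1 + u <= e^u bounds the secant slope by the larger exponential.
  Writing the sum of both exponentials makes the bound symmetric, so that no order of
  \<open>x\<close> and \<open>y\<close> has to be known.\<close>

lemma exp_secant_bound:
  fixes x y t :: real
  assumes "0 \<le> t"
  shows "(x - y) * (exp (t * x) - exp (t * y)) \<le> t * (x - y)\<^sup>2 * (exp (t * x) + exp (t * y))"
proof -
  have *: "(x - y) * (exp (t * x) - exp (t * y)) \<le> t * (x - y)\<^sup>2 * (exp (t * x) + exp (t * y))"
    if "y \<le> x" for x y :: real
  proof -
    have "1 + (t * y - t * x) \<le> exp (t * y - t * x)" by (rule exp_ge_add_one_self)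
    then have "(1 - t * (x - y)) * exp (t * x) \<le> exp (t * y - t * x) * exp (t * x)"
      by (intro mult_right_mono) (auto simp: algebra_simps)
    then have "exp (t * x) - exp (t * y) \<le> t * (x - y) * exp (t * x)"
      by (simp add: exp_diff algebra_simps)
    then have "(x - y) * (exp (t * x) - exp (t * y)) \<le> (x - y) * (t * (x - y) * exp (t * x))"
      using that by (intro mult_left_mono) auto
    also have "\<dots> = t * (x - y)\<^sup>2 * exp (t * x)" by (simp add: power2_eq_square)
    also have "\<dots> \<le> t * (x - y)\<^sup>2 * (exp (t * x) + exp (t * y))"
      using assms by (intro mult_left_mono) auto
    finally show ?thesis .
  qed
  show ?thesis
  proof (cases "y \<le> x")
    case False
    then show ?thesis using *[of x y] by (simp add: power2_commute algebra_simps)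
  qed (rule *)
qed

lemma integral_double_sum:
  fixes f :: "nat \<Rightarrow> nat \<Rightarrow> 'b \<Rightarrow> real"
  assumes "\<And>j k. j < n \<Longrightarrow> k < n \<Longrightarrow> integrable M (f j k)"
  shows "(\<integral>v. (\<Sum>j<n. \<Sum>k<n. f j k v) \<partial>M) = (\<Sum>j<n. \<Sum>k<n. \<integral>v. f j k v \<partial>M)"
  using assms
  by (subst Bochner_Integration.integral_sum)
    (auto intro!: sum.cong Bochner_Integration.integral_sum Bochner_Integration.integrable_sum)

section \<open>Exponential moments of a centred quadratic form by exchangeable pairs\<close>

context
  fixes n :: nat and \<nu> :: "(nat \<Rightarrow> 'a::real_or_complex) measure" and d :: "nat \<Rightarrow> real" and D :: real
  assumes inv: "rotation_invariant n \<nu>" and dD: "\<And>l. l < n \<Longrightarrow> \<bar>d l\<bar> \<le> D" and D: "D > 0"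
begin

interpretation \<nu>: prob_space \<nu>
  using inv by (simp add: rotation_invariant_def)

lemma sets_nu [measurable_cong]: "sets \<nu> = sets (PiM {..<n} (\<lambda>_. borel))"
  using inv by (simp add: rotation_invariant_def)

lemma AE_sphere: "AE v in \<nu>. (\<Sum>l<n. (norm (v l))\<^sup>2) = 1"
  using inv by (simp add: rotation_invariant_def)

lemma rotation_expectation:
  assumes "j < n" "k < n" "j \<noteq> k" "c\<^sup>2 + s\<^sup>2 = 1"
    and F: "F \<in> borel_measurable (PiM {..<n} (\<lambda>_. borel))"
  shows "(\<integral>v. F (plane_rotation n j k c s v) \<partial>\<nu>) = (\<integral>v. F v \<partial>\<nu> :: real)"
proof -
  have "(\<integral>v. F v \<partial>distr \<nu> \<nu> (plane_rotation n j k c s)) = (\<integral>v. F (plane_rotation n j k c s v) \<partial>\<nu>)"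
  proof (rule integral_distr)
    show "plane_rotation n j k c s \<in> measurable \<nu> \<nu>"
      unfolding measurable_cong_sets[OF sets_nu sets_nu] by (rule measurable_plane_rotation[OF assms(1,2)])
    show "F \<in> borel_measurable \<nu>"
      unfolding measurable_cong_sets[OF sets_nu refl] by (rule F)
  qed
  moreover have "distr \<nu> \<nu> (plane_rotation n j k c s) = \<nu>"
    using inv assms by (simp add: rotation_invariant_def)
  ultimately show ?thesis by simp
qed

text \<open>The rotation \<open>R\<close> and its inverse \<open>R'\<close> are used together.
  Invariance turns the sum of the two mean differences of \<open>q\<close> against the exponential
  weight into the mean of (q - q R')(w - w R'), which the secant inequality bounds by squared
  differences. On the left the terms odd in \<open>s\<close> cancel; on the right the mixed products
  do.\<close>

lemma exchange_pair_bound: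
  assumes jk: "j < n" "k < n" "j \<noteq> k" and cs: "c\<^sup>2 + s\<^sup>2 = 1" and t: "0 \<le> t"
  shows "2 * s\<^sup>2 * (\<integral>v. (d j - d k) * ((norm (v j))\<^sup>2 - (norm (v k))\<^sup>2) * exp (t * weighted_norm_sq n d v) \<partial>\<nu>)
    \<le> t * (\<integral>v. 2 * (d j - d k)\<^sup>2 * (s^4 * ((norm (v j))\<^sup>2 - (norm (v k))\<^sup>2)\<^sup>2
        + 4 * c\<^sup>2 * s\<^sup>2 * (re (v j * conjugate (v k)))\<^sup>2) * exp (t * weighted_norm_sq n d v) \<partial>\<nu>)"
proof -
  define q where "q = (weighted_norm_sq n d :: (nat \<Rightarrow> 'a) \<Rightarrow> real)"
  define R where "R = (plane_rotation n j k c s :: (nat \<Rightarrow> 'a) \<Rightarrow> _)"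
  define R' where "R' = (plane_rotation n j k c (- s) :: (nat \<Rightarrow> 'a) \<Rightarrow> _)"
  let ?w = "\<lambda>v. exp (t * q v)"
  have cs': "c\<^sup>2 + (- s)\<^sup>2 = 1" using cs by simp
  have [measurable]: "q \<in> borel_measurable (PiM {..<n} (\<lambda>_. borel))"
    unfolding q_def by measurable
  have [measurable]: "R \<in> measurable (PiM {..<n} (\<lambda>_. borel)) (PiM {..<n} (\<lambda>_. borel))"
    "R' \<in> measurable (PiM {..<n} (\<lambda>_. borel)) (PiM {..<n} (\<lambda>_. borel))"
    unfolding R_def R'_def using measurable_plane_rotation jk by blast+
  have qRR': "q (R (R' v)) = q v" "q (R' (R v)) = q v" for v
    unfolding q_def R_def R'_def
    using plane_rotation_inverse[OF jk cs] plane_rotation_inverse[OF jk cs']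
    by (auto intro!: weighted_norm_sq_cong)
  have sphere_R: "(\<Sum>l<n. (norm (R v l))\<^sup>2) = (\<Sum>l<n. (norm (v l))\<^sup>2)"
    "(\<Sum>l<n. (norm (R' v l))\<^sup>2) = (\<Sum>l<n. (norm (v l))\<^sup>2)" for v
    using weighted_norm_sq_rotation[OF jk cs, of "\<lambda>_. 1" v] weighted_norm_sq_rotation[OF jk cs', of "\<lambda>_. 1" v]
    by (simp_all add: weighted_norm_sq_def R_def R'_def)
  have q_le: "\<bar>q v\<bar> \<le> D" if "(\<Sum>l<n. (norm (v l))\<^sup>2) = 1" for v
    using abs_weighted_norm_sq_le[of n d D v] dD that by (simp add: q_def)
  have bd: "AE v in \<nu>. \<bar>q v\<bar> \<le> D \<and> \<bar>q (R v)\<bar> \<le> D \<and> \<bar>q (R' v)\<bar> \<le> D"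
    using AE_sphere by eventually_elim (auto intro!: q_le simp: sphere_R)
  have w_le: "?w v \<le> exp (t * D)" if "\<bar>q v\<bar> \<le> D" for v
    using that t by (auto intro!: mult_left_mono)
  have int1: "integrable \<nu> (\<lambda>v. (q (f v) - q (g v)) * ?w (h v))"
    and int2: "integrable \<nu> (\<lambda>v. (q (f v) - q (g v))\<^sup>2 * ?w (h v))"
    if fgh: "f \<in> {\<lambda>v. v, R, R'}" "g \<in> {\<lambda>v. v, R, R'}" "h \<in> {\<lambda>v. v, R, R'}" for f g h
  proof -
    have [measurable]: "f \<in> measurable (PiM {..<n} (\<lambda>_. borel)) (PiM {..<n} (\<lambda>_. borel))"
      "g \<in> measurable (PiM {..<n} (\<lambda>_. borel)) (PiM {..<n} (\<lambda>_. borel))"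
      "h \<in> measurable (PiM {..<n} (\<lambda>_. borel)) (PiM {..<n} (\<lambda>_. borel))"
      using fgh by auto
    have bd': "AE v in \<nu>. \<bar>q (f v) - q (g v)\<bar> \<le> 2 * D \<and> ?w (h v) \<le> exp (t * D)"
      using bd
    proof eventually_elim
      case (elim v)
      then have "\<bar>q (f v)\<bar> \<le> D" "\<bar>q (g v)\<bar> \<le> D" "\<bar>q (h v)\<bar> \<le> D" using fgh by auto
      then show ?case using w_le[of "h v"] by auto
    qed
    show "integrable \<nu> (\<lambda>v. (q (f v) - q (g v)) * ?w (h v))"
    proof (rule \<nu>.integrable_const_bound)
      show "AE v in \<nu>. norm ((q (f v) - q (g v)) * ?w (h v)) \<le> (2 * D) * exp (t * D)"
        using bd' by eventually_elim (auto simp: abs_mult intro!: mult_mono)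
    qed measurable
    show "integrable \<nu> (\<lambda>v. (q (f v) - q (g v))\<^sup>2 * ?w (h v))"
    proof (rule \<nu>.integrable_const_bound)
      show "AE v in \<nu>. norm ((q (f v) - q (g v))\<^sup>2 * ?w (h v)) \<le> (2 * D)\<^sup>2 * exp (t * D)"
        using bd'
      proof eventually_elim
        case (elim v)
        then have "\<bar>q (f v) - q (g v)\<bar>\<^sup>2 \<le> (2 * D)\<^sup>2" by (intro power_mono) auto
        then show ?case using elim by (auto simp: abs_mult intro!: mult_mono)
      qed
    qed measurable
  qed
  note ints = int1[of "\<lambda>v. v" R "\<lambda>v. v"] int1[of "\<lambda>v. v" R' "\<lambda>v. v"] int1[of "\<lambda>v. v" R' R']
    int2[of "\<lambda>v. v" R "\<lambda>v. v"] int2[of "\<lambda>v. v" R' "\<lambda>v. v"] int2[of "\<lambda>v. v" R' R']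
  \<comment> \<open>Substituting v by R' v exchanges the roles of the two points of the pair and
    flips the sign.\<close>
  have "(\<integral>v. (q v - q (R v)) * ?w v \<partial>\<nu>) = (\<integral>v. (q (R' v) - q (R (R' v))) * ?w (R' v) \<partial>\<nu>)"
    unfolding R'_def by (rule rotation_expectation[OF jk cs', symmetric]) measurable
  also have "\<dots> = (\<integral>v. - ((q v - q (R' v)) * ?w (R' v)) \<partial>\<nu>)"
    by (simp add: qRR' algebra_simps)
  also have "\<dots> = - (\<integral>v. (q v - q (R' v)) * ?w (R' v) \<partial>\<nu>)" by simp
  finally have e1: "(\<integral>v. (q v - q (R v)) * ?w v \<partial>\<nu>) = - (\<integral>v. (q v - q (R' v)) * ?w (R' v) \<partial>\<nu>)" .
  have e2: "(\<integral>v. (q v - q (R' v))\<^sup>2 * ?w (R' v) \<partial>\<nu>) = (\<integral>v. (q v - q (R v))\<^sup>2 * ?w v \<partial>\<nu>)"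
  proof -
    have "(\<integral>v. (q v - q (R' v))\<^sup>2 * ?w (R' v) \<partial>\<nu>) = (\<integral>v. (q (R v) - q (R' (R v)))\<^sup>2 * ?w (R' (R v)) \<partial>\<nu>)"
      unfolding R_def by (rule rotation_expectation[OF jk cs, symmetric]) measurable
    then show ?thesis by (simp add: qRR' power2_commute)
  qed
  have "(\<integral>v. (q v - q (R v)) * ?w v \<partial>\<nu>) + (\<integral>v. (q v - q (R' v)) * ?w v \<partial>\<nu>)
      = (\<integral>v. (q v - q (R' v)) * ?w v - (q v - q (R' v)) * ?w (R' v) \<partial>\<nu>)"
    unfolding e1 using ints by (subst Bochner_Integration.integral_diff) auto
  also have "\<dots> \<le> (\<integral>v. t * ((q v - q (R' v))\<^sup>2 * ?w v + (q v - q (R' v))\<^sup>2 * ?w (R' v)) \<partial>\<nu>)"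
  proof (rule integral_mono)
    fix v
    show "(q v - q (R' v)) * ?w v - (q v - q (R' v)) * ?w (R' v)
        \<le> t * ((q v - q (R' v))\<^sup>2 * ?w v + (q v - q (R' v))\<^sup>2 * ?w (R' v))"
      using exp_secant_bound[OF t, of "q v" "q (R' v)"] by (simp add: algebra_simps)
  qed (use ints in auto)
  also have "\<dots> = t * ((\<integral>v. (q v - q (R' v))\<^sup>2 * ?w v \<partial>\<nu>) + (\<integral>v. (q v - q (R v))\<^sup>2 * ?w v \<partial>\<nu>))"
    using ints by (simp add: e2)
  finally have main: "(\<integral>v. (q v - q (R v)) * ?w v + (q v - q (R' v)) * ?w v \<partial>\<nu>)
      \<le> t * (\<integral>v. (q v - q (R' v))\<^sup>2 * ?w v + (q v - q (R v))\<^sup>2 * ?w v \<partial>\<nu>)"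
    using ints by simp
  have diff: "q v - q (R v) = (d j - d k) * (s\<^sup>2 * ((norm (v j))\<^sup>2 - (norm (v k))\<^sup>2) - 2 * c * s * re (v j * conjugate (v k)))"
    "q v - q (R' v) = (d j - d k) * (s\<^sup>2 * ((norm (v j))\<^sup>2 - (norm (v k))\<^sup>2) + 2 * c * s * re (v j * conjugate (v k)))" for v
    using weighted_norm_sq_rotation[OF jk cs, of d v] weighted_norm_sq_rotation[OF jk cs', of d v]
    unfolding q_def R_def R'_def by (simp_all add: algebra_simps)
  have l: "(q v - q (R v)) * ?w v + (q v - q (R' v)) * ?w v
      = 2 * s\<^sup>2 * ((d j - d k) * ((norm (v j))\<^sup>2 - (norm (v k))\<^sup>2) * ?w v)" for v
    unfolding diff by (simp add: algebra_simps)
  have r: "(q v - q (R' v))\<^sup>2 * ?w v + (q v - q (R v))\<^sup>2 * ?w v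
      = 2 * (d j - d k)\<^sup>2 * (s^4 * ((norm (v j))\<^sup>2 - (norm (v k))\<^sup>2)\<^sup>2
        + 4 * c\<^sup>2 * s\<^sup>2 * (re (v j * conjugate (v k)))\<^sup>2) * ?w v" for v
  proof -
    have "(a * (s\<^sup>2 * b + 2 * c * s * e))\<^sup>2 * f + (a * (s\<^sup>2 * b - 2 * c * s * e))\<^sup>2 * f
        = 2 * a\<^sup>2 * (s^4 * b\<^sup>2 + 4 * c\<^sup>2 * s\<^sup>2 * e\<^sup>2) * f" for a b e f :: real
      by (simp add: power2_eq_square power4_eq_xxxx algebra_simps)
    then show ?thesis unfolding diff .
  qed
  show ?thesis
    using main unfolding l r unfolding q_def by simp
qed

text \<open>The first-order effect, summed over all planes, reproduces the form itself: the cross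
  terms contain the sum of the coefficients as a factor, and this is where centring enters.\<close>

lemma sum_pairs_first_moment:
  assumes "(\<Sum>l<n. d l) = 0"
  shows "(\<Sum>j<n. \<Sum>k<n. (d j - d k) * ((norm (v j))\<^sup>2 - (norm (v k))\<^sup>2)) = 2 * n * weighted_norm_sq n d v"
proof -
  let ?x = "\<lambda>j. (norm (v j))\<^sup>2"
  have "(\<Sum>j<n. \<Sum>k<n. (d j - d k) * (?x j - ?x k))
      = (\<Sum>j<n. \<Sum>k<n. d j * ?x j) - (\<Sum>j<n. \<Sum>k<n. d j * ?x k) - (\<Sum>j<n. \<Sum>k<n. d k * ?x j) + (\<Sum>j<n. \<Sum>k<n. d k * ?x k)"
    by (simp add: algebra_simps sum.distrib sum_subtractf)
  also have "(\<Sum>j<n. \<Sum>k<n. d j * ?x k) = (\<Sum>j<n. d j) * (\<Sum>k<n. ?x k)"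
    by (simp add: sum_product)
  also have "(\<Sum>j<n. \<Sum>k<n. d k * ?x j) = (\<Sum>k<n. d k) * (\<Sum>j<n. ?x j)"
    by (subst sum.swap) (simp add: sum_product)
  finally show ?thesis
    using assms by (simp add: weighted_norm_sq_def flip: sum_distrib_left)
qed

text \<open>Squared coordinates lie in [0,1], so (x_j - x_k)^2 <= x_j + x_k, whose double sum is 2n,
  while the squared cross terms are at most x_j x_k with double sum 1. The coefficient differences
  are at most 2D.\<close>

lemma sum_pairs_second_moment:
  fixes v :: "nat \<Rightarrow> 'a" and c s :: real
  assumes v: "(\<Sum>l<n. (norm (v l))\<^sup>2) = 1"
  shows "(\<Sum>j<n. \<Sum>k<n. (d j - d k)\<^sup>2 * (s^4 * ((norm (v j))\<^sup>2 - (norm (v k))\<^sup>2)\<^sup>2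
        + 4 * c\<^sup>2 * s\<^sup>2 * (re (v j * conjugate (v k)))\<^sup>2)) \<le> 4 * D\<^sup>2 * (2 * n * s^4 + 4 * c\<^sup>2 * s\<^sup>2)"
proof -
  let ?x = "\<lambda>j. (norm (v j))\<^sup>2"
  have x1: "?x j \<le> 1" if "j < n" for j
    using member_le_sum[of j "{..<n}" ?x] v that by simp
  have "(\<Sum>j<n. \<Sum>k<n. (d j - d k)\<^sup>2 * (s^4 * (?x j - ?x k)\<^sup>2 + 4 * c\<^sup>2 * s\<^sup>2 * (re (v j * conjugate (v k)))\<^sup>2))
      \<le> (\<Sum>j<n. \<Sum>k<n. (4 * D\<^sup>2) * (s^4 * (?x j + ?x k) + 4 * c\<^sup>2 * s\<^sup>2 * (?x j * ?x k)))"
  proof (intro sum_mono mult_mono add_mono mult_left_mono)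
    fix j k assume "j \<in> {..<n}" "k \<in> {..<n}"
    then have jk: "j < n" "k < n" by auto
    have "\<bar>d j - d k\<bar> \<le> 2 * D" using dD[OF jk(1)] dD[OF jk(2)] by linarith
    then have "\<bar>d j - d k\<bar>\<^sup>2 \<le> (2 * D)\<^sup>2" by (intro power_mono) auto
    then show "(d j - d k)\<^sup>2 \<le> 4 * D\<^sup>2" by (simp add: power_mult_distrib)
    have "(?x j - ?x k)\<^sup>2 = \<bar>?x j - ?x k\<bar> * \<bar>?x j - ?x k\<bar>" by (simp add: power2_eq_square)
    also have "\<dots> \<le> 1 * (?x j + ?x k)"
    proof (rule mult_mono)
      have "0 \<le> ?x j" "0 \<le> ?x k" by simp_all
      then show "\<bar>?x j - ?x k\<bar> \<le> 1" "\<bar>?x j - ?x k\<bar> \<le> ?x j + ?x k"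
        using x1[OF jk(1)] x1[OF jk(2)] by linarith+
    qed auto
    finally show "(?x j - ?x k)\<^sup>2 \<le> ?x j + ?x k" by simp
    have "\<bar>re (v j * conjugate (v k))\<bar> \<le> norm (v j) * norm (v k)"
      using abs_re_le_norm[of "v j * conjugate (v k)"] by (simp add: norm_mult)
    then have "\<bar>re (v j * conjugate (v k))\<bar>\<^sup>2 \<le> (norm (v j) * norm (v k))\<^sup>2" by (intro power_mono) auto
    then show "(re (v j * conjugate (v k)))\<^sup>2 \<le> ?x j * ?x k" by (simp add: power_mult_distrib)
  qed auto
  also have "\<dots> = 4 * D\<^sup>2 * (\<Sum>j<n. \<Sum>k<n. s^4 * (?x j + ?x k) + 4 * c\<^sup>2 * s\<^sup>2 * (?x j * ?x k))"
    by (simp only: sum_distrib_left)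
  also have "(\<Sum>j<n. \<Sum>k<n. s^4 * (?x j + ?x k) + 4 * c\<^sup>2 * s\<^sup>2 * (?x j * ?x k))
      = s^4 * (\<Sum>j<n. \<Sum>k<n. ?x j + ?x k) + 4 * c\<^sup>2 * s\<^sup>2 * (\<Sum>j<n. \<Sum>k<n. ?x j * ?x k)"
    by (simp only: distrib_left sum.distrib sum_distrib_left)
  also have "(\<Sum>j<n. \<Sum>k<n. ?x j + ?x k) = 2 * n"
    using v by (simp add: sum.distrib flip: sum_distrib_left)
  also have "(\<Sum>j<n. \<Sum>k<n. ?x j * ?x k) = 1"
    using v by (simp flip: sum_product)
  finally show ?thesis by (simp add: algebra_simps)
qed

lemma integrable_exp_weighted:
  assumes F [measurable]: "F \<in> borel_measurable (PiM {..<n} (\<lambda>_. borel))"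
    and bd: "\<And>v. (\<Sum>l<n. (norm (v l))\<^sup>2) = 1 \<Longrightarrow> \<bar>F v\<bar> \<le> C" and t: "0 \<le> t"
  shows "integrable \<nu> (\<lambda>v. F v * exp (t * weighted_norm_sq n d v))"
proof (rule \<nu>.integrable_const_bound)
  show "AE v in \<nu>. norm (F v * exp (t * weighted_norm_sq n d v)) \<le> C * exp (t * D)"
    using AE_sphere
  proof eventually_elim
    case (elim v)
    have "weighted_norm_sq n d v \<le> D"
      using abs_weighted_norm_sq_le[of n d D v] dD elim by simp
    then have "exp (t * weighted_norm_sq n d v) \<le> exp (t * D)"
      using t by (simp add: mult_left_mono)
    then show ?case using bd[OF elim] abs_ge_zero[of "F v"]
      by (auto simp: abs_mult intro!: mult_mono intro: order.trans)
  qed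
qed measurable

text \<open>Sums the pair inequality over all planes. It is the differential inequality m' <= (12
  D^2 / n) t m for the moment generating function m, stated without derivatives.\<close>

lemma tilted_mean_le:
  assumes d0: "(\<Sum>l<n. d l) = 0" and t: "0 \<le> t" and n: "n > 0"
  shows "(\<integral>v. weighted_norm_sq n d v * exp (t * weighted_norm_sq n d v) \<partial>\<nu>)
    \<le> 12 * D\<^sup>2 / n * t * (\<integral>v. exp (t * weighted_norm_sq n d v) \<partial>\<nu>)"
proof -
  \<comment> \<open>With s^2 = 1/n the two error terms 2 n s^4 and 4 c^2 s^2 are both of order 1/n;
    together they are at most 6/n, and 4 D^2 * 6/n is the bound 24 D^2 / n below.\<close>
  define s where "s = 1 / sqrt (real n)"
  define c where "c = sqrt (1 - 1 / real n)"
  have s2: "s\<^sup>2 = 1 / n" using n by (simp add: s_def power_divide)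
  have s4: "s^4 = (1 / n)\<^sup>2" using s2 by (metis (no_types) numeral_Bit0 power2_eq_square power_add)
  have c2: "c\<^sup>2 = 1 - 1 / n" using n by (simp add: c_def)
  have cs: "c\<^sup>2 + s\<^sup>2 = 1" by (simp add: s2 c2)
  let ?w = "\<lambda>v. exp (t * weighted_norm_sq n d v)"
  define G where "G = (\<lambda>j k (v :: nat \<Rightarrow> 'a). (d j - d k) * ((norm (v j))\<^sup>2 - (norm (v k))\<^sup>2))"
  define Hm where "Hm = (\<lambda>j k (v :: nat \<Rightarrow> 'a). (d j - d k)\<^sup>2 * (s^4 * ((norm (v j))\<^sup>2 - (norm (v k))\<^sup>2)\<^sup>2
        + 4 * c\<^sup>2 * s\<^sup>2 * (re (v j * conjugate (v k)))\<^sup>2))"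
  have sphere_le: "(norm (v j))\<^sup>2 \<le> 1" if "(\<Sum>l<n. (norm (v l))\<^sup>2) = 1" "j < n" for v :: "nat \<Rightarrow> 'a" and j
    using member_le_sum[of j "{..<n}" "\<lambda>l. (norm (v l))\<^sup>2"] that by simp
  have comp [measurable]: "(\<lambda>v. v j) \<in> borel_measurable (PiM {..<n} (\<lambda>_. borel :: 'a measure))" if "j < n" for j
    using that by simp
  have intG: "integrable \<nu> (\<lambda>v. G j k v * ?w v)" if jk: "j < n" "k < n" for j k
  proof (rule integrable_exp_weighted[OF _ _ t])
    show "G j k \<in> borel_measurable (PiM {..<n} (\<lambda>_. borel))"
      unfolding G_def using comp[OF jk(1)] comp[OF jk(2)] by measurable
    fix v :: "nat \<Rightarrow> 'a" assume v: "(\<Sum>l<n. (norm (v l))\<^sup>2) = 1"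
    have "0 \<le> (norm (v j))\<^sup>2" "0 \<le> (norm (v k))\<^sup>2" by simp_all
    then have "\<bar>(norm (v j))\<^sup>2 - (norm (v k))\<^sup>2\<bar> \<le> 1"
      using sphere_le[OF v jk(1)] sphere_le[OF v jk(2)] by linarith
    then show "\<bar>G j k v\<bar> \<le> \<bar>d j - d k\<bar>"
      using mult_left_mono[of _ 1 "\<bar>d j - d k\<bar>"] by (simp add: G_def abs_mult)
  qed
  have le_sum: "Hm j k v \<le> 4 * D\<^sup>2 * (2 * n * s^4 + 4 * c\<^sup>2 * s\<^sup>2)"
    if v: "(\<Sum>l<n. (norm (v l))\<^sup>2) = 1" and jk: "j < n" "k < n" for j k v
  proof -
    have nn: "0 \<le> Hm j k v" for j k by (auto simp: Hm_def intro!: mult_nonneg_nonneg add_nonneg_nonneg)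
    have "Hm j k v \<le> (\<Sum>k<n. Hm j k v)"
      using nn jk by (intro member_le_sum) auto
    also have "\<dots> \<le> (\<Sum>j<n. \<Sum>k<n. Hm j k v)"
      using nn jk by (intro member_le_sum[of j "{..<n}" "\<lambda>j. \<Sum>k<n. Hm j k v"]) (auto intro!: sum_nonneg)
    finally show ?thesis using sum_pairs_second_moment[OF v, of s c] by (simp add: Hm_def)
  qed
  have intH: "integrable \<nu> (\<lambda>v. Hm j k v * ?w v)" if jk: "j < n" "k < n" for j k
  proof (rule integrable_exp_weighted[OF _ _ t])
    have [measurable]: "(\<lambda>v. re (v j * conjugate (v k :: 'a))) \<in> borel_measurable (PiM {..<n} (\<lambda>_. borel))"
    proof -
      have "re (x * conjugate y) = ((norm (x + y))\<^sup>2 - (norm x)\<^sup>2 - (norm y)\<^sup>2) / 2" for x y :: 'a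
        by (simp add: norm_add_sq)
      then have *: "(\<lambda>v. re (v j * conjugate (v k :: 'a)))
          = (\<lambda>v. ((norm (v j + v k))\<^sup>2 - (norm (v j))\<^sup>2 - (norm (v k))\<^sup>2) / 2)" by (simp only:)
      show ?thesis unfolding * using comp[OF jk(1)] comp[OF jk(2)] by measurable
    qed
    show "Hm j k \<in> borel_measurable (PiM {..<n} (\<lambda>_. borel))"
      unfolding Hm_def using comp[OF jk(1)] comp[OF jk(2)] by measurable
    show "\<bar>Hm j k v\<bar> \<le> 4 * D\<^sup>2 * (2 * n * s^4 + 4 * c\<^sup>2 * s\<^sup>2)"
      if "(\<Sum>l<n. (norm (v l))\<^sup>2) = 1" for v
      using le_sum[OF that jk] by (auto simp: Hm_def abs_mult)
  qed
  have pair: "2 * s\<^sup>2 * (\<integral>v. G j k v * ?w v \<partial>\<nu>) \<le> 2 * t * (\<integral>v. Hm j k v * ?w v \<partial>\<nu>)"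
    if jk: "j < n" "k < n" for j k
  proof (cases "j = k")
    case False
    have "(\<lambda>v. 2 * (d j - d k)\<^sup>2 * (s^4 * ((norm (v j))\<^sup>2 - (norm (v k))\<^sup>2)\<^sup>2
        + 4 * c\<^sup>2 * s\<^sup>2 * (re (v j * conjugate (v k)))\<^sup>2) * ?w v) = (\<lambda>v. 2 * (Hm j k v * ?w v))"
      by (simp add: Hm_def mult.assoc)
    with exchange_pair_bound[OF jk False cs t] show ?thesis
      by (simp add: G_def)
  qed (simp add: G_def Hm_def)
  have leH: "(\<integral>v. (\<Sum>j<n. \<Sum>k<n. Hm j k v * ?w v) \<partial>\<nu>) \<le> (\<integral>v. 24 * D\<^sup>2 / n * ?w v \<partial>\<nu>)"
  proof (rule integral_mono_AE)
    show "integrable \<nu> (\<lambda>v. \<Sum>j<n. \<Sum>k<n. Hm j k v * ?w v)"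
      using intH by (intro Bochner_Integration.integrable_sum) auto
    show "integrable \<nu> (\<lambda>v. 24 * D\<^sup>2 / n * ?w v)"
      by (rule integrable_exp_weighted[OF _ _ t, of _ "24 * D\<^sup>2 / n"]) auto
    show "AE v in \<nu>. (\<Sum>j<n. \<Sum>k<n. Hm j k v * ?w v) \<le> 24 * D\<^sup>2 / n * ?w v"
      using AE_sphere
    proof eventually_elim
      case (elim v)
      have "(\<Sum>j<n. \<Sum>k<n. Hm j k v) \<le> 4 * D\<^sup>2 * (2 * n * s^4 + 4 * c\<^sup>2 * s\<^sup>2)"
        using sum_pairs_second_moment[OF elim, of s c] by (simp add: Hm_def)
      also have "\<dots> \<le> 4 * D\<^sup>2 * (6 / n)"
      proof (intro mult_left_mono)
        have "2 * n * s^4 = 2 / n" using n by (simp add: s4 power2_eq_square)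
        moreover have "4 * c\<^sup>2 * s\<^sup>2 \<le> 4 / n" using n by (simp add: s2 c2 field_simps)
        ultimately show "2 * n * s^4 + 4 * c\<^sup>2 * s\<^sup>2 \<le> 6 / n" by simp
      qed simp
      finally have "(\<Sum>j<n. \<Sum>k<n. Hm j k v) * ?w v \<le> (24 * D\<^sup>2 / n) * ?w v"
        by (intro mult_right_mono) auto
      then show ?case by (simp add: sum_distrib_right)
    qed
  qed
  \<comment> \<open>The factor 4 is 2 s^2 times 2n; dividing 2 * 24 by it leaves the constant
    12.\<close>
  have "4 * (\<integral>v. weighted_norm_sq n d v * ?w v \<partial>\<nu>) = 2 * s\<^sup>2 * (\<integral>v. (2 * n * weighted_norm_sq n d v) * ?w v \<partial>\<nu>)"
    using n by (simp add: s2 mult.assoc)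
  also have "\<dots> = 2 * s\<^sup>2 * (\<integral>v. (\<Sum>j<n. \<Sum>k<n. G j k v * ?w v) \<partial>\<nu>)"
    by (simp only: sum_pairs_first_moment[OF d0, symmetric] G_def sum_distrib_right)
  also have "\<dots> = (\<Sum>j<n. \<Sum>k<n. 2 * s\<^sup>2 * (\<integral>v. G j k v * ?w v \<partial>\<nu>))"
    by (subst integral_double_sum) (use intG in \<open>auto simp: sum_distrib_left\<close>)
  also have "\<dots> \<le> (\<Sum>j<n. \<Sum>k<n. 2 * t * (\<integral>v. Hm j k v * ?w v \<partial>\<nu>))"
    by (intro sum_mono pair) auto
  also have "\<dots> = 2 * t * (\<integral>v. (\<Sum>j<n. \<Sum>k<n. Hm j k v * ?w v) \<partial>\<nu>)"
    by (subst integral_double_sum) (use intH in \<open>auto simp: sum_distrib_left\<close>)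
  also have "\<dots> \<le> 2 * t * (\<integral>v. 24 * D\<^sup>2 / n * ?w v \<partial>\<nu>)"
    using t by (intro mult_left_mono leH) simp
  also have "\<dots> = 4 * (12 * D\<^sup>2 / n * t * (\<integral>v. ?w v \<partial>\<nu>))"
    by simp
  finally show ?thesis by simp
qed

text \<open>A discrete Gronwall argument: the tangent inequality compares the moments at
  neighbouring parameters, and [0,t] is cut into \<open>k\<close> equal steps. Each step estimates
  its parameter by \<open>t\<close>, so the exponent is K t^2 instead of half of that.\<close>

lemma exp_weighted_le:
  assumes d0: "(\<Sum>l<n. d l) = 0" and t: "0 \<le> t" and n: "n > 0"
  shows "(\<integral>v. exp (t * weighted_norm_sq n d v) \<partial>\<nu>) \<le> exp (12 * D\<^sup>2 / n * t\<^sup>2)"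
proof -
  define K where "K = 12 * D\<^sup>2 / n"
  have K: "K > 0" using D n by (simp add: K_def)
  define m where "m = (\<lambda>a. \<integral>v. exp (a * weighted_norm_sq n d v) \<partial>\<nu>)"
  have m_nonneg: "0 \<le> m a" for a by (simp add: m_def)
  have int: "integrable \<nu> (\<lambda>v. exp (a * weighted_norm_sq n d v))" if "0 \<le> a" for a
    using integrable_exp_weighted[of "\<lambda>_. 1" 1 a] that by simp
  have int': "integrable \<nu> (\<lambda>v. weighted_norm_sq n d v * exp (a * weighted_norm_sq n d v))" if "0 \<le> a" for a
  proof (rule integrable_exp_weighted[OF _ _ that])
    show "\<bar>weighted_norm_sq n d v\<bar> \<le> D" if "(\<Sum>l<n. (norm (v l))\<^sup>2) = 1" for v :: "nat \<Rightarrow> 'a"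
      using abs_weighted_norm_sq_le[of n d D v] dD that by simp
  qed measurable
  have step: "m b * (1 - (b - a) * (K * b)) \<le> m a" if ab: "0 \<le> a" "a \<le> b" for a b
  proof -
    have "m b - m a = (\<integral>v. exp (b * weighted_norm_sq n d v) - exp (a * weighted_norm_sq n d v) \<partial>\<nu>)"
      unfolding m_def using int ab by simp
    also have "\<dots> \<le> (\<integral>v. (b - a) * (weighted_norm_sq n d v * exp (b * weighted_norm_sq n d v)) \<partial>\<nu>)"
    proof (rule integral_mono)
      fix v :: "nat \<Rightarrow> 'a"
      let ?x = "weighted_norm_sq n d v"
      have "1 + (a * ?x - b * ?x) \<le> exp (a * ?x - b * ?x)" by (rule exp_ge_add_one_self)
      then have "(1 - (b - a) * ?x) * exp (b * ?x) \<le> exp (a * ?x - b * ?x) * exp (b * ?x)"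
        by (intro mult_right_mono) (auto simp: algebra_simps)
      then show "exp (b * ?x) - exp (a * ?x) \<le> (b - a) * (?x * exp (b * ?x))"
        by (simp add: exp_diff algebra_simps)
    qed (use int int' ab in auto)
    also have "\<dots> = (b - a) * (\<integral>v. weighted_norm_sq n d v * exp (b * weighted_norm_sq n d v) \<partial>\<nu>)"
      by simp
    also have "\<dots> \<le> (b - a) * (K * b * m b)"
      using tilted_mean_le[OF d0 _ n, of b] ab by (intro mult_left_mono) (auto simp: m_def K_def)
    finally show ?thesis by (simp add: algebra_simps)
  qed
  \<comment> \<open>\<open>k\<close> must exceed K t^2 so that the factor is positive and the steps
    may be multiplied; letting \<open>k\<close> tend to infinity then turns the power into e^(-K
    t^2).\<close>
  have le1: "m t * (1 - K * t\<^sup>2 / k) ^ k \<le> 1" if k: "K * t\<^sup>2 < real k" for k :: nat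
  proof -
    have k0: "0 < real k" using k K by (meson le_less_trans mult_nonneg_nonneg less_imp_le zero_le_power2)
    let ?x = "K * t\<^sup>2 / k"
    have x1: "0 \<le> 1 - ?x" using k k0 by (simp add: divide_le_eq)
    have "m (i * t / k) * (1 - ?x) ^ i \<le> 1" if "i \<le> k" for i
      using that
    proof (induction i)
      case 0
      then show ?case by (simp add: m_def)
    next
      case (Suc i)
      let ?a = "i * t / k" and ?b = "Suc i * t / k"
      have "real (Suc i) * t \<le> real k * t" using t Suc.prems by (intro mult_right_mono) auto
      then have b: "?b \<le> t" using k0 by (simp add: pos_divide_le_eq mult.commute)
      have ab: "0 \<le> ?a" "?a \<le> ?b" "?b - ?a = t / k" "?b \<le> t"
        using t k0 b by (auto simp: field_simps)
      have "(?b - ?a) * (K * ?b) \<le> t / k * (K * t)"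
        unfolding ab(3) using ab K t k0 by (intro mult_left_mono) auto
      also have "\<dots> = ?x" by (simp add: power2_eq_square)
      finally have "m ?b * (1 - ?x) \<le> m ?b * (1 - (?b - ?a) * (K * ?b))"
        using m_nonneg by (intro mult_left_mono) auto
      also have "\<dots> \<le> m ?a" by (rule step[OF ab(1,2)])
      finally have "m ?b * (1 - ?x) * (1 - ?x) ^ i \<le> m ?a * (1 - ?x) ^ i"
        using x1 by (intro mult_right_mono) auto
      also have "\<dots> \<le> 1" using Suc by simp
      finally show ?case by (simp add: mult.assoc)
    qed
    from this[of k] show ?thesis using k0 by simp
  qed
  have "(\<lambda>k. m t * (1 + (- (K * t\<^sup>2)) / real k) ^ k) \<longlonglongrightarrow> m t * exp (- (K * t\<^sup>2))"
    by (intro tendsto_intros tendsto_exp_limit_sequentially)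
  moreover have "\<forall>\<^sub>F k in sequentially. m t * (1 + (- (K * t\<^sup>2)) / real k) ^ k \<le> 1"
  proof -
    obtain k0 :: nat where "K * t\<^sup>2 < real k0" using reals_Archimedean2 by blast
    then show ?thesis
      unfolding eventually_sequentially using le1 by (intro exI[of _ k0]) auto
  qed
  ultimately have "m t * exp (- (K * t\<^sup>2)) \<le> 1"
    by (rule tendsto_upperbound) simp
  then have "m t \<le> exp (K * t\<^sup>2)" by (simp add: exp_minus field_simps)
  then show ?thesis by (simp add: m_def K_def)
qed

lemma upper_tail:
  assumes d0: "(\<Sum>l<n. d l) = 0" and n: "n > 0" and \<eta>: "\<eta> > 0"
  shows "\<nu>.prob {v \<in> space \<nu>. weighted_norm_sq n d v \<ge> \<eta>} \<le> exp (- (\<eta>\<^sup>2 * n / (48 * D\<^sup>2)))"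
proof -
  define K where "K = 12 * D\<^sup>2 / n"
  have K: "K > 0" using D n by (simp add: K_def)
  \<comment> \<open>The minimiser of K t^2 - t \<eta> in Chernoff's bound, with minimum -\<eta>^2 /
    (4K).\<close>
  define t where "t = \<eta> / (2 * K)"
  have t: "t > 0" using K \<eta> by (simp add: t_def)
  have meas [measurable]: "weighted_norm_sq n d \<in> borel_measurable \<nu>"
    unfolding measurable_cong_sets[OF sets_nu refl] by measurable
  have int: "integrable \<nu> (\<lambda>v. exp (t * weighted_norm_sq n d v))"
    using integrable_exp_weighted[of "\<lambda>_. 1" 1 t] t by simp
  have "{v \<in> space \<nu>. weighted_norm_sq n d v \<ge> \<eta>} = {v \<in> space \<nu>. exp (t * weighted_norm_sq n d v) \<ge> exp (t * \<eta>)}"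
    using t by simp
  then have "\<nu>.prob {v \<in> space \<nu>. weighted_norm_sq n d v \<ge> \<eta>}
      \<le> (\<integral>v. exp (t * weighted_norm_sq n d v) \<partial>\<nu>) / exp (t * \<eta>)"
    using integral_Markov_inequality_measure[OF int, of "space \<nu>" "exp (t * \<eta>)"] by simp
  also have "\<dots> \<le> exp (K * t\<^sup>2) / exp (t * \<eta>)"
    using exp_weighted_le[OF d0 _ n, of t] t by (intro divide_right_mono) (auto simp: K_def)
  also have "\<dots> = exp (K * t\<^sup>2 - t * \<eta>)" by (simp add: exp_diff)
  also have "K * t\<^sup>2 - t * \<eta> = - (\<eta>\<^sup>2 / (4 * K))"
    using K by (simp add: t_def field_simps power2_eq_square)
  also have "\<eta>\<^sup>2 / (4 * K) = \<eta>\<^sup>2 * n / (48 * D\<^sup>2)"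
    by (simp add: K_def)
  finally show ?thesis .
qed

end

theorem sphere_concentration:
  fixes \<nu> :: "(nat \<Rightarrow> 'a::real_or_complex) measure"
  assumes inv: "rotation_invariant n \<nu>" and dD: "\<And>l. l < n \<Longrightarrow> \<bar>d l\<bar> \<le> D" and D: "D > 0"
    and d0: "(\<Sum>l<n. d l) = 0" and n: "n > 0" and \<eta>: "\<eta> > 0"
  shows "measure \<nu> {v \<in> space \<nu>. \<bar>weighted_norm_sq n d v\<bar> \<ge> \<eta>} \<le> 2 * exp (- (\<eta>\<^sup>2 * n / (48 * D\<^sup>2)))"
proof -
  interpret prob_space \<nu> using inv by (simp add: rotation_invariant_def)
  have sets: "sets \<nu> = sets (PiM {..<n} (\<lambda>_. borel))" using inv by (simp add: rotation_invariant_def)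
  have meas [measurable]: "weighted_norm_sq n d \<in> borel_measurable \<nu>" for d
    unfolding measurable_cong_sets[OF sets refl] by measurable
  have neg: "weighted_norm_sq n (\<lambda>l. - d l) v = - weighted_norm_sq n d v" for v :: "nat \<Rightarrow> 'a"
    by (simp add: weighted_norm_sq_def sum_negf)
  have "{v \<in> space \<nu>. \<bar>weighted_norm_sq n d v\<bar> \<ge> \<eta>}
      = {v \<in> space \<nu>. weighted_norm_sq n d v \<ge> \<eta>} \<union> {v \<in> space \<nu>. weighted_norm_sq n (\<lambda>l. - d l) v \<ge> \<eta>}"
    by (auto simp: neg abs_real_def split: if_splits)
  also have "prob \<dots> \<le> prob {v \<in> space \<nu>. weighted_norm_sq n d v \<ge> \<eta>}
      + prob {v \<in> space \<nu>. weighted_norm_sq n (\<lambda>l. - d l) v \<ge> \<eta>}"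
    by (rule measure_Un_le) measurable
  also have "\<dots> \<le> exp (- (\<eta>\<^sup>2 * n / (48 * D\<^sup>2))) + exp (- (\<eta>\<^sup>2 * n / (48 * D\<^sup>2)))"
    using upper_tail[OF inv dD D d0 n \<eta>] upper_tail[OF inv _ D _ n \<eta>, of "\<lambda>l. - d l"] dD d0
    by (intro add_mono) (auto simp: sum_negf)
  finally show ?thesis by simp
qed

section \<open>Measurability of eigenvalues and Haar columns\<close>

lemma measurable_conjugate [measurable]:
  "conjugate \<in> borel_measurable (borel :: 'a::real_or_complex measure)"
proof (rule borel_measurable_continuous_onI)
  show "continuous_on UNIV (conjugate :: 'a \<Rightarrow> 'a)"
    unfolding continuous_on_iff by (metis conjugate_diff dist_norm norm_conjugate)
qed

lemma measurable_mult_entry: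
  fixes F G :: "'b \<Rightarrow> 'a::real_or_complex mat"
  assumes "\<And>x. x \<in> space M \<Longrightarrow> F x \<in> carrier_mat n k" "\<And>x. x \<in> space M \<Longrightarrow> G x \<in> carrier_mat k m"
    and "\<And>i l. i < n \<Longrightarrow> l < k \<Longrightarrow> (\<lambda>x. F x $$ (i, l)) \<in> borel_measurable M"
    and "\<And>l j. l < k \<Longrightarrow> j < m \<Longrightarrow> (\<lambda>x. G x $$ (l, j)) \<in> borel_measurable M"
    and "i < n" "j < m"
  shows "(\<lambda>x. (F x * G x) $$ (i, j)) \<in> borel_measurable M"
proof -
  have "(\<lambda>x. \<Sum>l<k. F x $$ (i, l) * G x $$ (l, j)) \<in> borel_measurable M"
    using assms by (intro borel_measurable_sum borel_measurable_times) auto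
  also have "?this \<longleftrightarrow> ?thesis"
  proof (rule measurable_cong)
    fix x assume "x \<in> space M"
    then show "(\<Sum>l<k. F x $$ (i, l) * G x $$ (l, j)) = (F x * G x) $$ (i, j)"
      using assms(1,2)[of x] assms(5,6) by (simp add: scalar_prod_def lessThan_atLeast0)
  qed
  finally show ?thesis .
qed

lemma measurable_adjoint_entry:
  fixes F :: "'b \<Rightarrow> 'a::real_or_complex mat"
  assumes "\<And>x. x \<in> space M \<Longrightarrow> F x \<in> carrier_mat n m"
    and "\<And>i j. i < n \<Longrightarrow> j < m \<Longrightarrow> (\<lambda>x. F x $$ (i, j)) \<in> borel_measurable M"
    and "i < m" "j < n"
  shows "(\<lambda>x. mat_adjoint (F x) $$ (i, j)) \<in> borel_measurable M"
proof -
  have "(\<lambda>x. conjugate (F x $$ (j, i))) \<in> borel_measurable M"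
    using assms by (intro measurable_compose[OF _ measurable_conjugate]) auto
  also have "?this \<longleftrightarrow> ?thesis"
  proof (rule measurable_cong)
    fix x assume "x \<in> space M"
    from assms(1)[OF this] show "conjugate (F x $$ (j, i)) = mat_adjoint (F x) $$ (i, j)"
      using assms(3,4) by simp
  qed
  finally show ?thesis .
qed

text \<open>The k-th eigenvalue is 1-Lipschitz for the entrywise distance. So it lies below
  \<open>t\<close> exactly if some Hermitian matrix from a countable dense family has its eigenvalue
  plus the distance below \<open>t\<close>, and the sublevel set is a countable union of measurable
  sets.\<close>

lemma measurable_eig:
  fixes F :: "'b \<Rightarrow> 'a::real_or_complex mat"
  assumes carrier: "\<And>x. x \<in> space M \<Longrightarrow> F x \<in> carrier_mat n n" and herm: "\<And>x. x \<in> space M \<Longrightarrow> hermitian (F x)"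
    and meas: "\<And>i j. i < n \<Longrightarrow> j < n \<Longrightarrow> (\<lambda>x. F x $$ (i, j)) \<in> borel_measurable M"
    and k: "1 \<le> k" "k \<le> n"
  shows "(\<lambda>x. eig k (F x)) \<in> borel_measurable M"
proof -
  obtain D :: "'a set" where D: "countable D" "\<And>X. open X \<Longrightarrow> X \<noteq> {} \<Longrightarrow> \<exists>d\<in>D. d \<in> X"
    by (rule countable_dense_setE) blast
  define C where "C = PiE ({..<n} \<times> {..<n}) (\<lambda>_. D)"
  have C: "countable C" unfolding C_def using D by (intro countable_PiE) auto
  \<comment> \<open>Entries chosen freely from the dense set are symmetrised to obtain a Hermitian
    matrix. Since \<open>F x\<close> is Hermitian, symmetrising does not worsen the
    approximation.\<close>
  define Y where "Y = (\<lambda>g :: nat \<times> nat \<Rightarrow> 'a. mat n n (\<lambda>(i, j). (g (i, j) + conjugate (g (j, i))) / 2))"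
  have Y: "Y g \<in> carrier_mat n n" for g by (simp add: Y_def)
  have conj2: "conjugate (x / 2) = conjugate x / 2" for x :: 'a
  proof -
    have "x / 2 = of_real (1/2) * x" for x :: 'a by simp
    then show ?thesis by (metis conjugate_dist_mul conjugate_of_real)
  qed
  have hY: "hermitian (Y g)" for g
    unfolding hermitian_def
  proof (rule eq_matI)
    fix i j assume "i < dim_row (Y g)" "j < dim_col (Y g)"
    then have ij: "i < n" "j < n" using Y[of g] by auto
    have "mat_adjoint (Y g) $$ (i, j) = conjugate (Y g $$ (j, i))"
      using ij Y[of g] by simp
    also have "\<dots> = conjugate ((g (j, i) + conjugate (g (i, j))) / 2)"
      using ij by (simp add: Y_def)
    also have "\<dots> = (conjugate (g (j, i)) + g (i, j)) / 2"
      unfolding conj2 conjugate_dist_add conjugate_id ..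
    also have "\<dots> = Y g $$ (i, j)"
      using ij by (simp add: Y_def add.commute)
    finally show "mat_adjoint (Y g) $$ (i, j) = Y g $$ (i, j)" .
  qed (use Y[of g] in auto)
  define dst where "dst = (\<lambda>A B :: 'a mat. \<Sum>i<n. \<Sum>j<n. norm (A $$ (i, j) - B $$ (i, j)))"
  have dst_sym: "dst A B = dst B A" for A B by (simp add: dst_def norm_minus_commute)
  have dst_meas: "(\<lambda>x. dst (F x) B) \<in> borel_measurable M" for B
    unfolding dst_def using meas
    by (intro borel_measurable_sum borel_measurable_norm borel_measurable_diff) auto
  have "{x \<in> space M. eig k (F x) < t} = (\<Union>g\<in>C. {x \<in> space M. eig k (Y g) + dst (F x) (Y g) < t})" for t
  proof (intro equalityI subsetI)
    fix x assume "x \<in> {x \<in> space M. eig k (F x) < t}"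
    then have x: "x \<in> space M" and less: "eig k (F x) < t" by auto
    \<comment> \<open>The distance, at most e n^2, is paid twice: once for the Lipschitz bound and
      once as the added term. The extra 1 keeps the inequality strict and the denominator
      positive.\<close>
    define e where "e = (t - eig k (F x)) / (2 * n^2 + 1)"
    have "real (2 * n^2 + 1) > 0" by linarith
    then have e: "e > 0" "e * (2 * n^2 + 1) = t - eig k (F x)" using less by (auto simp: e_def)
    have "\<exists>d\<in>D. norm (F x $$ ij - d) < e" for ij
      using D(2)[of "ball (F x $$ ij) e"] e(1) by (auto simp: dist_norm)
    then obtain g' where g': "g' ij \<in> D" "norm (F x $$ ij - g' ij) < e" for ij by metis
    define g where "g = restrict g' ({..<n} \<times> {..<n})"
    have gC: "g \<in> C" using g' by (auto simp: g_def C_def)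
    have "norm (F x $$ (i, j) - Y g $$ (i, j)) \<le> e" if ij: "i < n" "j < n" for i j
    proof -
      have "mat_adjoint (F x) $$ (i, j) = F x $$ (i, j)" using herm[OF x] by (simp add: hermitian_def)
      then have "conjugate (F x $$ (j, i)) = F x $$ (i, j)" using carrier[OF x] ij by simp
      then have "F x $$ (i, j) - Y g $$ (i, j)
          = ((F x $$ (i, j) - g' (i, j)) + conjugate (F x $$ (j, i) - g' (j, i))) / 2"
        using ij by (simp add: Y_def g_def conjugate_diff field_simps)
      also have "norm \<dots> = norm ((F x $$ (i, j) - g' (i, j)) + conjugate (F x $$ (j, i) - g' (j, i))) / 2"
        by (simp add: norm_divide)
      also have "\<dots> \<le> (norm (F x $$ (i, j) - g' (i, j)) + norm (F x $$ (j, i) - g' (j, i))) / 2"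
        using norm_triangle_ineq[of "F x $$ (i, j) - g' (i, j)" "conjugate (F x $$ (j, i) - g' (j, i))"] by simp
      also have "\<dots> \<le> (e + e) / 2"
        using g'(2)[of "(i, j)"] g'(2)[of "(j, i)"] by (intro divide_right_mono add_mono) auto
      finally show ?thesis by simp
    qed
    then have "dst (F x) (Y g) \<le> (\<Sum>i<n. \<Sum>j<n. e)"
      unfolding dst_def by (intro sum_mono) auto
    then have dle: "dst (F x) (Y g) \<le> e * n^2" by (simp add: power2_eq_square algebra_simps)
    have "eig k (Y g) \<le> eig k (F x) + dst (Y g) (F x)"
      unfolding dst_def by (rule eig_diff_le[OF Y hY carrier[OF x] herm[OF x] k])
    then have "eig k (Y g) + dst (F x) (Y g) \<le> eig k (F x) + (e * n^2 + e * n^2)"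
      using dle unfolding dst_sym[of "Y g"] by linarith
    also have "\<dots> < t" using e by (simp add: algebra_simps)
    finally show "x \<in> (\<Union>g\<in>C. {x \<in> space M. eig k (Y g) + dst (F x) (Y g) < t})"
      using gC x by auto
  next
    fix x assume "x \<in> (\<Union>g\<in>C. {x \<in> space M. eig k (Y g) + dst (F x) (Y g) < t})"
    then obtain g where x: "x \<in> space M" and l: "eig k (Y g) + dst (F x) (Y g) < t" by auto
    have "eig k (F x) \<le> eig k (Y g) + dst (F x) (Y g)"
      unfolding dst_def by (rule eig_diff_le[OF carrier[OF x] herm[OF x] Y hY k])
    with x l show "x \<in> {x \<in> space M. eig k (F x) < t}" by auto
  qed
  moreover have "(\<Union>g\<in>C. {x \<in> space M. eig k (Y g) + dst (F x) (Y g) < t}) \<in> sets M" for t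
  proof (rule sets.countable_UN''[OF C])
    fix g
    have [measurable]: "(\<lambda>x. dst (F x) (Y g)) \<in> borel_measurable M" by (rule dst_meas)
    show "{x \<in> space M. eig k (Y g) + dst (F x) (Y g) < t} \<in> sets M" by measurable
  qed
  ultimately show ?thesis unfolding borel_measurable_iff_less by simp
qed

section \<open>Haar measure and the law of a rotated unit vector\<close>

lemma haar_space:
  assumes "haar_law n \<mu>"
  shows "space \<mu> = unitary_group n"
proof -
  have "sets \<mu> = sets (restrict_space (mat_borel n) (unitary_group n))"
    using assms by (simp add: haar_law_def)
  then have "space \<mu> = unitary_group n \<inter> carrier_mat n n"
    by (simp add: sets_eq_imp_space_eq space_restrict_space mat_borel_def)
  then show ?thesis by (auto simp: unitary_group_def)
qed

lemma haar_measurable_entry: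
  fixes \<mu> :: "'a::real_or_complex mat measure"
  assumes haar: "haar_law n \<mu>" and ij: "i < n" "j < n"
  shows "(\<lambda>U. U $$ (i, j)) \<in> borel_measurable \<mu>"
proof -
  have s: "sets \<mu> = sets (restrict_space (mat_borel n) (unitary_group n))"
    using haar by (simp add: haar_law_def)
  let ?f = "\<lambda>A :: 'a mat. \<lambda>ij\<in>{..<n} \<times> {..<n}. A $$ ij"
  have "?f \<in> measurable (mat_borel n) (PiM ({..<n} \<times> {..<n}) (\<lambda>_. borel))"
    unfolding mat_borel_def by (rule measurable_vimage_algebra1) (auto simp: space_PiM)
  from measurable_compose[OF this measurable_component_singleton[of "(i, j)"]] ij
  have "(\<lambda>A. ?f A (i, j)) \<in> borel_measurable (mat_borel n)" by simp
  then have "(\<lambda>A. A $$ (i, j)) \<in> borel_measurable (mat_borel n :: 'a mat measure)" using ij by simp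
  then show ?thesis
    unfolding measurable_cong_sets[OF s refl] by (rule measurable_restrict_space1)
qed

lemma haar_measurable_mult:
  fixes \<mu> :: "'a::real_or_complex mat measure"
  assumes haar: "haar_law n \<mu>" and V: "V \<in> unitary_group n"
  shows "(\<lambda>U. V * U) \<in> measurable \<mu> \<mu>"
proof -
  have s: "sets \<mu> = sets (restrict_space (mat_borel n) (unitary_group n))"
    using haar by (simp add: haar_law_def)
  note VD = unitary_groupD[OF V]
  have U: "U \<in> carrier_mat n n" if "U \<in> space \<mu>" for U
    using that haar_space[OF haar] by (auto simp: unitary_group_def)
  show ?thesis
    unfolding measurable_cong_sets[OF refl s]
  proof (rule measurable_restrict_space2)
    show "(\<lambda>U. V * U) \<in> space \<mu> \<rightarrow> unitary_group n"
      using haar_space[OF haar] unitary_group_mult[OF V] by auto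
    show "(\<lambda>U. V * U) \<in> measurable \<mu> (mat_borel n)"
      unfolding mat_borel_def
    proof (rule measurable_vimage_algebra2)
      show "(\<lambda>U. V * U) \<in> space \<mu> \<rightarrow> carrier_mat n n" using U VD by auto
      show "(\<lambda>U. \<lambda>ij\<in>{..<n} \<times> {..<n}. (V * U) $$ ij) \<in> measurable \<mu> (PiM ({..<n} \<times> {..<n}) (\<lambda>_. borel))"
      proof (rule measurable_restrict)
        fix ij :: "nat \<times> nat" assume "ij \<in> {..<n} \<times> {..<n}"
        then obtain i j where ij: "ij = (i, j)" "i < n" "j < n" by auto
        show "(\<lambda>U. (V * U) $$ ij) \<in> borel_measurable \<mu>"
          unfolding ij by (rule measurable_mult_entry[of _ _ n n _ n])
            (use U VD ij haar_measurable_entry[OF haar] in auto)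
      qed
    qed
  qed
qed

definition rotation_mat :: "nat \<Rightarrow> nat \<Rightarrow> nat \<Rightarrow> real \<Rightarrow> real \<Rightarrow> 'a::real_or_complex mat" where
  "rotation_mat n j k c s = mat n n (\<lambda>(i, l). if i = j then (if l = j then of_real c else if l = k then of_real s else 0)
     else if i = k then (if l = k then of_real c else if l = j then - of_real s else 0)
     else if i = l then 1 else 0)"

lemma rotation_mat_carrier [simp]: "rotation_mat n j k c s \<in> carrier_mat n n"
  and dim_rotation_mat [simp]: "dim_row (rotation_mat n j k c s) = n" "dim_col (rotation_mat n j k c s) = n"
  by (simp_all add: rotation_mat_def)

lemma rotation_mat_mult_vec:
  fixes x :: "'a::real_or_complex vec"
  assumes jk: "j < n" "k < n" "j \<noteq> k" and x: "x \<in> carrier_vec n" and i: "i < n"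
  shows "(rotation_mat n j k c s *\<^sub>v x) $ i = plane_rotation n j k c s (\<lambda>l. x $ l) i"
proof -
  let ?G = "rotation_mat n j k c s :: 'a mat"
  have "(?G *\<^sub>v x) $ i = (\<Sum>l<n. ?G $$ (i, l) * x $ l)"
    using x i rotation_mat_carrier[of n j k c s] by (simp add: scalar_prod_def lessThan_atLeast0)
  also have "\<dots> = (\<Sum>l\<in>{i, j, k}. ?G $$ (i, l) * x $ l)"
    using jk i by (intro sum.mono_neutral_right) (auto simp: rotation_mat_def)
  also have "\<dots> = plane_rotation n j k c s (\<lambda>l. x $ l) i"
  proof -
    consider "i = j" | "i = k" | "i \<noteq> j" "i \<noteq> k" by blast
    then show ?thesis
    proof cases
      case 2
      then have "{i, j, k} = {j, k}" by auto
      then show ?thesis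
        using 2 jk by (simp add: rotation_mat_def plane_rotation_def scaleR_conv_of_real)
    qed (use jk i in \<open>simp_all add: rotation_mat_def plane_rotation_def scaleR_conv_of_real\<close>)
  qed
  finally show ?thesis .
qed

lemma eq_one_matI:
  assumes M: "M \<in> carrier_mat n n" and *: "\<And>x. x \<in> carrier_vec n \<Longrightarrow> M *\<^sub>v x = (x :: 'a::comm_ring_1 vec)"
  shows "M = 1\<^sub>m n"
proof (rule eq_matI)
  fix i j assume "i < dim_row (1\<^sub>m n :: 'a mat)" "j < dim_col (1\<^sub>m n :: 'a mat)"
  then have ij: "i < n" "j < n" by auto
  have "(M *\<^sub>v unit_vec n j) $ i = M $$ (i, j)" using M ij by simp
  then show "M $$ (i, j) = 1\<^sub>m n $$ (i, j)" using *[of "unit_vec n j"] ij by simp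
qed (use M in auto)

text \<open>The adjoint is the rotation by the opposite angle, which undoes the rotation on every
  vector.\<close>

lemma rotation_mat_unitary:
  assumes jk: "j < n" "k < n" "j \<noteq> k" and cs: "c\<^sup>2 + s\<^sup>2 = 1"
  shows "rotation_mat n j k c s \<in> (unitary_group n :: 'a::real_or_complex mat set)"
proof -
  let ?G = "rotation_mat n j k c s :: 'a mat" and ?H = "rotation_mat n j k c (- s) :: 'a mat"
  have adj: "mat_adjoint ?G = ?H"
    by (rule eq_matI) (use jk in \<open>auto simp: rotation_mat_def conjugate_neg\<close>)
  have "?H * ?G = 1\<^sub>m n"
  proof (rule eq_one_matI)
    fix x :: "'a vec" assume x: "x \<in> carrier_vec n"
    have cs': "c\<^sup>2 + (- s)\<^sup>2 = 1" using cs by simp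
    have Gx: "?G *\<^sub>v x \<in> carrier_vec n" using x by simp
    have "?H *\<^sub>v (?G *\<^sub>v x) = x"
    proof (rule eq_vecI)
      fix i assume "i < dim_vec x"
      then have i: "i < n" using x by simp
      have "(?H *\<^sub>v (?G *\<^sub>v x)) $ i = plane_rotation n j k c (- s) (\<lambda>l. (?G *\<^sub>v x) $ l) i"
        by (rule rotation_mat_mult_vec[OF jk Gx i])
      also have "\<dots> = plane_rotation n j k c (- s) (plane_rotation n j k c s (\<lambda>l. x $ l)) i"
        using rotation_mat_mult_vec[OF jk x] jk i by (simp add: plane_rotation_def[of n j k c "- s"])
      also have "\<dots> = x $ i" using plane_rotation_inverse[OF jk cs' i, of "\<lambda>l. x $ l"] by simp
      finally show "(?H *\<^sub>v (?G *\<^sub>v x)) $ i = x $ i" .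
    qed (use x in \<open>simp add: rotation_mat_def\<close>)
    then show "?H * ?G *\<^sub>v x = x" using x by (simp add: assoc_mult_mat_vec[of _ n n _ n])
  qed simp
  then show ?thesis by (simp add: unitary_group_def adj)
qed

text \<open>A rotation \<open>G\<close> applied to A U a equals A (V U) a with V = A* G A in the
  group, so left invariance of the law of \<open>U\<close> suffices. The fixed \<open>A\<close> will
  be the change to the eigenbasis of \<open>H\<close>.\<close>

lemma haar_column_rotation_invariant:
  fixes \<mu> :: "'a::real_or_complex mat measure"
  assumes haar: "haar_law n \<mu>" and A: "A \<in> unitary_group n" and a: "a \<in> carrier_vec n" "norm_sq a = 1"
  defines "Y \<equiv> \<lambda>U. \<lambda>l\<in>{..<n}. (A *\<^sub>v (U *\<^sub>v a)) $ l"
  shows "Y \<in> measurable \<mu> (PiM {..<n} (\<lambda>_. borel))"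
    and "rotation_invariant n (distr \<mu> (PiM {..<n} (\<lambda>_. borel)) Y)"
proof -
  interpret prob_space \<mu> using haar by (simp add: haar_law_def)
  note AD = unitary_groupD[OF A]
  have U: "U \<in> unitary_group n" "U \<in> carrier_mat n n" if "U \<in> space \<mu>" for U
    using that haar_space[OF haar] by (auto simp: unitary_group_def)
  show Y: "Y \<in> measurable \<mu> (PiM {..<n} (\<lambda>_. borel))"
    unfolding Y_def
  proof (rule measurable_restrict)
    fix l assume "l \<in> {..<n}"
    then have l: "l < n" by simp
    have "(\<lambda>U. \<Sum>i<n. A $$ (l, i) * (\<Sum>j<n. U $$ (i, j) * a $ j)) \<in> borel_measurable \<mu>"
      using haar_measurable_entry[OF haar]
      by (intro borel_measurable_sum borel_measurable_times) auto
    also have "?this \<longleftrightarrow> (\<lambda>U. (A *\<^sub>v (U *\<^sub>v a)) $ l) \<in> borel_measurable \<mu>"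
    proof (rule measurable_cong)
      fix V assume "V \<in> space \<mu>"
      then show "(\<Sum>i<n. A $$ (l, i) * (\<Sum>j<n. V $$ (i, j) * a $ j)) = (A *\<^sub>v (V *\<^sub>v a)) $ l"
        using U(2)[of V] AD a l by (simp add: scalar_prod_def lessThan_atLeast0)
    qed
    finally show "(\<lambda>U. (A *\<^sub>v (U *\<^sub>v a)) $ l) \<in> borel_measurable \<mu>" .
  qed
  let ?P = "PiM {..<n} (\<lambda>_. borel) :: (nat \<Rightarrow> 'a) measure"
  define \<nu> where "\<nu> = distr \<mu> ?P Y"
  have ps: "prob_space \<nu>" unfolding \<nu>_def by (rule prob_space_distr[OF Y])
  have sets: "sets \<nu> = sets ?P" by (simp add: \<nu>_def)
  have rot: "distr \<nu> \<nu> (plane_rotation n j k c s) = \<nu>"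
    if jk: "j < n" "k < n" "j \<noteq> k" and cs: "c\<^sup>2 + s\<^sup>2 = 1" for j k c s
  proof -
    let ?G = "rotation_mat n j k c s :: 'a mat"
    have G: "?G \<in> unitary_group n" by (rule rotation_mat_unitary[OF jk cs])
    define V where "V = mat_adjoint A * ?G * A"
    have V: "V \<in> unitary_group n"
      unfolding V_def using A G by (intro unitary_group_mult unitary_group_adjoint)
    have YV: "plane_rotation n j k c s (Y U) = Y (V * U)" if "U \<in> space \<mu>" for U
    proof
      fix l
      note UD = U(2)[OF that]
      let ?x = "A *\<^sub>v (U *\<^sub>v a)"
      have x: "?x \<in> carrier_vec n" using AD UD a by simp
      have "V * U *\<^sub>v a = mat_adjoint A *\<^sub>v (?G *\<^sub>v ?x)"
        unfolding V_def using AD UD a x by (simp add: assoc_mult_mat_vec[of _ n n _ n])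
      then have "A *\<^sub>v (V * U *\<^sub>v a) = ?G *\<^sub>v ?x"
        using unitary_group_cancel_vec(2)[OF A, of "?G *\<^sub>v ?x"] x by simp
      then show "plane_rotation n j k c s (Y U) l = Y (V * U) l"
        using rotation_mat_mult_vec[OF jk x, of l c s] jk by (auto simp: Y_def plane_rotation_def)
    qed
    have rot: "plane_rotation n j k c s \<in> measurable ?P ?P" by (rule measurable_plane_rotation[OF jk(1,2)])
    have "distr \<nu> \<nu> (plane_rotation n j k c s) = distr \<nu> ?P (plane_rotation n j k c s)"
      by (rule distr_cong) (auto simp: sets)
    also have "\<dots> = distr \<mu> ?P (plane_rotation n j k c s \<circ> Y)"
      unfolding \<nu>_def by (rule distr_distr[OF rot Y])
    also have "\<dots> = distr \<mu> ?P (Y \<circ> (\<lambda>U. V * U))"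
      by (rule distr_cong) (auto simp: YV)
    also have "\<dots> = distr (distr \<mu> \<mu> (\<lambda>U. V * U)) ?P Y"
      by (rule distr_distr[OF Y haar_measurable_mult[OF haar V], symmetric])
    also have "\<dots> = \<nu>" using haar V by (simp add: haar_law_def \<nu>_def)
    finally show ?thesis .
  qed
  have ae: "AE v in \<nu>. (\<Sum>l<n. (norm (v l))\<^sup>2) = 1"
    unfolding \<nu>_def
  proof (subst AE_distr_iff[OF Y])
    show "{v \<in> space ?P. (\<Sum>l<n. (norm (v l))\<^sup>2) = 1} \<in> sets ?P"
      by measurable
    show "AE U in \<mu>. (\<Sum>l<n. (norm (Y U l))\<^sup>2) = 1"
    proof (rule AE_I2)
      fix V assume V: "V \<in> space \<mu>"
      have "(\<Sum>l<n. (norm (Y V l))\<^sup>2) = norm_sq (A *\<^sub>v (V *\<^sub>v a))"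
        using AD U(2)[OF V] by (simp add: Y_def norm_sq_def)
      also have "\<dots> = norm_sq a"
        using norm_sq_isometry[OF A, of "V *\<^sub>v a"] norm_sq_isometry[OF U(1)[OF V] a(1)] U(2)[OF V] a by simp
      finally show "(\<Sum>l<n. (norm (Y V l))\<^sup>2) = 1" using a by simp
    qed
  qed
  show "rotation_invariant n (distr \<mu> ?P Y)"
    unfolding rotation_invariant_def \<nu>_def[symmetric]
    by (intro conjI allI impI ps sets rot ae)
qed

section \<open>Homogeneity and polarization of quadratic forms\<close>

lemma mult_mat_zero_vec [simp]: "A \<in> carrier_mat n m \<Longrightarrow> A *\<^sub>v 0\<^sub>v m = 0\<^sub>v n"
  by (intro eq_vecI) auto

lemma norm_sq_smult: "norm_sq (c \<cdot>\<^sub>v v) = (norm c)\<^sup>2 * norm_sq (v :: 'a::real_or_complex vec)"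
  by (simp add: norm_sq_def norm_mult power_mult_distrib sum_distrib_left)

lemma norm_sq_parallelogram:
  fixes x y :: "'a::real_or_complex vec"
  assumes "x \<in> carrier_vec n" "y \<in> carrier_vec n"
  shows "norm_sq (x + y) + norm_sq (x - y) = 2 * norm_sq x + 2 * norm_sq y"
proof -
  have *: "(norm (a + b))\<^sup>2 + (norm (a - b))\<^sup>2 = 2 * (norm a)\<^sup>2 + 2 * (norm b)\<^sup>2" for a b :: 'a
    using norm_add_sq[of a b] norm_add_sq[of a "- b"] by (simp add: conjugate_neg re_minus)
  have "norm_sq (x + y) + norm_sq (x - y)
      = (\<Sum>i<n. (norm (x $ i + y $ i))\<^sup>2 + (norm (x $ i - y $ i))\<^sup>2)"
    using assms by (simp add: norm_sq_def sum.distrib)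
  also have "\<dots> = 2 * norm_sq x + 2 * norm_sq y"
    unfolding * using assms by (simp add: norm_sq_def sum.distrib sum_distrib_left)
  finally show ?thesis .
qed

lemma norm_sq_diff_le:
  fixes x y :: "'a::real_or_complex vec"
  assumes "x \<in> carrier_vec n" "y \<in> carrier_vec n"
  shows "norm_sq (x + y) \<le> 2 * norm_sq x + 2 * norm_sq y"
  using norm_sq_parallelogram[OF assms] norm_sq_nonneg[of "x - y"] by linarith

lemma weighted_norm_sq_smult:
  assumes "v \<in> carrier_vec n"
  shows "weighted_norm_sq n d (\<lambda>l. (c \<cdot>\<^sub>v v) $ l) = (norm c)\<^sup>2 * weighted_norm_sq n d (\<lambda>l. (v :: 'a::real_or_complex vec) $ l)"
  using assms by (simp add: weighted_norm_sq_def norm_mult power_mult_distrib sum_distrib_left mult_ac)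

text \<open>With u = s (a - b) and v = (a + b) / s the factor \<open>s\<close> drops out of Re(u
  conj v) = |a|^2 - |b|^2, which equals (|u + v|^2 - |u - v|^2) / 4. The free parameter allows a
  small difference a - b to be balanced against a large sum a + b.\<close>

lemma weighted_norm_sq_polarization:
  fixes x y :: "'a::real_or_complex vec"
  assumes x: "x \<in> carrier_vec n" and y: "y \<in> carrier_vec n" and s: "s \<noteq> 0"
  shows "weighted_norm_sq n d (\<lambda>l. x $ l) - weighted_norm_sq n d (\<lambda>l. y $ l)
    = (weighted_norm_sq n d (\<lambda>l. (of_real s \<cdot>\<^sub>v (x - y) + of_real (1 / s) \<cdot>\<^sub>v (x + y)) $ l)
      - weighted_norm_sq n d (\<lambda>l. (of_real s \<cdot>\<^sub>v (x - y) - of_real (1 / s) \<cdot>\<^sub>v (x + y)) $ l)) / 4"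
proof -
  have *: "(norm (of_real s * (a - b) + of_real (1 / s) * (a + b)))\<^sup>2
      - (norm (of_real s * (a - b) - of_real (1 / s) * (a + b)))\<^sup>2 = 4 * ((norm a)\<^sup>2 - (norm b)\<^sup>2)" for a b :: 'a
  proof -
    let ?u = "of_real s * (a - b)" and ?v = "of_real (1 / s) * (a + b)"
    have "?u * conjugate ?v = (of_real s * of_real (1 / s)) * ((a - b) * conjugate (a + b))"
      by (simp only: conjugate_dist_mul conjugate_of_real mult_ac)
    also have "of_real s * of_real (1 / s) = (1 :: 'a)"
      using s by (metis nonzero_divide_eq_eq mult.commute of_real_1 of_real_mult)
    finally have "re (?u * conjugate ?v) = re ((a - b) * conjugate (a + b))" by (simp only: mult_1_left)
    also have "(a - b) * conjugate (a + b) = a * conjugate a - b * conjugate b + (a * conjugate b - b * conjugate a)"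
      by (simp add: conjugate_dist_add algebra_simps)
    also have "re \<dots> = (norm a)\<^sup>2 - (norm b)\<^sup>2"
      unfolding re_add re_diff mult_conjugate using re_mult_conjugate_commute[of a b]
      by (simp only: re_of_real)
    finally show ?thesis
      using norm_add_sq[of ?u ?v] norm_add_sq[of ?u "- ?v"] by (simp add: conjugate_neg re_minus)
  qed
  have "weighted_norm_sq n d (\<lambda>l. (of_real s \<cdot>\<^sub>v (x - y) + of_real (1 / s) \<cdot>\<^sub>v (x + y)) $ l)
      - weighted_norm_sq n d (\<lambda>l. (of_real s \<cdot>\<^sub>v (x - y) - of_real (1 / s) \<cdot>\<^sub>v (x + y)) $ l)
    = (\<Sum>l<n. d l * ((norm (of_real s * (x $ l - y $ l) + of_real (1 / s) * (x $ l + y $ l)))\<^sup>2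
      - (norm (of_real s * (x $ l - y $ l) - of_real (1 / s) * (x $ l + y $ l)))\<^sup>2))"
    using x y by (simp add: weighted_norm_sq_def right_diff_distrib sum_subtractf)
  also have "\<dots> = 4 * (weighted_norm_sq n d (\<lambda>l. x $ l) - weighted_norm_sq n d (\<lambda>l. y $ l))"
    unfolding * by (simp add: weighted_norm_sq_def right_diff_distrib sum_subtractf sum_distrib_left mult_ac)
  finally show ?thesis by simp
qed

section \<open>Uniform bounds on coordinate subspaces\<close>

text \<open>By homogeneity the unit-sphere bound applies to any \<open>a\<close>. The inequality
  defining \<open>S\<close> is strict, so that \<open>a = 0\<close> gives the empty set.\<close>

lemma haar_quadratic_tail:
  fixes \<mu> :: "'a::real_or_complex mat measure"
  assumes haar: "haar_law n \<mu>" and A: "A \<in> unitary_group n" and E: "E \<in> unitary_group n"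
    and dD: "\<And>l. l < n \<Longrightarrow> \<bar>d l\<bar> \<le> D" and D: "D > 0" and d0: "(\<Sum>l<n. d l) = 0" and n: "n > 0"
    and \<eta>: "\<eta> > 0" and a: "a \<in> carrier_vec n"
  defines "S \<equiv> {U \<in> space \<mu>. \<bar>weighted_norm_sq n d (\<lambda>l. (A *\<^sub>v (U *\<^sub>v (E *\<^sub>v a))) $ l)\<bar> > \<eta> * norm_sq a}"
  shows "S \<in> sets \<mu>" and "measure \<mu> S \<le> 2 * exp (- (\<eta>\<^sup>2 * n / (48 * D\<^sup>2)))"
proof -
  interpret prob_space \<mu> using haar by (simp add: haar_law_def)
  note AD = unitary_groupD[OF A] and ED = unitary_groupD[OF E]
  have Ucar: "U \<in> carrier_mat n n" if "U \<in> space \<mu>" for U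
    using that haar_space[OF haar] by (auto simp: unitary_group_def)
  have "S \<in> sets \<mu> \<and> measure \<mu> S \<le> 2 * exp (- (\<eta>\<^sup>2 * n / (48 * D\<^sup>2)))"
  proof (cases "a = 0\<^sub>v n")
    case True
    have "S = {}"
    proof -
      have "A *\<^sub>v (U *\<^sub>v (E *\<^sub>v a)) = 0\<^sub>v n" if "U \<in> space \<mu>" for U
        unfolding True mult_mat_zero_vec[OF ED(1)] mult_mat_zero_vec[OF Ucar[OF that]]
          mult_mat_zero_vec[OF AD(1)] ..
      then show ?thesis
        using True by (auto simp: S_def weighted_norm_sq_def norm_sq_def)
    qed
    then show ?thesis by simp
  next
    case False
    define r where "r = sqrt (norm_sq a)"
    have pos: "norm_sq a > 0" using False norm_sq_eq_0_iff[OF a] by (simp add: less_le)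
    then have r: "r > 0" "r\<^sup>2 = norm_sq a" by (auto simp: r_def)
    define b where "b = of_real (1 / r) \<cdot>\<^sub>v (E *\<^sub>v a)"
    have b: "b \<in> carrier_vec n" using ED a by (simp add: b_def)
    have "norm_sq b = (1 / r)\<^sup>2 * norm_sq (E *\<^sub>v a)"
      unfolding b_def norm_sq_smult by (simp only: norm_of_real power2_abs)
    then have b1: "norm_sq b = 1"
      using norm_sq_isometry[OF E a] r pos by (simp add: power_divide)
    have Ea: "E *\<^sub>v a = of_real r \<cdot>\<^sub>v b"
      using r ED a by (auto simp: b_def intro!: eq_vecI)
    define Y where "Y = (\<lambda>U. \<lambda>l\<in>{..<n}. (A *\<^sub>v (U *\<^sub>v b)) $ l)"
    define \<nu> where "\<nu> = distr \<mu> (PiM {..<n} (\<lambda>_. borel)) Y"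
    note Y = haar_column_rotation_invariant[OF haar A b b1, folded Y_def]
    have scale: "weighted_norm_sq n d (\<lambda>l. (A *\<^sub>v (U *\<^sub>v (E *\<^sub>v a))) $ l) = norm_sq a * weighted_norm_sq n d (Y U)"
      if "U \<in> space \<mu>" for U
    proof -
      have "A *\<^sub>v (U *\<^sub>v (E *\<^sub>v a)) = of_real r \<cdot>\<^sub>v (A *\<^sub>v (U *\<^sub>v b))"
        unfolding Ea using AD Ucar[OF that] b by (simp add: mult_mat_vec[of _ n n])
      then have "weighted_norm_sq n d (\<lambda>l. (A *\<^sub>v (U *\<^sub>v (E *\<^sub>v a))) $ l)
          = r\<^sup>2 * weighted_norm_sq n d (\<lambda>l. (A *\<^sub>v (U *\<^sub>v b)) $ l)"
        using weighted_norm_sq_smult[of "A *\<^sub>v (U *\<^sub>v b)" n d "of_real r"] AD Ucar[OF that] b by simp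
      also have "weighted_norm_sq n d (\<lambda>l. (A *\<^sub>v (U *\<^sub>v b)) $ l) = weighted_norm_sq n d (Y U)"
        by (rule weighted_norm_sq_cong) (simp add: Y_def)
      finally show ?thesis by (simp add: r)
    qed
    have S: "S = {U \<in> space \<mu>. \<bar>weighted_norm_sq n d (Y U)\<bar> > \<eta>}"
      unfolding S_def using scale pos by (auto simp: abs_mult)
    have qY [measurable]: "(\<lambda>U. weighted_norm_sq n d (Y U)) \<in> borel_measurable \<mu>"
      by (rule measurable_compose[OF Y(1) measurable_weighted_norm_sq])
    have "S \<in> sets \<mu>" unfolding S by measurable
    moreover have "measure \<mu> S \<le> measure \<nu> {v \<in> space \<nu>. \<bar>weighted_norm_sq n d v\<bar> \<ge> \<eta>}"
    proof -
      have "measure \<nu> {v \<in> space \<nu>. \<bar>weighted_norm_sq n d v\<bar> \<ge> \<eta>}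
          = measure \<mu> (Y -` {v \<in> space \<nu>. \<bar>weighted_norm_sq n d v\<bar> \<ge> \<eta>} \<inter> space \<mu>)"
        unfolding \<nu>_def by (rule measure_distr[OF Y(1)]) (simp, measurable)
      also have "Y -` {v \<in> space \<nu>. \<bar>weighted_norm_sq n d v\<bar> \<ge> \<eta>} \<inter> space \<mu>
          = {U \<in> space \<mu>. \<bar>weighted_norm_sq n d (Y U)\<bar> \<ge> \<eta>}"
        using measurable_space[OF Y(1)] by (auto simp: \<nu>_def)
      finally show ?thesis
        unfolding S by (auto intro!: finite_measure_mono)
    qed
    moreover have "\<dots> \<le> 2 * exp (- (\<eta>\<^sup>2 * n / (48 * D\<^sup>2)))"
      unfolding \<nu>_def by (rule sphere_concentration[OF Y(2) dD D d0 n \<eta>])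
    ultimately show ?thesis by simp
  qed
  then show "S \<in> sets \<mu>" "measure \<mu> S \<le> 2 * exp (- (\<eta>\<^sup>2 * n / (48 * D\<^sup>2)))" by auto
qed

section \<open>Integer points of a ball as a net\<close>

definition lattice_ball :: "'i set \<Rightarrow> int \<Rightarrow> ('i \<Rightarrow> int) set" where
  "lattice_ball I K = {a \<in> PiE I (\<lambda>_. {-K..K}). (\<Sum>i\<in>I. (a i)\<^sup>2) \<le> K}"

lemma finite_lattice_ball: "finite I \<Longrightarrow> finite (lattice_ball I K)"
  unfolding lattice_ball_def by (rule finite_subset[OF _ finite_PiE[of I "\<lambda>_. {-K..K}"]]) auto

text \<open>An integer satisfies |a_i| <= a_i^2, so the bound on the sum of squares already forces
  the box, which is part of the definition to make finiteness immediate.\<close>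

lemma lattice_ballI:
  assumes I: "finite I" and a: "a \<in> extensional I" "(\<Sum>i\<in>I. (a i)\<^sup>2) \<le> K"
  shows "a \<in> lattice_ball I K"
proof -
  have "a i \<in> {-K..K}" if "i \<in> I" for i
  proof -
    have "(a i)\<^sup>2 \<le> (\<Sum>i\<in>I. (a i)\<^sup>2)" using I that by (intro member_le_sum) auto
    moreover have "\<bar>a i\<bar> \<le> (a i)\<^sup>2"
    proof (cases "a i = 0")
      case False
      then have "1 * \<bar>a i\<bar> \<le> \<bar>a i\<bar> * \<bar>a i\<bar>" by (intro mult_right_mono) auto
      then show ?thesis by (simp add: power2_eq_square)
    qed simp
    ultimately show ?thesis using a by auto
  qed
  then show ?thesis using a by (auto simp: lattice_ball_def PiE_iff)
qed

text \<open>Since e^(-k^2) <= 2^(-k), a geometric series dominates. The induction carries the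
  sharper bound 3 - 2 (1/2)^K.\<close>

lemma sum_exp_neg_sq_le: "(\<Sum>z\<in>{-int K..int K}. exp (- (real_of_int z)\<^sup>2)) \<le> 3"
proof -
  have half: "exp (- (real k)\<^sup>2) \<le> (1/2) ^ k" for k :: nat
  proof -
    have "(2::real) \<le> exp 1" using exp_ge_add_one_self[of 1] by simp
    then have "(2::real) ^ k \<le> exp (real k)"
      by (metis exp_of_nat_mult mult.right_neutral power_mono zero_le_numeral)
    also have "\<dots> \<le> exp ((real k)\<^sup>2)"
    proof -
      have "real k \<le> real (k\<^sup>2)" by (simp only: of_nat_le_iff) (simp add: power2_eq_square)
      then show ?thesis by simp
    qed
    finally show ?thesis by (simp add: exp_minus power_divide inverse_eq_divide frac_le)
  qed
  have "(\<Sum>z\<in>{-int K..int K}. exp (- (real_of_int z)\<^sup>2)) \<le> 3 - 2 * (1/2) ^ K"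
  proof (induction K)
    case (Suc K)
    have eq: "{-int (Suc K)..int (Suc K)} = insert (- int (Suc K)) (insert (int (Suc K)) {-int K..int K})"
      by auto
    have "(\<Sum>z\<in>{-int (Suc K)..int (Suc K)}. exp (- (real_of_int z)\<^sup>2))
        = 2 * exp (- (real (Suc K))\<^sup>2) + (\<Sum>z\<in>{-int K..int K}. exp (- (real_of_int z)\<^sup>2))"
    proof -
      let ?f = "\<lambda>z. exp (- (real_of_int z)\<^sup>2)"
      have "sum ?f (insert (- int (Suc K)) (insert (int (Suc K)) {-int K..int K}))
          = ?f (- int (Suc K)) + sum ?f (insert (int (Suc K)) {-int K..int K})"
        by (rule sum.insert) auto
      also have "sum ?f (insert (int (Suc K)) {-int K..int K}) = ?f (int (Suc K)) + sum ?f {-int K..int K}"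
        by (rule sum.insert) auto
      also have "?f (- int (Suc K)) = exp (- (real (Suc K))\<^sup>2)"
        by (simp only: of_int_minus of_int_of_nat_eq power2_minus)
      also have "?f (int (Suc K)) = exp (- (real (Suc K))\<^sup>2)"
        by (simp only: of_int_of_nat_eq)
      finally show ?thesis unfolding eq by (simp only: mult_2 add.assoc)
    qed
    also have "\<dots> \<le> 2 * (1/2) ^ Suc K + (3 - 2 * (1/2) ^ K)"
      using half[of "Suc K"] Suc by (intro add_mono mult_left_mono) auto
    finally show ?case by simp
  qed simp
  also have "\<dots> \<le> 3" by simp
  finally show ?thesis .
qed

text \<open>Counting with exponential weights in place of volumes: each point of the ball has weight
  e^(K - sum of squares) >= 1, and summed over the whole box this weight factorises over the
  coordinates.\<close>

lemma card_lattice_ball_le: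
  assumes I: "finite I"
  shows "real (card (lattice_ball I (int K))) \<le> exp (real K) * 3 ^ card I"
proof -
  let ?P = "PiE I (\<lambda>_. {-int K..int K})"
  have "real (card (lattice_ball I (int K))) = (\<Sum>a\<in>lattice_ball I (int K). 1)" by simp
  also have "\<dots> \<le> (\<Sum>a\<in>lattice_ball I (int K). exp (real K) * (\<Prod>i\<in>I. exp (- (real_of_int (a i))\<^sup>2)))"
  proof (rule sum_mono)
    fix a assume "a \<in> lattice_ball I (int K)"
    then have "(\<Sum>i\<in>I. (a i)\<^sup>2) \<le> int K" by (simp add: lattice_ball_def)
    then have "real_of_int (\<Sum>i\<in>I. (a i)\<^sup>2) \<le> real_of_int (int K)" by (simp only: of_int_le_iff)
    then have "(\<Sum>i\<in>I. (real_of_int (a i))\<^sup>2) \<le> real K" by simp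
    then have "1 \<le> exp (real K - (\<Sum>i\<in>I. (real_of_int (a i))\<^sup>2))" by simp
    also have "\<dots> = exp (real K) * (\<Prod>i\<in>I. exp (- (real_of_int (a i))\<^sup>2))"
      using I by (simp add: exp_diff exp_minus prod_inversef[symmetric] exp_sum divide_inverse)
    finally show "1 \<le> exp (real K) * (\<Prod>i\<in>I. exp (- (real_of_int (a i))\<^sup>2))" .
  qed
  also have "\<dots> \<le> (\<Sum>a\<in>?P. exp (real K) * (\<Prod>i\<in>I. exp (- (real_of_int (a i))\<^sup>2)))"
    using I by (intro sum_mono2 finite_PiE) (auto simp: lattice_ball_def intro!: prod_nonneg mult_nonneg_nonneg)
  also have "\<dots> = exp (real K) * (\<Prod>i\<in>I. \<Sum>z\<in>{-int K..int K}. exp (- (real_of_int z)\<^sup>2))"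
    by (subst prod_sum_PiE) (use I in \<open>simp_all add: sum_distrib_left\<close>)
  also have "\<dots> \<le> exp (real K) * (\<Prod>i\<in>I. 3)"
    by (intro mult_left_mono prod_mono conjI sum_exp_neg_sq_le sum_nonneg) auto
  finally show ?thesis by simp
qed

text \<open>Two integers per coordinate are the real coordinates of a scalar with respect to 1 and
  the \<open>w\<close> supplied by \<open>ex_imaginary_unit\<close>.\<close>

definition lattice_vec :: "nat \<Rightarrow> nat set \<Rightarrow> 'a \<Rightarrow> (nat \<times> bool \<Rightarrow> int) \<Rightarrow> 'a::real_or_complex vec" where
  "lattice_vec n J w a = vec n (\<lambda>j. if j \<in> J then of_int (a (j, False)) + of_int (a (j, True)) * w else 0)"

lemma lattice_vec_carrier [simp]: "lattice_vec n J w a \<in> carrier_vec n"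
  by (simp add: lattice_vec_def)

lemma sum_square_bool:
  fixes f :: "'i \<times> bool \<Rightarrow> 'b::comm_monoid_add"
  assumes "finite J"
  shows "(\<Sum>i\<in>J \<times> UNIV. f i) = (\<Sum>j\<in>J. f (j, False) + f (j, True))"
  using sum.cartesian_product[of "\<lambda>j b. f (j, b)" "UNIV :: bool set" J] by (simp add: UNIV_bool add.commute)

lemma norm_sq_lattice_vec_le:
  assumes J: "J \<subseteq> {..<n}" and w: "norm (w :: 'a::real_or_complex) \<le> 1" and a: "a \<in> lattice_ball (J \<times> UNIV) K"
  shows "norm_sq (lattice_vec n J w a) \<le> 2 * of_int K"
proof -
  have fin: "finite J" using J finite_subset by blast
  have "norm_sq (lattice_vec n J w a) = (\<Sum>j\<in>J. (norm (of_int (a (j, False)) + of_int (a (j, True)) * w))\<^sup>2)"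
    using J by (simp add: norm_sq_def lattice_vec_def if_distrib[of norm] if_distrib[of "\<lambda>x. x\<^sup>2"] cong: if_cong)
      (simp add: sum.If_cases Int_absorb1)
  also have "\<dots> \<le> (\<Sum>j\<in>J. 2 * ((of_int (a (j, False)))\<^sup>2 + (of_int (a (j, True)))\<^sup>2))"
  proof (rule sum_mono)
    fix j
    let ?x = "real_of_int (a (j, False))" and ?y = "real_of_int (a (j, True))"
    have "norm (of_int (a (j, False)) + of_int (a (j, True)) * w) \<le> \<bar>?x\<bar> + \<bar>?y\<bar> * norm w"
      by (rule order.trans[OF norm_triangle_ineq]) (simp add: norm_mult)
    also have "\<dots> \<le> \<bar>?x\<bar> + \<bar>?y\<bar> * 1" using w by (intro add_mono mult_left_mono) auto
    finally have "(norm (of_int (a (j, False)) + of_int (a (j, True)) * w))\<^sup>2 \<le> (\<bar>?x\<bar> + \<bar>?y\<bar>)\<^sup>2"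
      by (intro power_mono) auto
    also have "\<dots> \<le> 2 * (?x\<^sup>2 + ?y\<^sup>2)"
      using sum_squares_bound[of "\<bar>?x\<bar>" "\<bar>?y\<bar>"] by (simp add: power2_sum)
    finally show "(norm (of_int (a (j, False)) + of_int (a (j, True)) * w))\<^sup>2 \<le> 2 * (?x\<^sup>2 + ?y\<^sup>2)" .
  qed
  also have "\<dots> = 2 * of_int (\<Sum>i\<in>J \<times> UNIV. (a i)\<^sup>2)"
    using fin by (simp add: sum_square_bool sum_distrib_left)
  also have "\<dots> \<le> 2 * of_int K"
  proof -
    have "(\<Sum>i\<in>J \<times> UNIV. (a i)\<^sup>2) \<le> K" using a by (simp add: lattice_ball_def)
    then show ?thesis by (simp only: of_int_le_iff mult_le_cancel_left_pos zero_less_numeral)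
  qed
  finally show ?thesis .
qed

text \<open>Scale the unit vector by R = 16 sqrt M, with M = \<open>card J\<close>, and round both
  real coordinates. Each scalar is then off by at most (1/2 + 1/2) / R, so the squared error is at
  most M / R^2 = 1/256.\<close>

lemma lattice_approximation:
  fixes c :: "'a::real_or_complex vec"
  assumes J: "J \<subseteq> {..<n}" "J \<noteq> {}" and c: "c \<in> carrier_vec n" "norm_sq c = 1" and supp: "\<And>j. j < n \<Longrightarrow> j \<notin> J \<Longrightarrow> c $ j = 0"
    and w: "norm w \<le> 1" "\<And>x :: 'a. x = Re (to_complex x) *\<^sub>R 1 + Im (to_complex x) *\<^sub>R w"
  shows "\<exists>a\<in>lattice_ball (J \<times> UNIV) (int (513 * card J)).
    norm_sq (c - of_real (1 / (16 * sqrt (real (card J)))) \<cdot>\<^sub>v lattice_vec n J w a) \<le> 1 / 256"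
proof -
  have fin: "finite J" using J finite_subset by blast
  have M: "real (card J) > 0" using fin J by (simp add: card_gt_0_iff)
  define R where "R = 16 * sqrt (real (card J))"
  have R: "R > 0" "R\<^sup>2 = 256 * card J" using M by (auto simp: R_def power_mult_distrib)
  define x where "x = (\<lambda>(j, b). R * (if b then Im (to_complex (c $ j)) else Re (to_complex (c $ j))))"
  define a where "a = restrict (\<lambda>i. round (x i)) (J \<times> UNIV)"
  have err: "\<bar>x i - of_int (round (x i))\<bar> \<le> 1 / 2" for i
    using of_int_round_abs_le[of "x i"] by (simp add: abs_minus_commute)
  have sum_c: "(\<Sum>j\<in>J. (norm (c $ j))\<^sup>2) = 1"
  proof -
    have "(\<Sum>j<n. (norm (c $ j))\<^sup>2) = (\<Sum>j\<in>J. (norm (c $ j))\<^sup>2)"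
      using J supp by (intro sum.mono_neutral_right) auto
    then show ?thesis using c by (simp add: norm_sq_def)
  qed
  have sum_x: "(\<Sum>i\<in>J \<times> UNIV. (x i)\<^sup>2) = R\<^sup>2"
  proof -
    have "(\<Sum>i\<in>J \<times> UNIV. (x i)\<^sup>2) = (\<Sum>j\<in>J. R\<^sup>2 * (norm (c $ j))\<^sup>2)"
      unfolding sum_square_bool[OF fin]
      by (intro sum.cong) (auto simp: x_def power_mult_distrib cmod_power2 simp flip: norm_to_complex[of "c $ _"] distrib_left)
    then show ?thesis using sum_c by (simp flip: sum_distrib_left)
  qed
  have "a \<in> lattice_ball (J \<times> UNIV) (int (513 * card J))"
  proof (rule lattice_ballI)
    have "real_of_int (\<Sum>i\<in>J \<times> UNIV. (a i)\<^sup>2) = (\<Sum>i\<in>J \<times> UNIV. (real_of_int (round (x i)))\<^sup>2)"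
      by (simp add: a_def)
    \<comment> \<open>Rounding changes a number by at most 1/2, so its square is at most 2 x^2 +
      1/2. Over the 2M coordinates this adds up to 2 R^2 + M = 513 M, the radius used for the
      lattice ball.\<close>
    also have "\<dots> \<le> (\<Sum>i\<in>J \<times> UNIV. 2 * (x i)\<^sup>2 + 1 / 2)"
    proof (rule sum_mono)
      fix i
      define e where "e = of_int (round (x i)) - x i"
      have "\<bar>e\<bar>\<^sup>2 \<le> (1 / 2)\<^sup>2" using err[of i] by (intro power_mono) (auto simp: e_def abs_minus_commute)
      then have e: "e\<^sup>2 \<le> 1 / 4" by (simp add: power_divide)
      have "(of_int (round (x i)))\<^sup>2 = (x i + e)\<^sup>2" by (simp add: e_def)
      also have "\<dots> \<le> 2 * (x i)\<^sup>2 + 2 * e\<^sup>2"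
        using sum_squares_bound[of "x i" e] by (simp add: power2_sum)
      also have "\<dots> \<le> 2 * (x i)\<^sup>2 + 1 / 2" using e by simp
      finally show "(of_int (round (x i)))\<^sup>2 \<le> 2 * (x i)\<^sup>2 + 1 / 2" .
    qed
    also have "\<dots> = 2 * R\<^sup>2 + card J"
      using fin by (simp add: sum.distrib sum_x card_cartesian_product flip: sum_distrib_left)
    also have "\<dots> = real_of_int (int (513 * card J))" by (simp add: R)
    finally show "(\<Sum>i\<in>J \<times> UNIV. (a i)\<^sup>2) \<le> int (513 * card J)" by (simp only: of_int_le_iff)
  qed (use fin in \<open>auto simp: a_def\<close>)
  moreover have "norm_sq (c - of_real (1 / R) \<cdot>\<^sub>v lattice_vec n J w a) \<le> 1 / 256"
  proof -
    have "norm_sq (c - of_real (1 / R) \<cdot>\<^sub>v lattice_vec n J w a)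
        = (\<Sum>j<n. (norm (c $ j - of_real (1 / R) * lattice_vec n J w a $ j))\<^sup>2)"
      using c by (simp add: norm_sq_def lattice_vec_def)
    also have "\<dots> = (\<Sum>j\<in>J. (norm (c $ j - of_real (1 / R) * lattice_vec n J w a $ j))\<^sup>2)"
      using J supp by (intro sum.mono_neutral_right) (auto simp: lattice_vec_def)
    also have "\<dots> \<le> (\<Sum>j\<in>J. (1 / R)\<^sup>2)"
    proof (intro sum_mono power_mono)
      fix j assume j: "j \<in> J"
      let ?u = "x (j, False) - of_int (round (x (j, False)))" and ?v = "x (j, True) - of_int (round (x (j, True)))"
      have "c $ j = (1 / R) *\<^sub>R (x (j, False) *\<^sub>R 1 + x (j, True) *\<^sub>R w)"
        using R w(2)[of "c $ j"] by (simp add: x_def scaleR_add_right)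
      moreover have "of_real (1 / R) * lattice_vec n J w a $ j
          = (1 / R) *\<^sub>R (real_of_int (round (x (j, False))) *\<^sub>R 1 + real_of_int (round (x (j, True))) *\<^sub>R w)"
        using j J by (auto simp: lattice_vec_def a_def scaleR_conv_of_real)
      ultimately have "c $ j - of_real (1 / R) * lattice_vec n J w a $ j = (1 / R) *\<^sub>R (?u *\<^sub>R 1 + ?v *\<^sub>R w)"
        by (simp only: scaleR_diff_left scaleR_diff_right[symmetric]) (simp only: algebra_simps)
      also have "norm \<dots> \<le> 1 / R"
      proof -
        have "norm (?u *\<^sub>R 1 + ?v *\<^sub>R w) \<le> \<bar>?u\<bar> + \<bar>?v\<bar> * norm w"
          by (rule order.trans[OF norm_triangle_ineq]) simp
        also have "\<dots> \<le> 1 / 2 + 1 / 2 * 1"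
          using w err by (intro add_mono mult_mono) auto
        finally show ?thesis using R by (simp add: divide_right_mono)
      qed
      finally show "norm (c $ j - of_real (1 / R) * lattice_vec n J w a $ j) \<le> 1 / R" .
    qed auto
    also have "\<dots> = 1 / 256" using R M by (simp add: power_divide)
    finally show ?thesis .
  qed
  ultimately show ?thesis unfolding R_def by blast
qed

section \<open>From the net to a whole coordinate subspace\<close>

definition supported :: "nat \<Rightarrow> nat set \<Rightarrow> 'a::zero vec \<Rightarrow> bool" where
  "supported n J c \<longleftrightarrow> c \<in> carrier_vec n \<and> (\<forall>j<n. j \<notin> J \<longrightarrow> c $ j = 0)"

text \<open>A net bound \<eta> together with any known bound \<rho> yields the bound 5 \<eta> +
  \<rho> / 2. The difference between a vector and its net point is written by polarization as a
  difference of two values of the form on supported vectors, where the old bound applies.\<close>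

lemma net_improvement:
  fixes G :: "'a::real_or_complex mat"
  assumes G: "G \<in> carrier_mat n n" and J: "J \<subseteq> {..<n}" "J \<noteq> {}"
    and w: "norm w \<le> 1" "\<And>x :: 'a. x = Re (to_complex x) *\<^sub>R 1 + Im (to_complex x) *\<^sub>R w"
    and \<eta>: "0 \<le> \<eta>" and \<rho>: "0 \<le> \<rho>"
    and net: "\<And>a. a \<in> lattice_ball (J \<times> UNIV) (int (513 * card J)) \<Longrightarrow>
      \<bar>weighted_norm_sq n d (\<lambda>l. (G *\<^sub>v lattice_vec n J w a) $ l)\<bar> \<le> \<eta> * norm_sq (lattice_vec n J w a)"
    and old: "\<And>c. supported n J c \<Longrightarrow> \<bar>weighted_norm_sq n d (\<lambda>l. (G *\<^sub>v c) $ l)\<bar> \<le> \<rho> * norm_sq c"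
    and c: "supported n J c"
  shows "\<bar>weighted_norm_sq n d (\<lambda>l. (G *\<^sub>v c) $ l)\<bar> \<le> (5 * \<eta> + \<rho> / 2) * norm_sq c"
proof -
  let ?q = "\<lambda>c. weighted_norm_sq n d (\<lambda>l. (G *\<^sub>v c) $ l)"
  have q_smult: "?q (of_real r \<cdot>\<^sub>v v) = r\<^sup>2 * ?q v" if "v \<in> carrier_vec n" for r v
    using weighted_norm_sq_smult[of "G *\<^sub>v v" n d "of_real r"] that G by (simp add: mult_mat_vec[of _ n n])
  have unit: "\<bar>?q c\<bar> \<le> 5 * \<eta> + \<rho> / 2" if c: "supported n J c" and c1: "norm_sq c = 1" for c
  proof -
    have cc: "c \<in> carrier_vec n" and supp: "\<And>j. j < n \<Longrightarrow> j \<notin> J \<Longrightarrow> c $ j = 0"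
      using c by (auto simp: supported_def)
    have M: "real (card J) > 0" using J finite_subset[OF J(1)] by (simp add: card_gt_0_iff)
    obtain a where a: "a \<in> lattice_ball (J \<times> UNIV) (int (513 * card J))"
      and err: "norm_sq (c - of_real (1 / (16 * sqrt (real (card J)))) \<cdot>\<^sub>v lattice_vec n J w a) \<le> 1 / 256"
      using lattice_approximation[OF J cc c1 supp w] by blast
    let ?r = "1 / (16 * sqrt (real (card J)))"
    define v where "v = of_real ?r \<cdot>\<^sub>v lattice_vec n J w a"
    have v: "v \<in> carrier_vec n" by (simp add: v_def)
    have vs: "supported n J v" by (auto simp: supported_def v_def lattice_vec_def)
    have r2: "?r\<^sup>2 = 1 / (256 * card J)" using M by (simp add: power_divide power_mult_distrib)
    have "\<bar>?q v\<bar> = ?r\<^sup>2 * \<bar>?q (lattice_vec n J w a)\<bar>"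
      unfolding v_def q_smult[OF lattice_vec_carrier] by (simp add: abs_mult)
    also have "\<dots> \<le> ?r\<^sup>2 * (\<eta> * (2 * of_int (int (513 * card J))))"
      using net[OF a] norm_sq_lattice_vec_le[OF J(1) w(1) a] \<eta>
      by (intro mult_left_mono) (auto intro: order.trans mult_left_mono)
    \<comment> \<open>Squared scale 1 / (256 M) times the largest squared norm 2 * 513 M of a net
      vector.\<close>
    also have "\<dots> = \<eta> * (1026 / 256)" unfolding r2 using M by simp
    also have "\<dots> \<le> \<eta> * 5" using \<eta> by (intro mult_left_mono) auto
    finally have qv: "\<bar>?q v\<bar> \<le> 5 * \<eta>" by simp
    define e where "e = c - v"
    have e: "e \<in> carrier_vec n" using cc v by (simp add: e_def)
    have e_le: "norm_sq e \<le> 1 / 256" using err by (simp add: e_def v_def)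
    define g where "g = c + v"
    have g: "g \<in> carrier_vec n" using cc v by (simp add: g_def)
    have g_le: "norm_sq g \<le> 9"
    proof -
      have "g = of_real 2 \<cdot>\<^sub>v c + of_real (- 1) \<cdot>\<^sub>v e"
        using cc v by (intro eq_vecI) (auto simp: g_def e_def)
      then have "norm_sq g \<le> 2 * norm_sq (of_real 2 \<cdot>\<^sub>v c :: 'a vec) + 2 * norm_sq (of_real (- 1) \<cdot>\<^sub>v e)"
        using norm_sq_diff_le[of "of_real 2 \<cdot>\<^sub>v c" n "of_real (- 1) \<cdot>\<^sub>v e"] cc e by simp
      also have "\<dots> = 8 + 2 * norm_sq e"
        unfolding norm_sq_smult norm_of_real by (simp add: c1)
      finally show ?thesis using e_le by simp
    qed
    \<comment> \<open>The factor 7 balances 49 |e|^2 <= 49/256 against |g|^2 / 49 <= 9/49. The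
      parallelogram law then gives |x|^2 + |y|^2 well below 2, and a quarter of 2 \<rho> is \<rho> /
      2.\<close>
    define x where "x = of_real 7 \<cdot>\<^sub>v e + of_real (1 / 7) \<cdot>\<^sub>v g"
    define y where "y = of_real 7 \<cdot>\<^sub>v e - of_real (1 / 7) \<cdot>\<^sub>v g"
    have xy: "x \<in> carrier_vec n" "y \<in> carrier_vec n" "supported n J x" "supported n J y"
      using e g c vs by (auto simp: x_def y_def supported_def e_def g_def)
    have Gx: "G *\<^sub>v x = of_real 7 \<cdot>\<^sub>v (G *\<^sub>v c - G *\<^sub>v v) + of_real (1 / 7) \<cdot>\<^sub>v (G *\<^sub>v c + G *\<^sub>v v)"
      and Gy: "G *\<^sub>v y = of_real 7 \<cdot>\<^sub>v (G *\<^sub>v c - G *\<^sub>v v) - of_real (1 / 7) \<cdot>\<^sub>v (G *\<^sub>v c + G *\<^sub>v v)"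
      unfolding x_def y_def e_def g_def using G cc v
      by (simp_all add: mult_add_distrib_mat_vec[of _ n n] mult_minus_distrib_mat_vec[of _ n n] mult_mat_vec[of _ n n])
    have "?q c - ?q v = (?q x - ?q y) / 4"
      unfolding Gx Gy using weighted_norm_sq_polarization[of "G *\<^sub>v c" n "G *\<^sub>v v" 7 d] G cc v by simp
    then have "\<bar>?q c - ?q v\<bar> = \<bar>?q x - ?q y\<bar> / 4" by (simp only: abs_divide abs_numeral)
    also have "\<dots> \<le> (\<bar>?q x\<bar> + \<bar>?q y\<bar>) / 4" by (intro divide_right_mono abs_triangle_ineq4) simp
    also have "\<dots> \<le> (\<rho> * norm_sq x + \<rho> * norm_sq y) / 4"
      using old xy by (intro divide_right_mono add_mono) auto
    also have "\<rho> * norm_sq x + \<rho> * norm_sq y = \<rho> * (norm_sq x + norm_sq y)"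
      by (simp only: distrib_left)
    also have "norm_sq x + norm_sq y = 2 * norm_sq (of_real 7 \<cdot>\<^sub>v e :: 'a vec) + 2 * norm_sq (of_real (1 / 7) \<cdot>\<^sub>v g)"
      unfolding x_def y_def by (rule norm_sq_parallelogram[of _ n]) (use e g in auto)
    also have "\<rho> * (2 * norm_sq (of_real 7 \<cdot>\<^sub>v e :: 'a vec) + 2 * norm_sq (of_real (1 / 7) \<cdot>\<^sub>v g))
        = \<rho> * (98 * norm_sq e + (2 / 49) * norm_sq g)"
      unfolding norm_sq_smult norm_of_real by (simp add: power_divide)
    also have "\<dots> \<le> \<rho> * 2"
      using \<rho> e_le g_le by (intro mult_left_mono) auto
    finally have "\<bar>?q c - ?q v\<bar> \<le> \<rho> / 2" by simp
    then show ?thesis using qv by linarith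
  qed
  show ?thesis
  proof (cases "c = 0\<^sub>v n")
    case True
    then show ?thesis using old[OF c] norm_sq_eq_0_iff[of c n] c by (simp add: supported_def)
  next
    case False
    have cc: "c \<in> carrier_vec n" using c by (simp add: supported_def)
    have pos: "norm_sq c > 0" using False norm_sq_eq_0_iff[OF cc] by (simp add: less_le)
    let ?s = "1 / sqrt (norm_sq c)"
    have s: "?s\<^sup>2 = 1 / norm_sq c" using pos by (simp add: power_divide)
    have "norm_sq (of_real ?s \<cdot>\<^sub>v c) = ?s\<^sup>2 * norm_sq c"
      unfolding norm_sq_smult by (simp only: norm_of_real power2_abs)
    then have "norm_sq (of_real ?s \<cdot>\<^sub>v c) = 1" using s pos by simp
    moreover have "supported n J (of_real ?s \<cdot>\<^sub>v c)" using c by (auto simp: supported_def)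
    ultimately have "\<bar>?q (of_real ?s \<cdot>\<^sub>v c)\<bar> \<le> 5 * \<eta> + \<rho> / 2" by (intro unit)
    then have "\<bar>?q c\<bar> / norm_sq c \<le> 5 * \<eta> + \<rho> / 2"
      unfolding q_smult[OF cc] s using pos by (simp add: abs_mult)
    then show ?thesis using pos by (simp add: pos_divide_le_eq)
  qed
qed

text \<open>Starting from the trivial bound \<open>D\<close>, the improvement step is iterated; 10
  \<eta> is the fixed point of \<rho> -> 5 \<eta> + \<rho> / 2, and the remainder D / 2^k tends to
  zero. No supremum over the sphere has to be attained.\<close>

lemma net_bound:
  fixes G :: "'a::real_or_complex mat"
  assumes G: "G \<in> unitary_group n" and J: "J \<subseteq> {..<n}" "J \<noteq> {}"
    and w: "norm w \<le> 1" "\<And>x :: 'a. x = Re (to_complex x) *\<^sub>R 1 + Im (to_complex x) *\<^sub>R w"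
    and \<eta>: "0 \<le> \<eta>" and dD: "\<And>l. l < n \<Longrightarrow> \<bar>d l\<bar> \<le> D" and D: "0 \<le> D"
    and net: "\<And>a. a \<in> lattice_ball (J \<times> UNIV) (int (513 * card J)) \<Longrightarrow>
      \<bar>weighted_norm_sq n d (\<lambda>l. (G *\<^sub>v lattice_vec n J w a) $ l)\<bar> \<le> \<eta> * norm_sq (lattice_vec n J w a)"
    and c: "supported n J c"
  shows "\<bar>weighted_norm_sq n d (\<lambda>l. (G *\<^sub>v c) $ l)\<bar> \<le> 10 * \<eta> * norm_sq c"
proof -
  note GD = unitary_groupD[OF G]
  have iter: "\<bar>weighted_norm_sq n d (\<lambda>l. (G *\<^sub>v c) $ l)\<bar> \<le> (10 * \<eta> + D * (1 / 2) ^ k) * norm_sq c"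
    if "supported n J c" for k c
    using that
  proof (induction k arbitrary: c)
    case 0
    then have cc: "c \<in> carrier_vec n" by (simp add: supported_def)
    have "(\<Sum>l<n. (norm ((G *\<^sub>v c) $ l))\<^sup>2) = norm_sq c"
      using norm_sq_isometry[OF G cc] GD by (simp add: norm_sq_def)
    then have "\<bar>weighted_norm_sq n d (\<lambda>l. (G *\<^sub>v c) $ l)\<bar> \<le> D * norm_sq c"
      using abs_weighted_norm_sq_le[of n d D "\<lambda>l. (G *\<^sub>v c) $ l"] dD by simp
    also have "\<dots> \<le> (10 * \<eta> + D) * norm_sq c" using \<eta> by (intro mult_right_mono) auto
    finally show ?case by simp
  next
    case (Suc k)
    have "\<bar>weighted_norm_sq n d (\<lambda>l. (G *\<^sub>v c) $ l)\<bar> \<le> (5 * \<eta> + (10 * \<eta> + D * (1 / 2) ^ k) / 2) * norm_sq c"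
      by (rule net_improvement[OF GD(1) J w \<eta> _ net Suc.IH Suc.prems]) (use \<eta> D in auto)
    also have "5 * \<eta> + (10 * \<eta> + D * (1 / 2) ^ k) / 2 = 10 * \<eta> + D * (1 / 2) ^ Suc k"
      by (simp add: add_divide_distrib)
    finally show ?case .
  qed
  have "(\<lambda>k. (10 * \<eta> + D * (1 / 2) ^ k) * norm_sq c) \<longlonglongrightarrow> (10 * \<eta> + D * 0) * norm_sq c"
    by (intro tendsto_intros LIMSEQ_power_zero) auto
  then have "\<bar>weighted_norm_sq n d (\<lambda>l. (G *\<^sub>v c) $ l)\<bar> \<le> (10 * \<eta> + D * 0) * norm_sq c"
    by (rule tendsto_lowerbound) (use iter[OF c] in auto)
  then show ?thesis by simp
qed

text \<open>A union bound over the net, whose points are tested at level \<eta> / 10 because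
  \<open>net_bound\<close> loses the factor 10. This turns 48 into 4800.\<close>

lemma haar_uniform_bound:
  fixes \<mu> :: "'a::real_or_complex mat measure"
  assumes haar: "haar_law n \<mu>" and A: "A \<in> unitary_group n" and E: "E \<in> unitary_group n"
    and J: "J \<subseteq> {..<n}" "J \<noteq> {}"
    and dD: "\<And>l. l < n \<Longrightarrow> \<bar>d l\<bar> \<le> D" and D: "D > 0" and d0: "(\<Sum>l<n. d l) = 0" and \<eta>: "\<eta> > 0"
  shows "\<exists>S\<in>sets \<mu>. measure \<mu> S \<le> 2 * exp (517 * card J - \<eta>\<^sup>2 * n / (4800 * D\<^sup>2)) \<and>
    (\<forall>U\<in>space \<mu> - S. \<forall>c. supported n J c \<longrightarrow>
      \<bar>weighted_norm_sq n d (\<lambda>l. (A *\<^sub>v (U *\<^sub>v (E *\<^sub>v c))) $ l)\<bar> \<le> \<eta> * norm_sq c)"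
proof -
  interpret prob_space \<mu> using haar by (simp add: haar_law_def)
  obtain w :: 'a where w: "norm w \<le> 1" "\<And>x :: 'a. x = Re (to_complex x) *\<^sub>R 1 + Im (to_complex x) *\<^sub>R w"
    using ex_imaginary_unit by blast
  have fin: "finite J" using J finite_subset by blast
  have n: "n > 0" using J by (cases n) auto
  note AD = unitary_groupD[OF A] and ED = unitary_groupD[OF E]
  let ?L = "lattice_ball (J \<times> (UNIV :: bool set)) (int (513 * card J))"
  have finL: "finite ?L" using fin by (intro finite_lattice_ball) auto
  define B where "B = (\<lambda>a. {U \<in> space \<mu>. \<bar>weighted_norm_sq n d (\<lambda>l. (A *\<^sub>v (U *\<^sub>v (E *\<^sub>v lattice_vec n J w a))) $ l)\<bar>
      > \<eta> / 10 * norm_sq (lattice_vec n J w a)})"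
  have B: "B a \<in> sets \<mu>" "measure \<mu> (B a) \<le> 2 * exp (- ((\<eta> / 10)\<^sup>2 * n / (48 * D\<^sup>2)))" for a
    unfolding B_def
    using haar_quadratic_tail[OF haar A E dD D d0 n _ lattice_vec_carrier, of "\<eta> / 10" J w a] \<eta> by auto
  define S where "S = (\<Union>a\<in>?L. B a)"
  have S: "S \<in> sets \<mu>" unfolding S_def using finL B by (intro sets.finite_UN) auto
  have "measure \<mu> S \<le> (\<Sum>a\<in>?L. measure \<mu> (B a))"
    unfolding S_def using finL B by (intro measure_UNION_le) auto
  also have "\<dots> \<le> (\<Sum>a\<in>?L. 2 * exp (- ((\<eta> / 10)\<^sup>2 * n / (48 * D\<^sup>2))))"
    by (intro sum_mono B)
  also have "\<dots> = real (card ?L) * (2 * exp (- ((\<eta> / 10)\<^sup>2 * n / (48 * D\<^sup>2))))" by simp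
  also have "\<dots> \<le> exp (517 * card J) * (2 * exp (- ((\<eta> / 10)\<^sup>2 * n / (48 * D\<^sup>2))))"
  proof (rule mult_right_mono)
    have "real (card ?L) \<le> exp (real (513 * card J)) * 3 ^ card (J \<times> (UNIV :: bool set))"
      using fin by (intro card_lattice_ball_le) auto
    \<comment> \<open>3 <= e^2, and there are 2M integer coordinates, so the count is at most e^(513
      M + 4 M).\<close>
    also have "\<dots> \<le> exp (real (513 * card J)) * (exp 2) ^ card (J \<times> (UNIV :: bool set))"
      using exp_ge_add_one_self[of 2] by (intro mult_left_mono power_mono) auto
    also have "\<dots> = exp (517 * card J)"
      by (simp add: card_cartesian_product flip: exp_of_nat_mult exp_add)
    finally show "real (card ?L) \<le> exp (517 * card J)" .
  qed simp
  also have "\<dots> = 2 * exp (517 * card J - \<eta>\<^sup>2 * n / (4800 * D\<^sup>2))"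
    by (simp add: exp_diff exp_minus power_divide field_simps)
  finally have mS: "measure \<mu> S \<le> 2 * exp (517 * card J - \<eta>\<^sup>2 * n / (4800 * D\<^sup>2))" .
  have "\<bar>weighted_norm_sq n d (\<lambda>l. (A *\<^sub>v (U *\<^sub>v (E *\<^sub>v c))) $ l)\<bar> \<le> \<eta> * norm_sq c"
    if U: "U \<in> space \<mu> - S" and c: "supported n J c" for U c
  proof -
    have UU: "U \<in> unitary_group n" using U haar_space[OF haar] by auto
    note UD = unitary_groupD[OF UU]
    define G where "G = A * U * E"
    have G: "G \<in> unitary_group n" unfolding G_def by (intro unitary_group_mult A UU E)
    have Gv: "G *\<^sub>v x = A *\<^sub>v (U *\<^sub>v (E *\<^sub>v x))" if "x \<in> carrier_vec n" for x
      unfolding G_def using AD UD ED that by (simp add: assoc_mult_mat_vec[of _ n n _ n])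
    have "\<bar>weighted_norm_sq n d (\<lambda>l. (G *\<^sub>v c) $ l)\<bar> \<le> 10 * (\<eta> / 10) * norm_sq c"
    proof (rule net_bound[OF G J w _ dD _ _ c])
      fix a assume "a \<in> ?L"
      then have "U \<notin> B a" using U by (auto simp: S_def)
      then show "\<bar>weighted_norm_sq n d (\<lambda>l. (G *\<^sub>v lattice_vec n J w a) $ l)\<bar> \<le> \<eta> / 10 * norm_sq (lattice_vec n J w a)"
        using U by (simp add: B_def Gv not_less)
    qed (use \<eta> D in auto)
    then show ?thesis using Gv[of c] c by (simp add: supported_def)
  qed
  with S mS show ?thesis by blast
qed

section \<open>Location of outliers\<close>

text \<open>The trial space is described by \<open>n - k\<close> rows of a square matrix. Rows are
  numbered from 0 and eigenvalues from 1, so the rows from \<open>k\<close> on are those behind the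
  k-th one.\<close>

lemma eig_ge_rows:
  fixes A :: "'a::real_or_complex mat"
  assumes A: "A \<in> carrier_mat n n" "hermitian A" and k: "1 \<le> k" "k \<le> n"
    and L: "L \<in> carrier_mat n n" and R: "R \<in> carrier_mat n n"
    and hyp: "\<And>b. b \<in> carrier_vec n \<Longrightarrow> b \<noteq> 0\<^sub>v n \<Longrightarrow> (\<And>j. k \<le> j \<Longrightarrow> j < n \<Longrightarrow> (R *\<^sub>v b) $ j = 0) \<Longrightarrow>
      L *\<^sub>v b \<noteq> 0\<^sub>v n \<and> t * norm_sq (L *\<^sub>v b) \<le> quad_form A (L *\<^sub>v b)"
  shows "t \<le> eig k A"
proof -
  define C where "C = mat (n - k) n (\<lambda>(i, j). R $$ (k + i, j))"
  have C: "C \<in> carrier_mat (n - k) n" by (simp add: C_def)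
  have row: "row C i = row R (k + i)" if "i < n - k" for i
    using that R by (intro eq_vecI) (auto simp: C_def)
  show ?thesis
  proof (rule eig_ge[OF A k L C])
    fix b :: "'a vec" assume b: "b \<in> carrier_vec n" "b \<noteq> 0\<^sub>v n" "C *\<^sub>v b = 0\<^sub>v (n - k)"
    have "(R *\<^sub>v b) $ j = 0" if j: "k \<le> j" "j < n" for j
    proof -
      have "(R *\<^sub>v b) $ j = (C *\<^sub>v b) $ (j - k)"
        using row[of "j - k"] j R C by simp
      then show ?thesis using b j by simp
    qed
    then show "L *\<^sub>v b \<noteq> 0\<^sub>v n \<and> t * norm_sq (L *\<^sub>v b) \<le> quad_form A (L *\<^sub>v b)" by (intro hyp b)
  qed (use k in simp)
qed

lemma eig_le_rows:
  fixes A :: "'a::real_or_complex mat"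
  assumes A: "A \<in> carrier_mat n n" "hermitian A" and k: "1 \<le> k" "k \<le> n"
    and L: "L \<in> carrier_mat n n" and R: "R \<in> carrier_mat n n"
    and hyp: "\<And>b. b \<in> carrier_vec n \<Longrightarrow> b \<noteq> 0\<^sub>v n \<Longrightarrow> (\<And>j. j < k - 1 \<Longrightarrow> (R *\<^sub>v b) $ j = 0) \<Longrightarrow>
      L *\<^sub>v b \<noteq> 0\<^sub>v n \<and> quad_form A (L *\<^sub>v b) \<le> t * norm_sq (L *\<^sub>v b)"
  shows "eig k A \<le> t"
proof -
  define C where "C = mat (k - 1) n (\<lambda>(i, j). R $$ (i, j))"
  have C: "C \<in> carrier_mat (k - 1) n" by (simp add: C_def)
  have row: "row C i = row R i" if "i < k - 1" for i
    using that R k by (intro eq_vecI) (auto simp: C_def)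
  show ?thesis
  proof (rule eig_le[OF A k L C])
    fix b :: "'a vec" assume b: "b \<in> carrier_vec n" "b \<noteq> 0\<^sub>v n" "C *\<^sub>v b = 0\<^sub>v (k - 1)"
    have "(R *\<^sub>v b) $ j = 0" if j: "j < k - 1" for j
    proof -
      have "(R *\<^sub>v b) $ j = (C *\<^sub>v b) $ j"
        using row[of j] j R C k by simp
      then show ?thesis using b j by simp
    qed
    then show "L *\<^sub>v b \<noteq> 0\<^sub>v n \<and> quad_form A (L *\<^sub>v b) \<le> t * norm_sq (L *\<^sub>v b)" by (intro hyp b)
  qed (use k in simp)
qed

lemma cscalar_unitary:
  fixes G :: "'a::real_or_complex mat"
  assumes G: "G \<in> unitary_group n" and w: "w \<in> carrier_vec n" and b: "b \<in> carrier_vec n"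
  shows "w \<bullet>c (G *\<^sub>v b) = (mat_adjoint G *\<^sub>v w) \<bullet>c b"
  using cscalar_mult_mat_vec[of "mat_adjoint G" n n w b] unitary_groupD[OF G] w b by simp

lemma cauchy_schwarz_weighted:
  fixes w u :: "'a::real_or_complex vec"
  assumes w: "w \<in> carrier_vec n" and u: "u \<in> carrier_vec n" and \<tau>: "\<And>l. l < n \<Longrightarrow> 0 < \<tau> l"
  shows "(norm (w \<bullet>c u))\<^sup>2 \<le> (\<Sum>l<n. \<tau> l * (norm (w $ l))\<^sup>2) * (\<Sum>l<n. (norm (u $ l))\<^sup>2 / \<tau> l)"
proof -
  let ?f = "\<lambda>l. sqrt (\<tau> l) * norm (w $ l)" and ?g = "\<lambda>l. norm (u $ l) / sqrt (\<tau> l)"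
  have "w \<bullet>c u = (\<Sum>l<n. w $ l * conjugate (u $ l))"
    using w u by (simp add: scalar_prod_def lessThan_atLeast0)
  then have "norm (w \<bullet>c u) \<le> (\<Sum>l<n. norm (w $ l * conjugate (u $ l)))"
    using norm_sum by metis
  also have "\<dots> = (\<Sum>l<n. ?f l * ?g l)"
  proof (rule sum.cong[OF refl])
    fix l assume "l \<in> {..<n}"
    then have "sqrt (\<tau> l) \<noteq> 0" using \<tau>[of l] by simp
    then show "norm (w $ l * conjugate (u $ l)) = ?f l * ?g l" by (simp add: norm_mult)
  qed
  finally have "(norm (w \<bullet>c u))\<^sup>2 \<le> (\<Sum>l<n. ?f l * ?g l)\<^sup>2"
    by (intro power_mono) auto
  also have "\<dots> \<le> (\<Sum>l<n. (?f l)\<^sup>2) * (\<Sum>l<n. (?g l)\<^sup>2)"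
    by (rule Cauchy_Schwarz_ineq_sum)
  also have "(\<Sum>l<n. (?f l)\<^sup>2) = (\<Sum>l<n. \<tau> l * (norm (w $ l))\<^sup>2)"
    using \<tau> by (intro sum.cong) (auto simp: power_mult_distrib less_imp_le)
  also have "(\<Sum>l<n. (?g l)\<^sup>2) = (\<Sum>l<n. (norm (u $ l))\<^sup>2 / \<tau> l)"
    using \<tau> by (intro sum.cong) (auto simp: power_divide less_imp_le)
  finally show ?thesis .
qed

text \<open>The next two lemmas treat outliers on both sides at once: \<open>\<sigma> = 1\<close> when \<open>z\<close> lies to the right
  of the spectrum \<open>h\<close>, \<open>\<sigma> = -1\<close> when it lies to the left, so that \<open>\<sigma> (z - h)\<close> is positive.\<close>

context
  fixes n :: nat and h p :: "nat \<Rightarrow> real" and z \<sigma> T \<eta> :: real and G :: "'a::real_or_complex mat" and J :: "nat set"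
  assumes G: "G \<in> unitary_group n" and z: "z > 0" and \<sigma>: "\<sigma> = 1 \<or> \<sigma> = - 1"
    and gap: "\<And>l. l < n \<Longrightarrow> \<sigma> * (z - h l) > 0"
    and p: "\<And>j. j < n \<Longrightarrow> p j > - 1" and J: "J = {j. j < n \<and> p j \<noteq> 0}"
    and good: "\<And>c. supported n J c \<Longrightarrow>
      \<bar>weighted_norm_sq n (\<lambda>l. h l / (z - h l) - T) (\<lambda>l. (G *\<^sub>v c) $ l)\<bar> \<le> \<eta> * norm_sq c"
begin

text \<open>From z / (z - h) = 1 + h / (z - h) the form of z (z - h)^(-1) is the squared norm plus
  the form of the T-transform weights. The sign only makes the weights positive, since 1 / \<sigma>
  = \<sigma>.\<close>

lemma resolvent_form_bound:
  assumes c: "supported n J c"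
  shows "\<bar>z * (\<Sum>l<n. (norm ((G *\<^sub>v c) $ l))\<^sup>2 / (\<sigma> * (z - h l))) - \<sigma> * (1 + T) * norm_sq c\<bar> \<le> \<eta> * norm_sq c"
proof -
  have cc: "c \<in> carrier_vec n" using c by (simp add: supported_def)
  have n1: "norm_sq c = (\<Sum>l<n. (norm ((G *\<^sub>v c) $ l))\<^sup>2)"
    using norm_sq_isometry[OF G cc] unitary_groupD[OF G] by (simp add: norm_sq_def)
  have "z * (\<Sum>l<n. (norm ((G *\<^sub>v c) $ l))\<^sup>2 / (\<sigma> * (z - h l))) - \<sigma> * (1 + T) * norm_sq c
      = (\<Sum>l<n. \<sigma> * ((h l / (z - h l) - T) * (norm ((G *\<^sub>v c) $ l))\<^sup>2))"
    unfolding n1 sum_distrib_left sum_subtractf[symmetric]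
  proof (rule sum.cong[OF refl])
    fix l assume "l \<in> {..<n}"
    then have "z - h l \<noteq> 0" using gap[of l] by auto
    then have e: "z / (z - h l) = 1 + h l / (z - h l)" by (simp add: field_simps)
    have "z * ((norm ((G *\<^sub>v c) $ l))\<^sup>2 / (\<sigma> * (z - h l))) = \<sigma> * (z / (z - h l)) * (norm ((G *\<^sub>v c) $ l))\<^sup>2"
    proof -
      have "z * (x / (\<sigma> * d)) = \<sigma> * (z / d) * x" for x d :: real
        using \<sigma> by (elim disjE) simp_all
      then show ?thesis .
    qed
    then show "z * ((norm ((G *\<^sub>v c) $ l))\<^sup>2 / (\<sigma> * (z - h l))) - \<sigma> * (1 + T) * (norm ((G *\<^sub>v c) $ l))\<^sup>2
        = \<sigma> * ((h l / (z - h l) - T) * (norm ((G *\<^sub>v c) $ l))\<^sup>2)"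
      unfolding e by (simp add: algebra_simps)
  qed
  also have "\<dots> = \<sigma> * weighted_norm_sq n (\<lambda>l. h l / (z - h l) - T) (\<lambda>l. (G *\<^sub>v c) $ l)"
    by (simp add: weighted_norm_sq_def sum_distrib_left)
  finally show ?thesis using good[OF c] \<sigma> by auto
qed

text \<open>Write X for the weighted norm of \<open>w\<close>, g for the dual weighted norm of G c,
  and C for the squared norm of the spike part \<open>c\<close>. Since <w, G c> = C, Cauchy-Schwarz
  gives C^2 <= X g, and the resolvent bound on z g turns this into z C <= X (\<sigma> (1 + T) +
  \<eta>). Multiplying by \<beta> shows that the spike part cannot exceed X.\<close>

lemma form_nonpos:
  assumes w: "w \<in> carrier_vec n" and \<beta>: "0 \<le> \<beta>" "\<beta> * (\<sigma> * (1 + T) + \<eta>) \<le> 1"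
    and le: "\<And>j. j \<in> J \<Longrightarrow> (mat_adjoint G *\<^sub>v w) $ j \<noteq> 0 \<Longrightarrow> \<sigma> * (p j / (1 + p j)) \<le> \<beta>"
  shows "\<sigma> * ((\<Sum>l<n. (h l - z) * (norm (w $ l))\<^sup>2) + z * (\<Sum>j<n. p j / (1 + p j) * (norm ((mat_adjoint G *\<^sub>v w) $ j))\<^sup>2)) \<le> 0"
proof -
  note GD = unitary_groupD[OF G]
  define c where "c = vec n (\<lambda>j. if j \<in> J then (mat_adjoint G *\<^sub>v w) $ j else 0)"
  have c: "c \<in> carrier_vec n" "supported n J c" by (auto simp: c_def supported_def)
  define u where "u = G *\<^sub>v c"
  have u: "u \<in> carrier_vec n" using GD c by (simp add: u_def)
  let ?X = "\<Sum>l<n. \<sigma> * (z - h l) * (norm (w $ l))\<^sup>2"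
  let ?g = "\<Sum>l<n. (norm (u $ l))\<^sup>2 / (\<sigma> * (z - h l))"
  let ?C = "norm_sq c"
  have X: "0 \<le> ?X"
  proof (rule sum_nonneg)
    fix l assume "l \<in> {..<n}"
    then have "0 \<le> \<sigma> * (z - h l)" using gap[of l] by simp
    then show "0 \<le> \<sigma> * (z - h l) * (norm (w $ l))\<^sup>2" by (rule mult_nonneg_nonneg) simp
  qed
  have sumJ: "(\<Sum>j<n. p j / (1 + p j) * (norm ((mat_adjoint G *\<^sub>v w) $ j))\<^sup>2) = (\<Sum>j<n. p j / (1 + p j) * (norm (c $ j))\<^sup>2)"
    using J by (intro sum.cong) (auto simp: c_def)
  have "w \<bullet>c u = (mat_adjoint G *\<^sub>v w) \<bullet>c c" unfolding u_def by (rule cscalar_unitary[OF G w c(1)])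
  also have "\<dots> = c \<bullet>c c"
    using c by (auto simp: scalar_prod_def c_def intro!: sum.cong)
  finally have wu: "w \<bullet>c u = of_real ?C" by (simp add: cscalar_self)
  have cs: "?C\<^sup>2 \<le> ?X * ?g"
    using cauchy_schwarz_weighted[OF w u gap] wu by simp
  have zg: "z * ?g \<le> (\<sigma> * (1 + T) + \<eta>) * ?C"
    using resolvent_form_bound[OF c(2)] unfolding u_def by (simp add: algebra_simps)
  have "z * (\<Sum>j<n. \<sigma> * (p j / (1 + p j)) * (norm (c $ j))\<^sup>2) \<le> z * (\<Sum>j<n. \<beta> * (norm (c $ j))\<^sup>2)"
  proof (intro mult_left_mono sum_mono)
    fix j assume "j \<in> {..<n}"
    then have "c $ j \<noteq> 0 \<Longrightarrow> j \<in> J \<and> (mat_adjoint G *\<^sub>v w) $ j \<noteq> 0"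
      by (simp add: c_def split: if_splits)
    then show "\<sigma> * (p j / (1 + p j)) * (norm (c $ j))\<^sup>2 \<le> \<beta> * (norm (c $ j))\<^sup>2"
      using mult_right_mono[OF le[of j], of "(norm (c $ j))\<^sup>2"] by (cases "c $ j = 0") auto
  qed (use z in simp)
  also have "\<dots> = \<beta> * (z * ?C)" using c by (simp add: norm_sq_def sum_distrib_left mult_ac)
  also have "\<dots> \<le> ?X"
  proof (cases "?C = 0")
    case False
    then have C: "?C > 0" by (simp add: less_le)
    have "z * ?C\<^sup>2 \<le> z * (?X * ?g)" using cs z by (intro mult_left_mono) auto
    also have "\<dots> = ?X * (z * ?g)" by simp
    also have "\<dots> \<le> ?X * ((\<sigma> * (1 + T) + \<eta>) * ?C)" using zg X by (intro mult_left_mono) auto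
    finally have "(z * ?C) * ?C \<le> (?X * (\<sigma> * (1 + T) + \<eta>)) * ?C" by (simp add: power2_eq_square mult_ac)
    then have "z * ?C \<le> ?X * (\<sigma> * (1 + T) + \<eta>)" using C by (rule mult_right_le_imp_le)
    then have "\<beta> * (z * ?C) \<le> \<beta> * (?X * (\<sigma> * (1 + T) + \<eta>))" using \<beta> by (intro mult_left_mono) auto
    also have "\<dots> = ?X * (\<beta> * (\<sigma> * (1 + T) + \<eta>))" by simp
    also have "\<dots> \<le> ?X * 1" using \<beta> X by (intro mult_left_mono) auto
    finally show ?thesis by simp
  qed (use X in simp)
  finally have fin: "z * (\<Sum>j<n. \<sigma> * (p j / (1 + p j)) * (norm (c $ j))\<^sup>2) \<le> ?X" .
  have e1: "\<sigma> * (\<Sum>l<n. (h l - z) * (norm (w $ l))\<^sup>2) = - ?X"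
    unfolding sum_distrib_left sum_negf[symmetric] by (intro sum.cong) (auto simp: algebra_simps)
  have e2: "\<sigma> * (z * (\<Sum>j<n. p j / (1 + p j) * (norm (c $ j))\<^sup>2)) = z * (\<Sum>j<n. \<sigma> * (p j / (1 + p j)) * (norm (c $ j))\<^sup>2)"
    unfolding sum_distrib_left by (intro sum.cong) (auto simp: mult_ac)
  show ?thesis using fin unfolding sumJ distrib_left e1 e2 by simp
qed

text \<open>The choice of \<open>w\<close> as resolvent of G b is the equality case of the weighted
  Cauchy-Schwarz inequality: X and g of \<open>form_nonpos\<close> then both equal <w, G b>. The
  estimate can therefore be reversed.\<close>

lemma form_nonneg:
  assumes b: "supported n J b" "b \<noteq> 0\<^sub>v n" and \<beta>: "1 \<le> \<beta> * (\<sigma> * (1 + T) - \<eta>)" "\<beta> > 0"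
  defines "w \<equiv> vec n (\<lambda>l. of_real (1 / (\<sigma> * (z - h l))) * (G *\<^sub>v b) $ l)"
  assumes ge: "\<And>j. j \<in> J \<Longrightarrow> (mat_adjoint G *\<^sub>v w) $ j \<noteq> 0 \<Longrightarrow> \<beta> \<le> \<sigma> * (p j / (1 + p j))"
  shows "0 \<le> \<sigma> * ((\<Sum>l<n. (h l - z) * (norm (w $ l))\<^sup>2) + z * (\<Sum>j<n. p j / (1 + p j) * (norm ((mat_adjoint G *\<^sub>v w) $ j))\<^sup>2))"
proof -
  note GD = unitary_groupD[OF G]
  have bc: "b \<in> carrier_vec n" using b by (simp add: supported_def)
  have w: "w \<in> carrier_vec n" by (simp add: w_def)
  define u where "u = G *\<^sub>v b"
  have u: "u \<in> carrier_vec n" using GD bc by (simp add: u_def)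
  define c where "c = vec n (\<lambda>j. if j \<in> J then (mat_adjoint G *\<^sub>v w) $ j else 0)"
  have c: "c \<in> carrier_vec n" by (simp add: c_def)
  let ?X = "\<Sum>l<n. \<sigma> * (z - h l) * (norm (w $ l))\<^sup>2"
  let ?g = "\<Sum>l<n. (norm (u $ l))\<^sup>2 / (\<sigma> * (z - h l))"
  let ?C = "norm_sq c"
  let ?k = "\<sigma> * (1 + T) - \<eta>"
  have "0 < \<beta> * ?k" using \<beta>(1) by linarith
  then have k: "?k > 0" using \<beta>(2) by (rule zero_less_mult_pos)
  have B: "norm_sq b > 0" using b norm_sq_eq_0_iff[OF bc] by (simp add: less_le)
  have wn: "(norm (w $ l))\<^sup>2 = (norm (u $ l))\<^sup>2 / (\<sigma> * (z - h l))\<^sup>2" if "l < n" for l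
  proof -
    have "w $ l = of_real (1 / (\<sigma> * (z - h l))) * u $ l"
      using that by (simp add: w_def u_def)
    then have "(norm (w $ l))\<^sup>2 = (1 / (\<sigma> * (z - h l)))\<^sup>2 * (norm (u $ l))\<^sup>2"
      by (simp only: norm_mult norm_of_real power_mult_distrib power2_abs)
    then show ?thesis by (simp only: power_divide power_one times_divide_eq_left mult_1_left)
  qed
  have Xg: "?X = ?g"
  proof (rule sum.cong[OF refl])
    fix l assume "l \<in> {..<n}"
    then have l: "l < n" by simp
    show "\<sigma> * (z - h l) * (norm (w $ l))\<^sup>2 = (norm (u $ l))\<^sup>2 / (\<sigma> * (z - h l))"
      unfolding wn[OF l] using gap[OF l] by (simp add: power2_eq_square)
  qed
  have zg: "?k * norm_sq b \<le> z * ?g"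
    using resolvent_form_bound[OF b(1)] unfolding u_def by (simp add: algebra_simps)
  moreover have "0 < ?k * norm_sq b" using k B by (rule mult_pos_pos)
  ultimately have "0 < z * ?g" by linarith
  then have gpos: "?g > 0" using z by (rule zero_less_mult_pos)
  have sumJ: "(\<Sum>j<n. p j / (1 + p j) * (norm ((mat_adjoint G *\<^sub>v w) $ j))\<^sup>2) = (\<Sum>j<n. p j / (1 + p j) * (norm (c $ j))\<^sup>2)"
    using J by (intro sum.cong) (auto simp: c_def)
  have "w \<bullet>c u = of_real ?g"
  proof -
    have "w \<bullet>c u = (\<Sum>l<n. of_real (1 / (\<sigma> * (z - h l))) * (u $ l * conjugate (u $ l)))"
      using u unfolding w_def u_def[symmetric] by (simp add: scalar_prod_def lessThan_atLeast0 mult.assoc)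
    also have "\<dots> = (\<Sum>l<n. of_real ((norm (u $ l))\<^sup>2 / (\<sigma> * (z - h l))))"
      unfolding mult_conjugate by (intro sum.cong refl) (simp only: of_real_mult[symmetric] times_divide_eq_left mult_1_left)
    finally show ?thesis by (simp only: of_real_sum)
  qed
  moreover have "w \<bullet>c u = c \<bullet>c b"
  proof -
    have "w \<bullet>c u = (mat_adjoint G *\<^sub>v w) \<bullet>c b" unfolding u_def by (rule cscalar_unitary[OF G w bc])
    also have "\<dots> = c \<bullet>c b"
      using b bc by (auto simp: scalar_prod_def c_def supported_def intro!: sum.cong)
    finally show ?thesis .
  qed
  ultimately have "c \<bullet>c b = of_real ?g" by (simp only:)
  then have "?g\<^sup>2 = (norm (c \<bullet>c b))\<^sup>2" by (simp only: norm_of_real power2_abs)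
  also have "\<dots> \<le> ?C * norm_sq b"
    using cauchy_schwarz_weighted[OF c bc, of "\<lambda>_. 1"] c bc by (simp add: norm_sq_def)
  finally have g2: "?g\<^sup>2 \<le> ?C * norm_sq b" .
  \<comment> \<open>Two facts are combined: g^2 <= C |b|^2, since g = <c, b>, and k |b|^2 <= z g
    from the resolvent bound. Cancelling one g gives k g <= z C.\<close>
  have "(?k * ?g) * ?g = ?k * ?g\<^sup>2" by (simp add: power2_eq_square)
  also have "\<dots> \<le> ?k * (?C * norm_sq b)" using g2 k by (intro mult_left_mono) auto
  also have "\<dots> = ?C * (?k * norm_sq b)" by simp
  also have "\<dots> \<le> ?C * (z * ?g)" using zg by (intro mult_left_mono) auto
  finally have "(?k * ?g) * ?g \<le> (z * ?C) * ?g" by (simp add: mult_ac)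
  then have kg: "?k * ?g \<le> z * ?C" using gpos by (rule mult_right_le_imp_le)
  have "?X \<le> (\<beta> * ?k) * ?g" using mult_right_mono[OF \<beta>(1), of ?g] gpos Xg by simp
  also have "\<dots> \<le> \<beta> * (z * ?C)" using mult_left_mono[OF kg, of \<beta>] \<beta> by (simp add: mult_ac)
  also have "\<dots> = z * (\<Sum>j<n. \<beta> * (norm (c $ j))\<^sup>2)" using c by (simp add: norm_sq_def sum_distrib_left mult_ac)
  also have "\<dots> \<le> z * (\<Sum>j<n. \<sigma> * (p j / (1 + p j)) * (norm (c $ j))\<^sup>2)"
  proof (intro mult_left_mono sum_mono)
    fix j assume "j \<in> {..<n}"
    then have "c $ j \<noteq> 0 \<Longrightarrow> j \<in> J \<and> (mat_adjoint G *\<^sub>v w) $ j \<noteq> 0"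
      by (simp add: c_def split: if_splits)
    then show "\<beta> * (norm (c $ j))\<^sup>2 \<le> \<sigma> * (p j / (1 + p j)) * (norm (c $ j))\<^sup>2"
      using mult_right_mono[OF ge[of j], of "(norm (c $ j))\<^sup>2"] by (cases "c $ j = 0") auto
  qed (use z in simp)
  finally have fin: "?X \<le> z * (\<Sum>j<n. \<sigma> * (p j / (1 + p j)) * (norm (c $ j))\<^sup>2)" .
  have e1: "\<sigma> * (\<Sum>l<n. (h l - z) * (norm (w $ l))\<^sup>2) = - ?X"
    unfolding sum_distrib_left sum_negf[symmetric] by (intro sum.cong) (auto simp: algebra_simps)
  have e2: "\<sigma> * (z * (\<Sum>j<n. p j / (1 + p j) * (norm (c $ j))\<^sup>2)) = z * (\<Sum>j<n. \<sigma> * (p j / (1 + p j)) * (norm (c $ j))\<^sup>2)"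
    unfolding sum_distrib_left by (intro sum.cong) (auto simp: mult_ac)
  show ?thesis using fin unfolding sumJ distrib_left e1 e2 by simp
qed

end

section \<open>The deformed matrix in the eigenbases of \<open>H\<close> and
  \<open>P\<close>\<close>

lemma quad_form_congruence:
  fixes A :: "'a::real_or_complex mat"
  assumes H: "H \<in> carrier_mat n n" and A: "A \<in> carrier_mat n n" and x: "x \<in> carrier_vec n"
  shows "quad_form (mat_adjoint A * H * A) x = quad_form H (A *\<^sub>v x)"
proof -
  have A': "mat_adjoint A \<in> carrier_mat n n" using A by simp
  have "(mat_adjoint A * H * A) *\<^sub>v x = mat_adjoint A *\<^sub>v (H *\<^sub>v (A *\<^sub>v x))"
    using H A A' x by (simp add: assoc_mult_mat_vec[of _ n n _ n])
  then show ?thesis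
    using cscalar_mult_mat_vec[OF A', of "H *\<^sub>v (A *\<^sub>v x)" x] H A x by (simp add: quad_form_def)
qed

lemma one_plus_unitary_diag:
  fixes E :: "'a::real_or_complex mat"
  assumes E: "E \<in> unitary_group n"
  shows "1\<^sub>m n + E * diag_real n p * mat_adjoint E = E * diag_real n (\<lambda>j. 1 + p j) * mat_adjoint E"
proof -
  note ED = unitary_groupD[OF E]
  have D: "(diag_real n p :: 'a mat) \<in> carrier_mat n n" by simp
  have "diag_real n (\<lambda>j. 1 + p j) = 1\<^sub>m n + (diag_real n p :: 'a mat)"
    by (rule eq_matI) auto
  then have "E * diag_real n (\<lambda>j. 1 + p j) * mat_adjoint E = (E * 1\<^sub>m n + E * diag_real n p) * mat_adjoint E"
    using mult_add_distrib_mat[OF ED(1) one_carrier_mat D] by simp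
  also have "\<dots> = E * 1\<^sub>m n * mat_adjoint E + E * diag_real n p * mat_adjoint E"
    using ED D by (intro add_mult_distrib_mat[of _ n n]) auto
  finally show ?thesis using ED by simp
qed

context
  fixes n :: nat and H P U Q E :: "'a::real_or_complex mat" and h p :: "nat \<Rightarrow> real"
  assumes Q: "Q \<in> unitary_group n" and E: "E \<in> unitary_group n" and U: "U \<in> unitary_group n"
    and H: "H = Q * diag_real n h * mat_adjoint Q" and P: "P = E * diag_real n p * mat_adjoint E"
    and p: "\<And>j. j < n \<Longrightarrow> p j > - 1"
begin

lemma W_tilde_eq_congruence:
  "W_tilde H P U = mat_adjoint (U * (E * diag_real n (\<lambda>j. sqrt (1 + p j)) * mat_adjoint E)) * H
     * (U * (E * diag_real n (\<lambda>j. sqrt (1 + p j)) * mat_adjoint E))"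
proof -
  let ?S = "E * diag_real n (\<lambda>j. sqrt (1 + p j)) * mat_adjoint E"
  note UD = unitary_groupD[OF U]
  have S: "?S \<in> carrier_mat n n" using E by simp
  have Hc: "H \<in> carrier_mat n n" using Q H by simp
  have Pn: "dim_row P = n" using unitary_diag_carrier[OF E, of p] P by auto
  have "mat_sqrt (1\<^sub>m (dim_row P) + P) = ?S"
    unfolding Pn unfolding P one_plus_unitary_diag[OF E]
    by (rule mat_sqrt_unitary_diag[OF E]) (use p in \<open>fastforce simp: less_imp_le\<close>)
  then have "W_tilde H P U = ?S * mat_adjoint U * H * U * ?S" by (simp add: W_tilde_def Let_def)
  moreover have "mat_adjoint (U * ?S) = ?S * mat_adjoint U"
    using mat_adjoint_mult[OF UD(1) S] hermitian_unitary_diag[OF E] by (simp add: hermitian_def)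
  moreover have "?S * mat_adjoint U * H * U * ?S = ?S * mat_adjoint U * H * (U * ?S)"
    by (rule assoc_mult_mat[of _ n n _ n _ n]) (use S UD Hc in simp_all)
  ultimately show ?thesis by (simp only:)
qed

lemma W_tilde_carrier: "W_tilde H P U \<in> carrier_mat n n"
  and W_tilde_hermitian: "hermitian (W_tilde H P U)"
proof -
  have Hc: "H \<in> carrier_mat n n" "hermitian H" using Q H by auto
  have A: "U * (E * diag_real n (\<lambda>j. sqrt (1 + p j)) * mat_adjoint E) \<in> carrier_mat n n"
    using E unitary_groupD[OF U] by simp
  show "W_tilde H P U \<in> carrier_mat n n" unfolding W_tilde_eq_congruence using Hc A mat_adjoint_carrier[OF A] by simp
  show "hermitian (W_tilde H P U)" unfolding W_tilde_eq_congruence by (rule hermitian_congruence[OF Hc A])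
qed

lemma W_tilde_form:
  assumes x: "x \<in> carrier_vec n"
  defines "w \<equiv> mat_adjoint Q *\<^sub>v (U *\<^sub>v (E *\<^sub>v (diag_real n (\<lambda>j. sqrt (1 + p j)) *\<^sub>v (mat_adjoint E *\<^sub>v x))))"
  shows "quad_form (W_tilde H P U) x = (\<Sum>l<n. h l * (norm (w $ l))\<^sup>2)"
proof -
  let ?S = "E * diag_real n (\<lambda>j. sqrt (1 + p j)) * mat_adjoint E"
  note UD = unitary_groupD[OF U] and QD = unitary_groupD[OF Q] and ED = unitary_groupD[OF E]
  have S: "?S \<in> carrier_mat n n" using E by simp
  have D: "diag_real n (\<lambda>j. sqrt (1 + p j)) \<in> carrier_mat n n" by simp
  have Hc: "H \<in> carrier_mat n n" using Q H by simp
  have US: "U * ?S \<in> carrier_mat n n" using UD S by simp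
  have y: "(U * ?S) *\<^sub>v x \<in> carrier_vec n" using US x by simp
  have "?S *\<^sub>v x = E *\<^sub>v (diag_real n (\<lambda>j. sqrt (1 + p j)) *\<^sub>v (mat_adjoint E *\<^sub>v x))"
    using ED x D by (simp add: assoc_mult_mat_vec[of _ n n _ n])
  then have "mat_adjoint Q *\<^sub>v ((U * ?S) *\<^sub>v x) = w"
    unfolding w_def using assoc_mult_mat_vec[OF UD(1) S x] by simp
  moreover have "quad_form H ((U * ?S) *\<^sub>v x)
      = (\<Sum>l<n. h l * (norm ((mat_adjoint Q *\<^sub>v ((U * ?S) *\<^sub>v x)) $ l))\<^sup>2)"
    by (subst H) (rule quad_form_unitary_diag[OF Q y])
  ultimately show ?thesis
    unfolding W_tilde_eq_congruence quad_form_congruence[OF Hc US x] by (simp only:)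
qed

text \<open>The Haar matrix read in the eigenbases of \<open>P\<close> and \<open>H\<close>; it
  plays the part of \<open>G\<close> in \<open>form_nonpos\<close> and
  \<open>form_nonneg\<close>.\<close>

definition "mixing = mat_adjoint Q * U * E"

lemma mixing_unitary: "mixing \<in> unitary_group n"
  unfolding mixing_def by (intro unitary_group_mult unitary_group_adjoint Q U E)

lemma mixing_mult_vec:
  assumes "v \<in> carrier_vec n"
  shows "mixing *\<^sub>v v = mat_adjoint Q *\<^sub>v (U *\<^sub>v (E *\<^sub>v v))"
  using assms unitary_groupD[OF Q] unitary_groupD[OF U] unitary_groupD[OF E]
  by (simp add: mixing_def assoc_mult_mat_vec[of _ n n _ n])

text \<open>Let b be the coordinates of \<open>x\<close> in the eigenbasis of \<open>P\<close>, c =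
  sqrt(1 + p) b and w the mixed vector. The H-part is diagonal in \<open>w\<close>, and |w|^2 =
  |c|^2; so z |x|^2 differs from z |w|^2 only through |c_j|^2 - |b_j|^2 = p_j / (1 + p_j) |c_j|^2,
  which is nonzero only at spikes.\<close>

lemma W_tilde_form_identity:
  assumes x: "x \<in> carrier_vec n"
  defines "w \<equiv> mixing *\<^sub>v (diag_real n (\<lambda>j. sqrt (1 + p j)) *\<^sub>v (mat_adjoint E *\<^sub>v x))"
  shows "quad_form (W_tilde H P U) x - z * norm_sq x
    = (\<Sum>l<n. (h l - z) * (norm (w $ l))\<^sup>2) + z * (\<Sum>j<n. p j / (1 + p j) * (norm ((mat_adjoint mixing *\<^sub>v w) $ j))\<^sup>2)"
proof -
  note ED = unitary_groupD[OF E]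
  define b where "b = mat_adjoint E *\<^sub>v x"
  have b: "b \<in> carrier_vec n" using ED x by (simp add: b_def)
  define c where "c = diag_real n (\<lambda>j. sqrt (1 + p j)) *\<^sub>v b"
  have c: "c \<in> carrier_vec n" using b mult_mat_vec_carrier_square[OF diag_real_carrier b] by (simp add: c_def)
  have wc: "w = mixing *\<^sub>v c" by (simp add: w_def c_def b_def)
  have w: "w \<in> carrier_vec n" using unitary_groupD[OF mixing_unitary] c by (simp add: wc)
  have Gw: "mat_adjoint mixing *\<^sub>v w = c"
    unfolding wc by (rule unitary_group_cancel_vec(1)[OF mixing_unitary c])
  have cj: "(norm (c $ j))\<^sup>2 = (1 + p j) * (norm (b $ j))\<^sup>2" if "j < n" for j
  proof -
    have "c $ j = of_real (sqrt (1 + p j)) * b $ j"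
      unfolding c_def diag_real_mult_vec[OF b] using that by simp
    then have "(norm (c $ j))\<^sup>2 = (sqrt (1 + p j))\<^sup>2 * (norm (b $ j))\<^sup>2"
      by (simp only: norm_mult norm_of_real power_mult_distrib power2_abs)
    then show ?thesis using p[OF that] by simp
  qed
  have n1: "(\<Sum>l<n. (norm (w $ l))\<^sup>2) = (\<Sum>j<n. (norm (c $ j))\<^sup>2)"
    using norm_sq_isometry[OF mixing_unitary c] w c unfolding wc[symmetric] by (simp add: norm_sq_def)
  have n2: "norm_sq x = (\<Sum>j<n. (norm (b $ j))\<^sup>2)"
    using norm_sq_unitary_coords[OF E x] by (simp add: b_def)
  have "quad_form (W_tilde H P U) x = (\<Sum>l<n. h l * (norm (w $ l))\<^sup>2)"
    unfolding W_tilde_form[OF x] w_def using c by (simp add: mixing_mult_vec c_def b_def)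
  then have "quad_form (W_tilde H P U) x - z * norm_sq x
      = (\<Sum>l<n. (h l - z) * (norm (w $ l))\<^sup>2) + z * ((\<Sum>l<n. (norm (w $ l))\<^sup>2) - norm_sq x)"
    by (simp add: left_diff_distrib right_diff_distrib sum_subtractf sum_distrib_left)
  also have "(\<Sum>l<n. (norm (w $ l))\<^sup>2) - norm_sq x = (\<Sum>j<n. p j / (1 + p j) * (norm (c $ j))\<^sup>2)"
    unfolding n1 n2 sum_subtractf[symmetric]
  proof (rule sum.cong[OF refl])
    fix j assume "j \<in> {..<n}"
    then have j: "j < n" by simp
    have "1 + p j \<noteq> 0" using p[OF j] by auto
    then show "(norm (c $ j))\<^sup>2 - (norm (b $ j))\<^sup>2 = p j / (1 + p j) * (norm (c $ j))\<^sup>2"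
    proof -
      have "(a / q) * (q * B) = a * B" if "q \<noteq> 0" for a q B :: real using that by simp
      from this[OF \<open>1 + p j \<noteq> 0\<close>] show ?thesis unfolding cj[OF j] by (simp only:) (simp add: algebra_simps)
    qed
  qed
  finally show ?thesis unfolding Gw .
qed

context
  fixes z \<sigma> T \<eta> :: real and J :: "nat set" and k :: nat
  assumes z: "z > 0" and \<sigma>: "\<sigma> = 1 \<or> \<sigma> = - 1" and gap: "\<And>l. l < n \<Longrightarrow> \<sigma> * (z - h l) > 0"
    and J: "J = {j. j < n \<and> p j \<noteq> 0}" and mono: "\<And>i j. i \<le> j \<Longrightarrow> j < n \<Longrightarrow> p j \<le> p i"
    and good: "\<And>c. supported n J c \<Longrightarrow>
      \<bar>weighted_norm_sq n (\<lambda>l. h l / (z - h l) - T) (\<lambda>l. (mat_adjoint Q *\<^sub>v (U *\<^sub>v (E *\<^sub>v c))) $ l)\<bar> \<le> \<eta> * norm_sq c"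
    and k: "1 \<le> k" "k \<le> n" and spike: "\<sigma> * p (k - 1) > 0"
begin

lemma good_mixing:
  "supported n J c \<Longrightarrow> \<bar>weighted_norm_sq n (\<lambda>l. h l / (z - h l) - T) (\<lambda>l. (mixing *\<^sub>v c) $ l)\<bar> \<le> \<eta> * norm_sq c"
  using good[of c] mixing_mult_vec[of c] by (simp add: supported_def)

lemma spike_ratio_mono:
  assumes "i \<le> j" "j < n"
  shows "p j / (1 + p j) \<le> p i / (1 + p i)"
proof -
  have "p j \<le> p i" "1 + p j > 0" "1 + p i > 0" using mono[OF assms] p[of j] p[of i] assms by auto
  then show ?thesis by (simp add: divide_simps algebra_simps)
qed

lemma spike_ratio_pos: "\<sigma> * (p (k - 1) / (1 + p (k - 1))) > 0"
proof -
  have "k - 1 < n" using k by simp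
  then have "1 + p (k - 1) > 0" using p[of "k - 1"] by linarith
  then show ?thesis using spike by (simp add: zero_less_divide_iff)
qed

text \<open>Keeps the k-th eigenvalue from lying beyond \<open>z\<close>, seen from the spectrum of
  \<open>H\<close>. The trial vectors have no component along eigenvectors of \<open>P\<close> whose
  spike is stronger than the k-th, so \<beta> may be the ratio of that spike in
  \<open>form_nonpos\<close>. For \<sigma> = 1 the stronger spikes come first in the list, for
  \<sigma> = -1 last.\<close>

lemma outlier_outer_bound:
  assumes le: "\<sigma> * (p (k - 1) / (1 + p (k - 1))) * (\<sigma> * (1 + T) + \<eta>) \<le> 1"
  shows "\<sigma> = 1 \<Longrightarrow> eig k (W_tilde H P U) \<le> z" and "\<sigma> = - 1 \<Longrightarrow> z \<le> eig k (W_tilde H P U)"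
proof -
  note ED = unitary_groupD[OF E]
  have form: "\<sigma> * (quad_form (W_tilde H P U) x - z * norm_sq x) \<le> 0"
    if x: "x \<in> carrier_vec n"
      and zero: "\<And>j. j < n \<Longrightarrow> \<sigma> * (p j / (1 + p j)) > \<sigma> * (p (k - 1) / (1 + p (k - 1))) \<Longrightarrow> (mat_adjoint E *\<^sub>v x) $ j = 0" for x
    unfolding W_tilde_form_identity[OF x]
  proof (rule form_nonpos[OF mixing_unitary z \<sigma> gap p J good_mixing _ _ le])
    let ?c = "diag_real n (\<lambda>j. sqrt (1 + p j)) *\<^sub>v (mat_adjoint E *\<^sub>v x)"
    have b: "mat_adjoint E *\<^sub>v x \<in> carrier_vec n" using ED x by simp
    have c: "?c \<in> carrier_vec n" by (rule mult_mat_vec_carrier_square[OF diag_real_carrier b])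
    show "mixing *\<^sub>v ?c \<in> carrier_vec n" using unitary_groupD[OF mixing_unitary] c by simp
    show "0 \<le> \<sigma> * (p (k - 1) / (1 + p (k - 1)))" using spike_ratio_pos by simp
    fix j assume j: "j \<in> J" "(mat_adjoint mixing *\<^sub>v (mixing *\<^sub>v ?c)) $ j \<noteq> 0"
    then have jn: "j < n" using J by simp
    have "?c $ j \<noteq> 0" using j unitary_group_cancel_vec(1)[OF mixing_unitary c] by simp
    then have "(mat_adjoint E *\<^sub>v x) $ j \<noteq> 0"
      unfolding diag_real_mult_vec[OF b] using jn by simp
    then show "\<sigma> * (p j / (1 + p j)) \<le> \<sigma> * (p (k - 1) / (1 + p (k - 1)))"
      using zero[OF jn] by force
  qed auto
  show "eig k (W_tilde H P U) \<le> z" if s: "\<sigma> = 1"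
  proof (rule eig_le_rows[OF W_tilde_carrier W_tilde_hermitian k one_carrier_mat ED(4)])
    fix x :: "'a vec" assume x: "x \<in> carrier_vec n" "x \<noteq> 0\<^sub>v n" "\<And>j. j < k - 1 \<Longrightarrow> (mat_adjoint E *\<^sub>v x) $ j = 0"
    have "\<sigma> * (quad_form (W_tilde H P U) x - z * norm_sq x) \<le> 0"
    proof (rule form[OF x(1)])
      fix j assume "j < n" "\<sigma> * (p j / (1 + p j)) > \<sigma> * (p (k - 1) / (1 + p (k - 1)))"
      then have "j < k - 1" using s spike_ratio_mono[of "k - 1" j] by (cases "j < k - 1") auto
      then show "(mat_adjoint E *\<^sub>v x) $ j = 0" by (rule x(3))
    qed
    then show "1\<^sub>m n *\<^sub>v x \<noteq> 0\<^sub>v n \<and> quad_form (W_tilde H P U) (1\<^sub>m n *\<^sub>v x) \<le> z * norm_sq (1\<^sub>m n *\<^sub>v x)"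
      using x s by simp
  qed
  show "z \<le> eig k (W_tilde H P U)" if s: "\<sigma> = - 1"
  proof (rule eig_ge_rows[OF W_tilde_carrier W_tilde_hermitian k one_carrier_mat ED(4)])
    fix x :: "'a vec" assume x: "x \<in> carrier_vec n" "x \<noteq> 0\<^sub>v n"
      "\<And>j. k \<le> j \<Longrightarrow> j < n \<Longrightarrow> (mat_adjoint E *\<^sub>v x) $ j = 0"
    have "\<sigma> * (quad_form (W_tilde H P U) x - z * norm_sq x) \<le> 0"
    proof (rule form[OF x(1)])
      fix j assume j: "j < n" "\<sigma> * (p j / (1 + p j)) > \<sigma> * (p (k - 1) / (1 + p (k - 1)))"
      have "k \<le> j"
      proof (rule ccontr)
        assume "\<not> k \<le> j"
        then have "p (k - 1) / (1 + p (k - 1)) \<le> p j / (1 + p j)" using k by (intro spike_ratio_mono) auto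
        then show False using j s by simp
      qed
      then show "(mat_adjoint E *\<^sub>v x) $ j = 0" using j x(3) by blast
    qed
    then show "1\<^sub>m n *\<^sub>v x \<noteq> 0\<^sub>v n \<and> z * norm_sq (1\<^sub>m n *\<^sub>v x) \<le> quad_form (W_tilde H P U) (1\<^sub>m n *\<^sub>v x)"
      using x s by simp
  qed
qed

text \<open>Shows that the k-th eigenvalue has moved at least as far as \<open>z\<close>. The trial
  vectors must be those of \<open>form_nonneg\<close>, parametrised by \<open>b\<close>; two kinds
  of linear conditions on \<open>b\<close> are needed, and they fit into one row per
  coordinate.\<close>

lemma outlier_inner_bound:
  assumes ge: "1 \<le> \<sigma> * (p (k - 1) / (1 + p (k - 1))) * (\<sigma> * (1 + T) - \<eta>)"
  shows "\<sigma> = 1 \<Longrightarrow> z \<le> eig k (W_tilde H P U)" and "\<sigma> = - 1 \<Longrightarrow> eig k (W_tilde H P U) \<le> z"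
proof -
  note ED = unitary_groupD[OF E] and GD = unitary_groupD[OF mixing_unitary]
  define \<tau> where "\<tau> = (\<lambda>l. 1 / (\<sigma> * (z - h l)))"
  define Di where "Di = (diag_real n (\<lambda>j. 1 / sqrt (1 + p j)) :: 'a mat)"
  \<comment> \<open>\<open>L\<close> is chosen so that the vector \<open>w\<close> belonging to L b
    in the form identity is the resolvent applied to the mixed \<open>b\<close>; then Z b is that
    \<open>w\<close> carried back to the eigenbasis of \<open>P\<close>.\<close>
  define Z where "Z = mat_adjoint mixing * (diag_real n \<tau> * mixing)"
  define L where "L = E * (Di * Z)"
  \<comment> \<open>A coordinate without a spike gives the condition b_j = 0, which yields the
    support; a coordinate with a spike gives (Z b)_j = 0, which removes that spike from the form.
    Each coordinate needs one of them only, so the count matches Courant-Fischer.\<close>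
  define R where "R = mat n n (\<lambda>(j, l). if p j = 0 then (if j = l then 1 else 0) else Z $$ (j, l))"
  have DT: "(diag_real n \<tau> :: 'a mat) \<in> carrier_mat n n" by simp
  have Di: "Di \<in> carrier_mat n n" by (simp add: Di_def)
  have Z: "Z \<in> carrier_mat n n" using GD DT by (simp add: Z_def)
  have L: "L \<in> carrier_mat n n" using ED Di Z by (simp add: L_def)
  have R: "R \<in> carrier_mat n n" by (simp add: R_def)
  have Rz: "(R *\<^sub>v b) $ j = (if p j = 0 then b $ j else (Z *\<^sub>v b) $ j)" if "b \<in> carrier_vec n" "j < n" for b j
  proof -
    have "(R *\<^sub>v b) $ j = (\<Sum>l<n. R $$ (j, l) * b $ l)"
      using that R by (simp add: scalar_prod_def lessThan_atLeast0)
    also have "\<dots> = (if p j = 0 then b $ j else (Z *\<^sub>v b) $ j)"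
    proof (cases "p j = 0")
      case True
      then have "(\<Sum>l<n. R $$ (j, l) * b $ l) = (\<Sum>l<n. if j = l then b $ l else 0)"
        using that by (intro sum.cong) (auto simp: R_def)
      then show ?thesis using True that by simp
    next
      case False
      then show ?thesis using that Z by (simp add: R_def scalar_prod_def lessThan_atLeast0)
    qed
    finally show ?thesis .
  qed
  have main: "L *\<^sub>v b \<noteq> 0\<^sub>v n \<and> 0 \<le> \<sigma> * (quad_form (W_tilde H P U) (L *\<^sub>v b) - z * norm_sq (L *\<^sub>v b))"
    if b: "b \<in> carrier_vec n" "b \<noteq> 0\<^sub>v n"
      and zero: "\<And>j. j < n \<Longrightarrow> \<sigma> * (p j / (1 + p j)) < \<sigma> * (p (k - 1) / (1 + p (k - 1))) \<Longrightarrow> (R *\<^sub>v b) $ j = 0" for b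
  proof -
    define w where "w = vec n (\<lambda>l. of_real (1 / (\<sigma> * (z - h l))) * (mixing *\<^sub>v b) $ l)"
    have w: "w \<in> carrier_vec n" by (simp add: w_def)
    have Gb: "mixing *\<^sub>v b \<in> carrier_vec n" using GD b by simp
    have w': "diag_real n \<tau> *\<^sub>v (mixing *\<^sub>v b) = w"
      unfolding diag_real_mult_vec[OF Gb] by (simp add: w_def \<tau>_def)
    have Zb: "Z *\<^sub>v b = mat_adjoint mixing *\<^sub>v w"
      unfolding Z_def w'[symmetric] using GD DT b Gb by (simp add: assoc_mult_mat_vec[of _ n n _ n])
    have Zc: "Z *\<^sub>v b \<in> carrier_vec n" using Z b by simp
    have Lb: "L *\<^sub>v b = E *\<^sub>v (Di *\<^sub>v (Z *\<^sub>v b))"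
      unfolding L_def using ED Di Z b by (simp add: assoc_mult_mat_vec[of _ n n _ n])
    have EL: "mat_adjoint E *\<^sub>v (L *\<^sub>v b) = Di *\<^sub>v (Z *\<^sub>v b)"
      unfolding Lb by (rule unitary_group_cancel_vec(1)[OF E]) (use Di Zc in simp)
    have DEL: "diag_real n (\<lambda>j. sqrt (1 + p j)) *\<^sub>v (mat_adjoint E *\<^sub>v (L *\<^sub>v b)) = Z *\<^sub>v b"
    proof (rule eq_vecI)
      fix j assume "j < dim_vec (Z *\<^sub>v b)"
      then have j: "j < n" using Z by simp
      have DZ: "Di *\<^sub>v (Z *\<^sub>v b) \<in> carrier_vec n" using Di Zc by simp
      have "sqrt (1 + p j) * (1 / sqrt (1 + p j)) = 1" using p[OF j] by simp
      then have "of_real (sqrt (1 + p j)) * of_real (1 / sqrt (1 + p j)) = (1 :: 'a)"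
        by (metis of_real_1 of_real_mult)
      then show "(diag_real n (\<lambda>j. sqrt (1 + p j)) *\<^sub>v (mat_adjoint E *\<^sub>v (L *\<^sub>v b))) $ j = (Z *\<^sub>v b) $ j"
        unfolding EL diag_real_mult_vec[OF DZ] using j unfolding Di_def diag_real_mult_vec[OF Zc]
        by (simp add: mult.assoc[symmetric] del: of_real_divide)
    qed (use Z in simp)
    have GDEL: "mixing *\<^sub>v (diag_real n (\<lambda>j. sqrt (1 + p j)) *\<^sub>v (mat_adjoint E *\<^sub>v (L *\<^sub>v b))) = w"
      unfolding DEL Zb by (rule unitary_group_cancel_vec(2)[OF mixing_unitary w])
    have supp: "supported n J b"
      unfolding supported_def
    proof (intro conjI b(1) allI impI)
      fix j assume j: "j < n" "j \<notin> J"
      then have pj: "p j = 0" using J by simp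
      \<comment> \<open>A coordinate without a spike has ratio 0, strictly weaker than the k-th one,
        so it is among the rows imposed.\<close>
      then have "(R *\<^sub>v b) $ j = 0" using spike_ratio_pos by (intro zero[OF j(1)]) simp
      then show "b $ j = 0" using Rz[OF b(1) j(1)] pj by simp
    qed
    have nz: "L *\<^sub>v b \<noteq> 0\<^sub>v n"
    proof
      assume "L *\<^sub>v b = 0\<^sub>v n"
      then have "w = 0\<^sub>v n"
        using GDEL mult_mat_zero_vec[OF ED(4)] mult_mat_zero_vec[OF diag_real_carrier] mult_mat_zero_vec[OF GD(1)] by metis
      then have "(mixing *\<^sub>v b) $ l = 0" if "l < n" for l
        using that gap[OF that] by (auto simp: w_def dest!: arg_cong[of _ _ "\<lambda>v. v $ l"])
      then have "mixing *\<^sub>v b = 0\<^sub>v n" using GD(1) by (intro eq_vecI) auto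
      then show False
        using unitary_group_cancel_vec(1)[OF mixing_unitary b(1)] mult_mat_zero_vec[OF GD(4)] b(2) by simp
    qed
    have "0 \<le> \<sigma> * ((\<Sum>l<n. (h l - z) * (norm (w $ l))\<^sup>2)
        + z * (\<Sum>j<n. p j / (1 + p j) * (norm ((mat_adjoint mixing *\<^sub>v w) $ j))\<^sup>2))"
      unfolding w_def
    proof (rule form_nonneg[OF mixing_unitary z \<sigma> gap p J good_mixing supp b(2) ge spike_ratio_pos], unfold w_def[symmetric])
      fix j assume j: "j \<in> J" "(mat_adjoint mixing *\<^sub>v w) $ j \<noteq> 0"
      then have jn: "j < n" and pj: "p j \<noteq> 0" using J by auto
      then have "(R *\<^sub>v b) $ j \<noteq> 0" using Rz[OF b(1) jn] j Zb by simp
      then show "\<sigma> * (p (k - 1) / (1 + p (k - 1))) \<le> \<sigma> * (p j / (1 + p j))"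
        using zero[OF jn] by force
    qed
    moreover have "L *\<^sub>v b \<in> carrier_vec n" using L b by simp
    ultimately show ?thesis
      using W_tilde_form_identity[of "L *\<^sub>v b" z] nz unfolding GDEL by simp
  qed
  show "z \<le> eig k (W_tilde H P U)" if s: "\<sigma> = 1"
  proof (rule eig_ge_rows[OF W_tilde_carrier W_tilde_hermitian k L R])
    fix b :: "'a vec" assume b: "b \<in> carrier_vec n" "b \<noteq> 0\<^sub>v n"
      "\<And>j. k \<le> j \<Longrightarrow> j < n \<Longrightarrow> (R *\<^sub>v b) $ j = 0"
    have "L *\<^sub>v b \<noteq> 0\<^sub>v n \<and> 0 \<le> \<sigma> * (quad_form (W_tilde H P U) (L *\<^sub>v b) - z * norm_sq (L *\<^sub>v b))"
    proof (rule main[OF b(1,2)])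
      fix j assume j: "j < n" "\<sigma> * (p j / (1 + p j)) < \<sigma> * (p (k - 1) / (1 + p (k - 1)))"
      have "k \<le> j"
      proof (rule ccontr)
        assume "\<not> k \<le> j"
        then have "p (k - 1) / (1 + p (k - 1)) \<le> p j / (1 + p j)" using k by (intro spike_ratio_mono) auto
        then show False using j s by simp
      qed
      then show "(R *\<^sub>v b) $ j = 0" using j b(3) by blast
    qed
    then show "L *\<^sub>v b \<noteq> 0\<^sub>v n \<and> z * norm_sq (L *\<^sub>v b) \<le> quad_form (W_tilde H P U) (L *\<^sub>v b)"
      using s by simp
  qed
  show "eig k (W_tilde H P U) \<le> z" if s: "\<sigma> = - 1"
  proof (rule eig_le_rows[OF W_tilde_carrier W_tilde_hermitian k L R])
    fix b :: "'a vec" assume b: "b \<in> carrier_vec n" "b \<noteq> 0\<^sub>v n" "\<And>j. j < k - 1 \<Longrightarrow> (R *\<^sub>v b) $ j = 0"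
    have "L *\<^sub>v b \<noteq> 0\<^sub>v n \<and> 0 \<le> \<sigma> * (quad_form (W_tilde H P U) (L *\<^sub>v b) - z * norm_sq (L *\<^sub>v b))"
    proof (rule main[OF b(1,2)])
      fix j assume j: "j < n" "\<sigma> * (p j / (1 + p j)) < \<sigma> * (p (k - 1) / (1 + p (k - 1)))"
      have "j < k - 1"
      proof (rule ccontr)
        assume "\<not> j < k - 1"
        then have "p j / (1 + p j) \<le> p (k - 1) / (1 + p (k - 1))" using j by (intro spike_ratio_mono) auto
        then show False using j s by simp
      qed
      then show "(R *\<^sub>v b) $ j = 0" by (rule b(3))
    qed
    then show "L *\<^sub>v b \<noteq> 0\<^sub>v n \<and> quad_form (W_tilde H P U) (L *\<^sub>v b) \<le> z * norm_sq (L *\<^sub>v b)"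
      using s by simp
  qed
qed

end

end

section \<open>Rank and indexing of the spikes\<close>

lemma unitary_diag_entry:
  fixes E :: "'a::real_or_complex mat"
  assumes E: "E \<in> unitary_group n" and ij: "i < n" "j < n"
  shows "(E * diag_real n q * mat_adjoint E) $$ (i, j)
    = (\<Sum>k<n. E $$ (i, k) * of_real (q k) * conjugate (E $$ (j, k)))"
proof -
  note ED = unitary_groupD[OF E]
  show ?thesis
    unfolding diag_real_mult_right[OF ED(1)]
    using ij ED by (simp add: scalar_prod_def lessThan_atLeast0)
qed

lemma unitary_diag_add:
  fixes E :: "'a::real_or_complex mat"
  assumes E: "E \<in> unitary_group n"
  shows "E * diag_real n p * mat_adjoint E + E * diag_real n q * mat_adjoint E
    = E * diag_real n (\<lambda>j. p j + q j) * mat_adjoint E"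
proof (rule eq_matI)
  have c: "E * diag_real n q * mat_adjoint E \<in> carrier_mat n n" for q using E by simp
  fix i j assume "i < dim_row (E * diag_real n (\<lambda>j. p j + q j) * mat_adjoint E)"
    "j < dim_col (E * diag_real n (\<lambda>j. p j + q j) * mat_adjoint E)"
  then have ij: "i < n" "j < n" using c[of "\<lambda>j. p j + q j"] by auto
  have "(E * diag_real n p * mat_adjoint E + E * diag_real n q * mat_adjoint E) $$ (i, j)
      = (E * diag_real n p * mat_adjoint E) $$ (i, j) + (E * diag_real n q * mat_adjoint E) $$ (i, j)"
    by (rule index_add_mat(1)) (use c[of q] ij in auto)
  then show "(E * diag_real n p * mat_adjoint E + E * diag_real n q * mat_adjoint E) $$ (i, j)
      = (E * diag_real n (\<lambda>j. p j + q j) * mat_adjoint E) $$ (i, j)"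
    unfolding unitary_diag_entry[OF E ij] by (simp add: sum.distrib distrib_left distrib_right)
qed (use E unitary_groupD[OF E] in auto)

text \<open>Each index of \<open>A\<close> contributes a rank-one matrix, a column of
  \<open>E\<close> times its adjoint, and the rank is subadditive.\<close>

lemma rank_unitary_diag_le:
  fixes E :: "'a::real_or_complex mat"
  assumes E: "E \<in> unitary_group n" and A: "A \<subseteq> {..<n}"
  shows "vec_space.rank n (E * diag_real n (\<lambda>j. if j \<in> A then q j else 0) * mat_adjoint E) \<le> card A"
proof -
  interpret vec_space "TYPE('a)" n .
  have "finite A" using A finite_subset by blast
  then show ?thesis using A
  proof (induction A rule: finite_induct)
    case empty
    have "E * diag_real n (\<lambda>j. if j \<in> {} then q j else 0) * mat_adjoint E = 0\<^sub>m n n"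
    proof (rule eq_matI)
      fix i j assume "i < dim_row (0\<^sub>m n n :: 'a mat)" "j < dim_col (0\<^sub>m n n :: 'a mat)"
      then show "(E * diag_real n (\<lambda>j. if j \<in> {} then q j else 0) * mat_adjoint E) $$ (i, j) = 0\<^sub>m n n $$ (i, j)"
        using unitary_diag_entry[OF E, of i j] by simp
    qed (use unitary_groupD[OF E] in auto)
    then show ?case using rank_0I by simp
  next
    case (insert a A)
    let ?M = "\<lambda>q. E * diag_real n q * mat_adjoint E"
    have c: "?M q \<in> carrier_mat n n" for q using E by simp
    have "?M (\<lambda>j. if j \<in> insert a A then q j else 0) = ?M (\<lambda>j. if j \<in> A then q j else 0) + ?M (\<lambda>j. if j = a then q a else 0)"
      unfolding unitary_diag_add[OF E]
      by (rule arg_cong[of _ _ ?M]) (use insert in auto)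
    then have "rank (?M (\<lambda>j. if j \<in> insert a A then q j else 0))
        \<le> rank (?M (\<lambda>j. if j \<in> A then q j else 0)) + rank (?M (\<lambda>j. if j = a then q a else 0))"
      using rank_subadditive[OF c c] by simp
    moreover have "rank (?M (\<lambda>j. if j = a then q a else 0)) \<le> 1"
    proof (rule rank_le_1_product_entries[OF c])
      fix i j assume "i < dim_row (?M (\<lambda>j. if j = a then q a else 0))" "j < dim_col (?M (\<lambda>j. if j = a then q a else 0))"
      then have ij: "i < n" "j < n" using c[of "\<lambda>j. if j = a then q a else 0"] by auto
      have "?M (\<lambda>j. if j = a then q a else 0) $$ (i, j)
          = (\<Sum>k<n. if k = a then E $$ (i, a) * of_real (q a) * conjugate (E $$ (j, a)) else 0)"
        unfolding unitary_diag_entry[OF E ij] by (intro sum.cong) auto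
      then show "?M (\<lambda>j. if j = a then q a else 0) $$ (i, j) = (E $$ (i, a) * of_real (q a)) * conjugate (E $$ (j, a))"
        using insert.prems by simp
    qed
    ultimately show ?case using insert by simp
  qed
qed

text \<open>For the lower bound, adding 1 at the zero positions makes the matrix invertible. Its
  rank \<open>n\<close> is then at most the rank sought plus the number of zero positions.\<close>

lemma rank_unitary_diag:
  fixes E :: "'a::real_or_complex mat"
  assumes E: "E \<in> unitary_group n"
  shows "vec_space.rank n (E * diag_real n p * mat_adjoint E) = card {j. j < n \<and> p j \<noteq> 0}"
proof -
  interpret vec_space "TYPE('a)" n .
  let ?M = "\<lambda>q. E * diag_real n q * mat_adjoint E"
  have c: "?M q \<in> carrier_mat n n" for q using E by simp
  let ?J = "{j. j < n \<and> p j \<noteq> 0}" and ?Z = "{j. j < n \<and> p j = 0}"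
  have ext: "?M q = ?M q'" if "\<And>j. j < n \<Longrightarrow> q j = q' j" for q q'
  proof -
    have "(diag_real n q :: 'a mat) = diag_real n q'" by (rule eq_matI) (use that in auto)
    then show ?thesis by simp
  qed
  have le: "rank (?M p) \<le> card ?J"
    using rank_unitary_diag_le[OF E, of ?J p] ext[of p "\<lambda>j. if j \<in> ?J then p j else 0"] by auto
  let ?p' = "\<lambda>j. p j + (if j \<in> ?Z then 1 else 0)"
  have "?M ?p' * ?M (\<lambda>j. 1 / ?p' j) = 1\<^sub>m n"
  proof -
    have "?M ?p' * ?M (\<lambda>j. 1 / ?p' j) = ?M (\<lambda>_. 1)"
      unfolding unitary_diag_mult[OF E] by (rule ext) auto
    also have "\<dots> = E * 1\<^sub>m n * mat_adjoint E" by (simp only: one_eq_diag_real)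
    also have "\<dots> = 1\<^sub>m n" using unitary_groupD[OF E] by simp
    finally show ?thesis .
  qed
  then have "det (?M ?p') * det (?M (\<lambda>j. 1 / ?p' j)) = 1"
    using det_mult[OF c c, of ?p' "\<lambda>j. 1 / ?p' j"] by simp
  then have "det (?M ?p') \<noteq> 0" by auto
  then have "n = rank (?M ?p')" using det_rank_iff[OF c, of ?p'] by simp
  also have "\<dots> = rank (?M p + ?M (\<lambda>j. if j \<in> ?Z then 1 else 0))"
    unfolding unitary_diag_add[OF E] ..
  also have "\<dots> \<le> rank (?M p) + rank (?M (\<lambda>j. if j \<in> ?Z then 1 else 0))"
    by (rule rank_subadditive[OF c c])
  also have "rank (?M (\<lambda>j. if j \<in> ?Z then 1 else 0)) \<le> card ?Z"
    by (rule rank_unitary_diag_le[OF E]) auto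
  finally have "n \<le> rank (?M p) + card ?Z" by simp
  moreover have "card ?J + card ?Z = n"
  proof -
    have "card ?J + card ?Z = card (?J \<union> ?Z)" by (rule card_Un_disjoint[symmetric]) auto
    also have "?J \<union> ?Z = {..<n}" by auto
    finally show ?thesis by simp
  qed
  ultimately show ?thesis using le by simp
qed

lemma sorted_sign_split:
  fixes xs :: "real list"
  assumes "sorted_wrt (\<ge>) xs"
  shows "xs = filter (\<lambda>x. x > 0) xs @ filter (\<lambda>x. x = 0) xs @ filter (\<lambda>x. x < 0) xs"
    and "filter (\<lambda>x. x \<noteq> 0) xs = filter (\<lambda>x. x > 0) xs @ filter (\<lambda>x. x < 0) xs"
proof -
  have "xs = filter (\<lambda>x. x > 0) xs @ filter (\<lambda>x. x = 0) xs @ filter (\<lambda>x. x < 0) xs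
    \<and> filter (\<lambda>x. x \<noteq> 0) xs = filter (\<lambda>x. x > 0) xs @ filter (\<lambda>x. x < 0) xs"
    using assms
  proof (induction xs)
    case (Cons x xs)
    then have le: "\<forall>y\<in>set xs. y \<le> x" and IH: "xs = filter (\<lambda>x. x > 0) xs @ filter (\<lambda>x. x = 0) xs @ filter (\<lambda>x. x < 0) xs"
      "filter (\<lambda>x. x \<noteq> 0) xs = filter (\<lambda>x. x > 0) xs @ filter (\<lambda>x. x < 0) xs" by auto
    consider "x > 0" | "x = 0" | "x < 0" by linarith
    then show ?case
    proof cases
      case 1
      then show ?thesis using IH by simp
    next
      case 2
      then have "filter (\<lambda>x. x > 0) xs = []" using le by (auto simp: filter_empty_conv)
      then show ?thesis using IH 2 by simp
    next
      case 3
      then have "filter (\<lambda>x. x > 0) xs = []" "filter (\<lambda>x. x = 0) xs = []"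
        using le by (auto simp: filter_empty_conv)
      then show ?thesis using IH 3 by simp
    qed
  qed simp
  then show "xs = filter (\<lambda>x. x > 0) xs @ filter (\<lambda>x. x = 0) xs @ filter (\<lambda>x. x < 0) xs"
    "filter (\<lambda>x. x \<noteq> 0) xs = filter (\<lambda>x. x > 0) xs @ filter (\<lambda>x. x < 0) xs" by auto
qed

text \<open>A decreasing list consists of positive, zero and negative entries in this order.
  Deleting the zeros keeps the positions of positive entries and moves negative ones forward by the
  number of zeros.\<close>

lemma nth_nonzero_sorted:
  fixes xs :: "real list"
  assumes "sorted_wrt (\<ge>) xs" and ys: "ys = filter (\<lambda>x. x \<noteq> 0) xs" and i: "i < length ys"
  shows "ys ! i > 0 \<Longrightarrow> xs ! i = ys ! i"
    and "ys ! i < 0 \<Longrightarrow> xs ! (length xs - length ys + i) = ys ! i"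
proof -
  define a where "a = filter (\<lambda>x. x > 0) xs"
  define o' where "o' = filter (\<lambda>x. x = 0) xs"
  define b where "b = filter (\<lambda>x. x < 0) xs"
  have xs: "xs = a @ o' @ b" and ysab: "ys = a @ b"
    using sorted_sign_split[OF assms(1)] ys by (simp_all add: a_def o'_def b_def)
  have a: "\<forall>x\<in>set a. x > 0" and b: "\<forall>x\<in>set b. x < 0" by (auto simp: a_def b_def)
  show "xs ! i = ys ! i" if "ys ! i > 0"
  proof (cases "i < length a")
    case True
    then show ?thesis by (subst xs) (simp add: ysab nth_append)
  next
    case False
    then have "ys ! i \<in> set b" using i by (simp add: ysab nth_append)
    then show ?thesis using that b by fastforce
  qed
  show "xs ! (length xs - length ys + i) = ys ! i" if "ys ! i < 0"
  proof (cases "i < length a")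
    case True
    then have "ys ! i \<in> set a" by (simp add: ysab nth_append)
    then show ?thesis using that a by fastforce
  next
    case False
    have "length xs - length ys = length o'" unfolding xs ysab by simp
    then have "xs ! (length xs - length ys + i) = (a @ o' @ b) ! (length o' + i)" unfolding xs[symmetric] by simp
    also have "\<dots> = (o' @ b) ! (length o' + (i - length a))" using False by (simp add: nth_append)
    also have "\<dots> = ys ! i" using False unfolding nth_append_length_plus by (simp add: ysab nth_append)
    finally show ?thesis .
  qed
qed

text \<open>One index \<open>k\<close> serves both purposes: it locates the spike among all
  eigenvalues of \<open>P\<close> and the outlier among those of \<open>W\<close>. It is
  \<open>i\<close> for a positive spike and \<open>n - M + i\<close> for a negative one, because the
  rank \<open>M\<close> counts the nonzero eigenvalues.\<close>

lemma outlier_eig_index: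
  fixes P :: "'a::real_or_complex mat"
  assumes P: "P \<in> carrier_mat n n" "hermitian P" and M: "vec_space.rank n P = M" and i: "1 \<le> i" "i \<le> M"
  obtains k where "1 \<le> k" "k \<le> n" "eig k P = nonzero_eig i P" "nonzero_eig i P \<noteq> 0"
    "\<And>W :: 'a mat. W \<in> carrier_mat n n \<Longrightarrow> outlier_eig M i P W = eig k W"
proof -
  obtain E where E: "E \<in> unitary_group n" and PE: "P = E * diag_real n (\<lambda>j. eig (Suc j) P) * mat_adjoint E"
    using hermitian_spectral[OF P] .
  have len: "length (eigs P) = n" by (rule length_eigs[OF P])
  have sorted: "sorted_wrt (\<ge>) (eigs P)"
    unfolding sorted_wrt_iff_nth_less using eig_antimono[OF P] len by (auto simp: eig_def)
  define ys where "ys = filter (\<lambda>x. x \<noteq> 0) (eigs P)"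
  have "length ys = card {j. j < n \<and> eigs P ! j \<noteq> 0}"
    unfolding ys_def by (simp add: length_filter_conv_card len)
  also have "\<dots> = M" using rank_unitary_diag[OF E, of "\<lambda>j. eig (Suc j) P"] PE M by (simp add: eig_def)
  finally have ys: "length ys = M" .
  have Mn: "M \<le> n" using length_filter_le[of "\<lambda>x. x \<noteq> 0" "eigs P"] ys len by (simp add: ys_def)
  have th: "nonzero_eig i P = ys ! (i - 1)" by (simp add: nonzero_eig_def ys_def)
  have i': "i - 1 < length ys" using i ys by simp
  then have "ys ! (i - 1) \<in> set ys" by simp
  then have nz: "ys ! (i - 1) \<noteq> 0" by (simp add: ys_def)
  show ?thesis
  proof (cases "ys ! (i - 1) > 0")
    case True
    show ?thesis
    proof (rule that[of i])
      show "eig i P = nonzero_eig i P"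
        using nth_nonzero_sorted(1)[OF sorted ys_def i' True] by (simp add: eig_def th)
    qed (use i Mn nz th True in \<open>auto simp: outlier_eig_def\<close>)
  next
    case False
    then have neg: "ys ! (i - 1) < 0" using nz by simp
    show ?thesis
    proof (rule that[of "n - M + i"])
      have "n - M + i - 1 = length (eigs P) - length ys + (i - 1)" using len ys i by simp
      then show "eig (n - M + i) P = nonzero_eig i P"
        using nth_nonzero_sorted(2)[OF sorted ys_def i' neg] by (simp add: eig_def th)
    qed (use i Mn nz th neg in \<open>auto simp: outlier_eig_def\<close>)
  qed
qed

section \<open>Eigenvalues and the operator norm\<close>

lemma vec_norm2_eq: "vec_norm2 v = sqrt (norm_sq v)"
  by (simp add: vec_norm2_def L2_set_def norm_sq_def)

text \<open>The unit eigenvector for \<open>eig k A\<close> is a competitor in the supremum.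
  Boundedness of the set has to be shown as well, since otherwise \<open>SUP\<close> over the reals
  says nothing; the root of the sum of squared eigenvalues is enough.\<close>

lemma abs_eig_le_op_norm:
  fixes A :: "'a::real_or_complex mat"
  assumes A: "A \<in> carrier_mat n n" "hermitian A" and k: "1 \<le> k" "k \<le> n"
  shows "\<bar>eig k A\<bar> \<le> op_norm A"
proof -
  obtain Q where Q: "Q \<in> unitary_group n" and AQ: "A = Q * diag_real n (\<lambda>i. eig (Suc i) A) * mat_adjoint Q"
    using hermitian_spectral[OF A] .
  note QD = unitary_groupD[OF Q]
  define d where "d = (\<lambda>i. eig (Suc i) A)"
  have D: "(diag_real n d :: 'a mat) \<in> carrier_mat n n" by simp
  have Av: "norm_sq (A *\<^sub>v v) = (\<Sum>i<n. (d i)\<^sup>2 * (norm ((mat_adjoint Q *\<^sub>v v) $ i))\<^sup>2)" if v: "v \<in> carrier_vec n" for v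
  proof -
    have u: "mat_adjoint Q *\<^sub>v v \<in> carrier_vec n" using QD v by simp
    have "A *\<^sub>v v = (Q * diag_real n d * mat_adjoint Q) *\<^sub>v v"
      using AQ unfolding d_def[symmetric] by (rule arg_cong)
    also have "\<dots> = Q *\<^sub>v (diag_real n d *\<^sub>v (mat_adjoint Q *\<^sub>v v))"
      using QD D v u by (simp add: assoc_mult_mat_vec[of _ n n _ n])
    finally have "norm_sq (A *\<^sub>v v) = norm_sq (diag_real n d *\<^sub>v (mat_adjoint Q *\<^sub>v v))"
      using norm_sq_isometry[OF Q mult_mat_vec_carrier[OF D u]] by simp
    also have "\<dots> = (\<Sum>i<n. (d i)\<^sup>2 * (norm ((mat_adjoint Q *\<^sub>v v) $ i))\<^sup>2)"
      unfolding diag_real_mult_vec[OF u] by (simp add: norm_sq_def norm_mult power_mult_distrib)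
    finally show ?thesis .
  qed
  let ?V = "{v \<in> carrier_vec (dim_col A). vec_norm2 v \<le> 1}"
  have bdd: "bdd_above ((\<lambda>v. vec_norm2 (A *\<^sub>v v)) ` ?V)"
  proof (rule bdd_aboveI2)
    fix v :: "'a vec" assume "v \<in> ?V"
    then have v: "v \<in> carrier_vec n" "norm_sq v \<le> 1" using A by (auto simp: vec_norm2_eq)
    have le: "(norm ((mat_adjoint Q *\<^sub>v v) $ i))\<^sup>2 \<le> 1" if "i < n" for i
    proof -
      have "(norm ((mat_adjoint Q *\<^sub>v v) $ i))\<^sup>2 \<le> (\<Sum>i<n. (norm ((mat_adjoint Q *\<^sub>v v) $ i))\<^sup>2)"
        using that by (intro member_le_sum) auto
      then show ?thesis using norm_sq_unitary_coords[OF Q v(1)] v(2) by simp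
    qed
    have "norm_sq (A *\<^sub>v v) \<le> (\<Sum>i<n. (d i)\<^sup>2 * 1)"
      unfolding Av[OF v(1)] by (intro sum_mono mult_left_mono le) auto
    then show "vec_norm2 (A *\<^sub>v v) \<le> sqrt (\<Sum>i<n. (d i)\<^sup>2)" by (simp add: vec_norm2_eq)
  qed
  let ?e = "unit_vec n (k - 1) :: 'a vec"
  define v where "v = Q *\<^sub>v ?e"
  have v: "v \<in> carrier_vec n" using QD by (simp add: v_def)
  have e: "mat_adjoint Q *\<^sub>v v = ?e" unfolding v_def by (rule unitary_group_cancel_vec(1)[OF Q]) simp
  have sq: "(norm (?e $ i))\<^sup>2 = (if i = k - 1 then 1 else 0)" if "i < n" for i
    using that k by (auto simp: unit_vec_def)
  have "norm_sq v = (\<Sum>i<n. (norm (?e $ i))\<^sup>2)"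
    using norm_sq_unitary_coords[OF Q v] unfolding e by simp
  also have "\<dots> = (\<Sum>i<n. if i = k - 1 then 1 else 0)"
    by (rule sum.cong[OF refl], rule sq) simp
  finally have n1: "norm_sq v = 1" using k by simp
  have "norm_sq (A *\<^sub>v v) = (\<Sum>i<n. if i = k - 1 then (d (k - 1))\<^sup>2 else 0)"
    unfolding Av[OF v] e
  proof (rule sum.cong[OF refl])
    fix i assume "i \<in> {..<n}"
    then show "(d i)\<^sup>2 * (norm (?e $ i))\<^sup>2 = (if i = k - 1 then (d (k - 1))\<^sup>2 else 0)"
      using sq[of i] by (cases "i = k - 1") simp_all
  qed
  then have "norm_sq (A *\<^sub>v v) = (eig k A)\<^sup>2" using k by (simp add: d_def)
  then have "\<bar>eig k A\<bar> = vec_norm2 (A *\<^sub>v v)" by (simp add: vec_norm2_eq)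
  also have "\<dots> \<le> op_norm A"
    unfolding op_norm_def by (rule cSUP_upper[OF _ bdd]) (use v n1 A in \<open>auto simp: vec_norm2_eq\<close>)
  finally show ?thesis .
qed

section \<open>The T-transform\<close>

lemma T_transform_eq:
  assumes "H \<in> carrier_mat n n"
  shows "T_transform H z = (\<Sum>l<n. eig (Suc l) H / (z - eig (Suc l) H)) / real n"
proof -
  have "(\<Sum>k = 1..n. eig k H / (z - eig k H)) = (\<Sum>l<n. eig (Suc l) H / (z - eig (Suc l) H))"
    by (rule sum.reindex_bij_witness[of _ Suc "\<lambda>k. k - 1"]) auto
  then show ?thesis using assms by (simp add: T_transform_def)
qed

context
  fixes H :: "'a::real_or_complex mat" and n :: nat
  assumes H: "H \<in> carrier_mat n n" "psd H" "H \<noteq> 0\<^sub>m n n" and n: "n \<ge> 1"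
begin

lemma psd_hermitian: "hermitian H"
  using H by (simp add: psd_def)

lemma psd_eig_nonneg: "l < n \<Longrightarrow> 0 \<le> eig (Suc l) H"
  by (rule eig_nonneg[OF H(1) psd_hermitian]) (auto intro: psd_quad_form_nonneg[OF H(2,1)])

lemma eig_le_top: "l < n \<Longrightarrow> eig (Suc l) H \<le> eig 1 H"
  using eig_antimono[OF H(1) psd_hermitian, of 0 l] by simp

lemma eig_ge_bottom: "l < n \<Longrightarrow> eig n H \<le> eig (Suc l) H"
  using eig_antimono[OF H(1) psd_hermitian, of l "n - 1"] by simp

lemma eig_top_pos: "0 < eig 1 H"
proof (rule ccontr)
  assume neg: "\<not> 0 < eig 1 H"
  obtain Q where Q: "Q \<in> unitary_group n" and HQ: "H = Q * diag_real n (\<lambda>i. eig (Suc i) H) * mat_adjoint Q"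
    using hermitian_spectral[OF H(1) psd_hermitian] .
  have "eig (Suc l) H = 0" if "l < n" for l
    using psd_eig_nonneg[OF that] eig_le_top[OF that] neg by linarith
  then have "(diag_real n (\<lambda>i. eig (Suc i) H) :: 'a mat) = 0\<^sub>m n n"
    by (intro eq_matI) auto
  then have "Q * diag_real n (\<lambda>i. eig (Suc i) H) * mat_adjoint Q = 0\<^sub>m n n"
    using unitary_groupD[OF Q] by simp
  then show False using HQ H(3) by simp
qed

lemma T_transform_diff:
  assumes "\<And>l. l < n \<Longrightarrow> x \<noteq> eig (Suc l) H" "\<And>l. l < n \<Longrightarrow> y \<noteq> eig (Suc l) H"
  shows "T_transform H x - T_transform H y
    = (\<Sum>l<n. eig (Suc l) H * (y - x) / ((x - eig (Suc l) H) * (y - eig (Suc l) H))) / real n"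
proof -
  have "eig (Suc l) H / (x - eig (Suc l) H) - eig (Suc l) H / (y - eig (Suc l) H)
      = eig (Suc l) H * (y - x) / ((x - eig (Suc l) H) * (y - eig (Suc l) H))" if "l < n" for l
  proof -
    have "x - eig (Suc l) H \<noteq> 0" "y - eig (Suc l) H \<noteq> 0" using assms that by auto
    then show ?thesis by (simp add: divide_simps) (simp add: algebra_simps)
  qed
  then show ?thesis
    unfolding T_transform_eq[OF H(1)] diff_divide_distrib[symmetric] sum_subtractf[symmetric]
    by (intro arg_cong2[of _ _ _ _ "(/)"] sum.cong) auto
qed

text \<open>In the difference every term is nonnegative, as both factors of the denominator have the
  same sign; the term of the largest eigenvalue is positive since \<open>H\<close> is
  nonzero.\<close>

lemma T_transform_strict_antimono:
  assumes "x < y" "eig 1 H < x \<or> y < eig n H"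
  shows "T_transform H y < T_transform H x"
proof -
  have ne: "x \<noteq> eig (Suc l) H" "y \<noteq> eig (Suc l) H" "(x - eig (Suc l) H) * (y - eig (Suc l) H) > 0" if "l < n" for l
    using eig_le_top[OF that] eig_ge_bottom[OF that] assms by (auto intro: mult_pos_pos mult_neg_neg)
  have "0 < (\<Sum>l<n. eig (Suc l) H * (y - x) / ((x - eig (Suc l) H) * (y - eig (Suc l) H)))"
  proof (rule sum_pos2[of _ 0])
    have "0 < eig (Suc 0) H * (y - x)" using eig_top_pos assms by simp
    moreover have "0 < (x - eig (Suc 0) H) * (y - eig (Suc 0) H)" using ne(3)[of 0] n by simp
    ultimately show "0 < eig (Suc 0) H * (y - x) / ((x - eig (Suc 0) H) * (y - eig (Suc 0) H))"
      by (rule divide_pos_pos)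
    show "0 \<le> eig (Suc l) H * (y - x) / ((x - eig (Suc l) H) * (y - eig (Suc l) H))" if "l \<in> {..<n}" for l
    proof (rule divide_nonneg_nonneg)
      show "0 \<le> eig (Suc l) H * (y - x)" using psd_eig_nonneg[of l] that assms by simp
      show "0 \<le> (x - eig (Suc l) H) * (y - eig (Suc l) H)" using ne(3)[of l] that by simp
    qed
  qed (use n in auto)
  then have "0 < T_transform H x - T_transform H y"
    using T_transform_diff[of x y] ne n by simp
  then show ?thesis by simp
qed

lemma T_transform_right_pos:
  assumes "eig 1 H < z"
  shows "0 < T_transform H z"
proof -
  have gt: "eig (Suc l) H < z" if "l < n" for l using eig_le_top[OF that] assms by simp
  have "0 < (\<Sum>l<n. eig (Suc l) H / (z - eig (Suc l) H))"
  proof (rule sum_pos2[of _ 0])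
    show "0 < eig (Suc 0) H / (z - eig (Suc 0) H)"
      using gt[of 0] eig_top_pos n by (intro divide_pos_pos) auto
    show "0 \<le> eig (Suc l) H / (z - eig (Suc l) H)" if "l \<in> {..<n}" for l
      using gt[of l] psd_eig_nonneg[of l] that by (intro divide_nonneg_nonneg) auto
  qed (use n in auto)
  then show ?thesis unfolding T_transform_eq[OF H(1)] using n by (intro divide_pos_pos) auto
qed

lemma T_transform_left_nonpos:
  assumes "z < eig n H"
  shows "T_transform H z \<le> 0"
proof -
  have lt: "z < eig (Suc l) H" if "l < n" for l using eig_ge_bottom[OF that] assms by simp
  have "(\<Sum>l<n. eig (Suc l) H / (z - eig (Suc l) H)) \<le> 0"
    using lt psd_eig_nonneg by (intro sum_nonpos divide_nonneg_nonpos) (auto simp: less_imp_le)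
  then show ?thesis unfolding T_transform_eq[OF H(1)] by (intro divide_nonpos_nonneg) auto
qed

text \<open>\<open>T_inv\<close> inverts on the union of both half-lines. Inside each one strict
  monotonicity applies; across them the values differ in sign.\<close>

lemma inj_on_T_transform: "inj_on (T_transform H) ({..<eig n H} \<union> {eig 1 H<..})"
proof (rule linorder_inj_onI)
  fix x y assume xy: "x < y" "x \<in> {..<eig n H} \<union> {eig 1 H<..}" "y \<in> {..<eig n H} \<union> {eig 1 H<..}"
  show "T_transform H x \<noteq> T_transform H y"
  proof (cases "eig 1 H < x \<or> y < eig n H")
    case True
    then show ?thesis using T_transform_strict_antimono[OF xy(1)] by auto
  next
    case False
    then have "x < eig n H" "eig 1 H < y" using xy by auto
    then show ?thesis using T_transform_left_nonpos T_transform_right_pos by fastforce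
  qed
qed auto

text \<open>\<open>the_inv_into\<close> is meaningful only at attained values, so the preimage comes
  first, by the intermediate value theorem on an explicit interval.\<close>

lemma T_inv_right:
  assumes "\<theta> > 0"
  shows "eig 1 H < T_inv H (1 / \<theta>)" "T_transform H (T_inv H (1 / \<theta>)) = 1 / \<theta>"
proof -
  let ?h = "eig 1 H"
  have h: "?h > 0" by (rule eig_top_pos)
  \<comment> \<open>At \<open>x\<close> the term of the largest eigenvalue alone contributes 1 /
    \<theta>; at \<open>y\<close> every term is at most 1 / \<theta>, hence so is the mean.\<close>
  define x where "x = ?h + ?h * \<theta> / n"
  define y where "y = ?h + ?h * \<theta>"
  have n0: "real n > 0" using n by simp
  have x: "?h < x" using h assms n0 by (simp add: x_def)
  have xy: "x \<le> y"
  proof -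
    have "?h * \<theta> / n \<le> ?h * \<theta> / 1" using h assms n by (intro divide_left_mono) auto
    then show ?thesis by (simp add: x_def y_def)
  qed
  have Tx: "1 / \<theta> \<le> T_transform H x"
  proof -
    have gt: "eig (Suc l) H < x" if "l < n" for l using eig_le_top[OF that] x by simp
    have "?h / (x - ?h) \<le> (\<Sum>l<n. eig (Suc l) H / (x - eig (Suc l) H))"
      using member_le_sum[of 0 "{..<n}" "\<lambda>l. eig (Suc l) H / (x - eig (Suc l) H)"] gt psd_eig_nonneg n
      by (simp add: less_imp_le)
    then have "?h / (x - ?h) / n \<le> T_transform H x"
      unfolding T_transform_eq[OF H(1)] by (intro divide_right_mono) auto
    moreover have "?h / (x - ?h) / n = 1 / \<theta>" using h assms n0 by (simp add: x_def)
    ultimately show ?thesis by simp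
  qed
  have Ty: "T_transform H y \<le> 1 / \<theta>"
  proof -
    have yh: "y - ?h = ?h * \<theta>" by (simp add: y_def)
    have pos: "0 < ?h * \<theta>" using h assms by simp
    have "eig (Suc l) H / (y - eig (Suc l) H) \<le> ?h / (y - ?h)" if "l < n" for l
      using eig_le_top[OF that] psd_eig_nonneg[OF that] pos yh by (intro frac_le) auto
    then have "(\<Sum>l<n. eig (Suc l) H / (y - eig (Suc l) H)) \<le> (\<Sum>l<n. ?h / (y - ?h))" by (intro sum_mono) auto
    also have "\<dots> = n * (1 / \<theta>)" unfolding yh using h by simp
    finally show ?thesis unfolding T_transform_eq[OF H(1)] using n0 by (simp add: pos_divide_le_eq mult.commute)
  qed
  have "continuous_on {x..y} (T_transform H)"
    unfolding T_transform_eq[OF H(1), abs_def]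
  proof (intro continuous_intros ballI)
    fix l z assume "l \<in> {..<n}" "z \<in> {x..y}"
    then show "z - eig (Suc l) H \<noteq> 0" using eig_le_top[of l] x by auto
  qed (use n in auto)
  then obtain z where z: "x \<le> z" "z \<le> y" "T_transform H z = 1 / \<theta>"
    using IVT2'[of "T_transform H" y "1 / \<theta>" x] Tx Ty xy by auto
  have dim: "dim_row H = n" using H by simp
  have zin: "z \<in> {..<eig n H} \<union> {eig 1 H<..}" using z x by auto
  have "T_inv H (1 / \<theta>) = z"
    unfolding T_inv_def dim z(3)[symmetric] by (rule the_inv_into_f_f[OF inj_on_T_transform zin])
  then show "eig 1 H < T_inv H (1 / \<theta>)" "T_transform H (T_inv H (1 / \<theta>)) = 1 / \<theta>"
    using z x by auto
qed

lemma T_inv_left: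
  assumes "y \<in> T_transform H ` {..<eig n H}"
  shows "T_inv H y < eig n H" "T_transform H (T_inv H y) = y"
proof -
  obtain z where z: "z < eig n H" "y = T_transform H z" using assms by auto
  have dim: "dim_row H = n" using H by simp
  have "T_inv H y = z"
    unfolding T_inv_def dim z(2) by (rule the_inv_into_f_f[OF inj_on_T_transform]) (use z in auto)
  then show "T_inv H y < eig n H" "T_transform H (T_inv H y) = y" using z by auto
qed

text \<open>A term of the difference is h (y - x) / ((x - h)(y - h)). One factor of the denominator
  is kept to form T at \<open>z\<close>, the other is at most \<open>C\<close>. Allowing
  \<open>z\<close> to be either endpoint covers steps in both directions from a point where T is
  known.\<close>

lemma T_transform_margin_right:
  assumes hB: "eig 1 H \<le> B" and x: "eig 1 H < x" and xy: "x < y" and C: "y \<le> C"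
    and z: "z = x \<or> z = y"
  shows "T_transform H x - T_transform H y \<ge> (y - x) / C * T_transform H z"
proof -
  have C0: "C > 0" using eig_top_pos x xy C by simp
  have gt: "eig (Suc l) H < x" "eig (Suc l) H < y" if "l < n" for l using eig_le_top[OF that] x xy by auto
  have "(y - x) / C * (eig (Suc l) H / (z - eig (Suc l) H))
      \<le> eig (Suc l) H * (y - x) / ((x - eig (Suc l) H) * (y - eig (Suc l) H))" if l: "l < n" for l
  proof -
    let ?h = "eig (Suc l) H"
    have h: "0 \<le> ?h" by (rule psd_eig_nonneg[OF l])
    have le: "?h / (z - ?h) / C \<le> ?h / (z - ?h) / (o' - ?h)" if "o' = x \<or> o' = y" for o'
    proof (rule divide_left_mono)
      show "o' - ?h \<le> C" using that h xy C by auto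
      show "0 \<le> ?h / (z - ?h)" using z gt[OF l] h by (intro divide_nonneg_nonneg) auto
      show "0 < C * (o' - ?h)" using C0 gt[OF l] that by (intro mult_pos_pos) auto
    qed
    have "?h / (z - ?h) / C \<le> ?h / ((x - ?h) * (y - ?h))"
      using z le[of x] le[of y] by (auto simp: mult.commute)
    then have "(y - x) * (?h / (z - ?h) / C) \<le> (y - x) * (?h / ((x - ?h) * (y - ?h)))"
      using xy by (intro mult_left_mono) auto
    then show ?thesis by (simp add: mult_ac)
  qed
  then have "(\<Sum>l<n. (y - x) / C * (eig (Suc l) H / (z - eig (Suc l) H)))
      \<le> (\<Sum>l<n. eig (Suc l) H * (y - x) / ((x - eig (Suc l) H) * (y - eig (Suc l) H)))"
    by (intro sum_mono) auto
  then have "(y - x) / C * (\<Sum>l<n. eig (Suc l) H / (z - eig (Suc l) H)) / n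
      \<le> (\<Sum>l<n. eig (Suc l) H * (y - x) / ((x - eig (Suc l) H) * (y - eig (Suc l) H))) / n"
    unfolding sum_distrib_left by (intro divide_right_mono) auto
  moreover have "T_transform H x - T_transform H y
      = (\<Sum>l<n. eig (Suc l) H * (y - x) / ((x - eig (Suc l) H) * (y - eig (Suc l) H))) / n"
    using gt by (intro T_transform_diff) auto
  ultimately show ?thesis
    by (simp only: T_transform_eq[OF H(1), of z] times_divide_eq_right)
qed

text \<open>As on the right, but now the distances h - x and h - y are at most \<open>B\<close>,
  which is where 0 <= x enters.\<close>

lemma T_transform_margin_left:
  assumes hB: "eig 1 H \<le> B" and x: "0 \<le> x" and xy: "x < y" and y: "y < eig n H" and z: "z = x \<or> z = y"
  shows "T_transform H x - T_transform H y \<ge> (y - x) / B * (- T_transform H z)"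
proof -
  have B0: "B > 0" using eig_top_pos hB by simp
  have gt: "x < eig (Suc l) H" "y < eig (Suc l) H" if "l < n" for l using eig_ge_bottom[OF that] y xy by auto
  have "(y - x) / B * (eig (Suc l) H / (eig (Suc l) H - z))
      \<le> eig (Suc l) H * (y - x) / ((x - eig (Suc l) H) * (y - eig (Suc l) H))" if l: "l < n" for l
  proof -
    let ?h = "eig (Suc l) H"
    have h: "0 \<le> ?h" "?h \<le> B" using psd_eig_nonneg[OF l] eig_le_top[OF l] hB by auto
    have le: "?h / (?h - z) / B \<le> ?h / (?h - z) / (?h - o')" if "o' = x \<or> o' = y" for o'
    proof (rule divide_left_mono)
      show "?h - o' \<le> B" using that h x xy by auto
      show "0 \<le> ?h / (?h - z)" using z gt[OF l] h by (intro divide_nonneg_nonneg) auto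
      show "0 < B * (?h - o')" using B0 gt[OF l] that by (intro mult_pos_pos) auto
    qed
    have "?h / (?h - z) / B \<le> ?h / ((?h - x) * (?h - y))"
      using z le[of x] le[of y] by (auto simp: mult.commute)
    then have "(y - x) * (?h / (?h - z) / B) \<le> (y - x) * (?h / ((?h - x) * (?h - y)))"
      using xy by (intro mult_left_mono) auto
    moreover have "(?h - x) * (?h - y) = (x - ?h) * (y - ?h)" by (simp add: algebra_simps)
    ultimately show ?thesis by (simp add: mult_ac)
  qed
  then have "(\<Sum>l<n. (y - x) / B * (eig (Suc l) H / (eig (Suc l) H - z)))
      \<le> (\<Sum>l<n. eig (Suc l) H * (y - x) / ((x - eig (Suc l) H) * (y - eig (Suc l) H)))"
    by (intro sum_mono) auto
  then have "(y - x) / B * (\<Sum>l<n. eig (Suc l) H / (eig (Suc l) H - z)) / n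
      \<le> (\<Sum>l<n. eig (Suc l) H * (y - x) / ((x - eig (Suc l) H) * (y - eig (Suc l) H))) / n"
    unfolding sum_distrib_left by (intro divide_right_mono) auto
  moreover have "T_transform H x - T_transform H y
      = (\<Sum>l<n. eig (Suc l) H * (y - x) / ((x - eig (Suc l) H) * (y - eig (Suc l) H))) / n"
    using gt by (intro T_transform_diff) auto
  moreover have "- T_transform H z = (\<Sum>l<n. eig (Suc l) H / (eig (Suc l) H - z)) / n"
  proof -
    have "e / (e - z) = - (e / (z - e))" for e :: real
      by (metis minus_diff_eq minus_divide_right)
    then show ?thesis unfolding T_transform_eq[OF H(1)] by (simp add: sum_negf)
  qed
  ultimately show ?thesis by (simp only: times_divide_eq_right)
qed

end

section \<open>Concentration of outliers\<close>

lemma W_tilde_measurable_eig: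
  fixes H P Q E :: "'a::real_or_complex mat" and \<mu> :: "'a mat measure"
  assumes haar: "haar_law n \<mu>" and Q: "Q \<in> unitary_group n" and E: "E \<in> unitary_group n"
    and H: "H = Q * diag_real n h * mat_adjoint Q" and P: "P = E * diag_real n p * mat_adjoint E"
    and p: "\<And>j. j < n \<Longrightarrow> p j > - 1" and k: "1 \<le> k" "k \<le> n"
  shows "(\<lambda>U. eig k (W_tilde H P U)) \<in> borel_measurable \<mu>"
proof -
  have U: "U \<in> unitary_group n" if "U \<in> space \<mu>" for U using that haar_space[OF haar] by simp
  have Uc: "U \<in> carrier_mat n n" if "U \<in> space \<mu>" for U using unitary_groupD(1)[OF U[OF that]] .
  let ?S = "E * diag_real n (\<lambda>j. sqrt (1 + p j)) * mat_adjoint E"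
  have S: "?S \<in> carrier_mat n n" using E by simp
  have Hc: "H \<in> carrier_mat n n" using Q H by simp
  have AU: "U * ?S \<in> carrier_mat n n" if "U \<in> space \<mu>" for U using Uc[OF that] S by simp
  have m1: "(\<lambda>U. (U * ?S) $$ (i, j)) \<in> borel_measurable \<mu>" if "i < n" "j < n" for i j
    by (rule measurable_mult_entry[of _ _ n n _ n]) (use Uc S haar_measurable_entry[OF haar] that in auto)
  have m2: "(\<lambda>U. mat_adjoint (U * ?S) $$ (i, j)) \<in> borel_measurable \<mu>" if "i < n" "j < n" for i j
    by (rule measurable_adjoint_entry[of _ _ n n]) (use AU m1 that in auto)
  have m3: "(\<lambda>U. (mat_adjoint (U * ?S) * H) $$ (i, j)) \<in> borel_measurable \<mu>" if "i < n" "j < n" for i j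
    by (rule measurable_mult_entry[of _ _ n n _ n]) (use mat_adjoint_carrier[OF AU] m2 Hc that in auto)
  have m4: "(\<lambda>U. (mat_adjoint (U * ?S) * H * (U * ?S)) $$ (i, j)) \<in> borel_measurable \<mu>" if "i < n" "j < n" for i j
    by (rule measurable_mult_entry[of _ _ n n _ n])
      (use mult_carrier_mat_square[OF mat_adjoint_carrier[OF AU] Hc] AU m1 m3 that in auto)
  show ?thesis
  proof (rule measurable_eig[OF _ _ _ k])
    fix U assume "U \<in> space \<mu>"
    from U[OF this] show "W_tilde H P U \<in> carrier_mat n n" "hermitian (W_tilde H P U)"
      using W_tilde_carrier[OF Q E _ H P p] W_tilde_hermitian[OF Q E _ H P p] by auto
  next
    fix i j assume ij: "i < n" "j < n"
    have "(\<lambda>U. W_tilde H P U $$ (i, j)) \<in> borel_measurable \<mu>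
        \<longleftrightarrow> (\<lambda>U. (mat_adjoint (U * ?S) * H * (U * ?S)) $$ (i, j)) \<in> borel_measurable \<mu>"
      by (rule measurable_cong) (simp only: W_tilde_eq_congruence[OF Q E U H P p])
    then show "(\<lambda>U. W_tilde H P U $$ (i, j)) \<in> borel_measurable \<mu>" using m4[OF ij] by simp
  qed
qed

text \<open>\<open>m\<close> is the rate at which the T-transform separates \<open>z\<^sub>0 \<plusminus> \<epsilon>\<close> from \<open>z\<^sub>0\<close>.\<close>

theorem outlier_concentration:
  fixes H P :: "'a::real_or_complex mat" and \<mu> :: "'a mat measure" and \<delta> B :: real
  assumes \<delta>: "\<delta> > 0" and B: "B > 0" and n: "n \<ge> 1" and model: "spiked_model B n M H P"
    and haar: "haar_law n \<mu>" and \<epsilon>: "0 < \<epsilon>" "\<epsilon> \<le> \<delta>" and i: "1 \<le> i" "i \<le> M"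
    and sep: "separated \<delta> H (nonzero_eig i P)"
  defines "m \<equiv> 1 / ((1 + B) * (B + B\<^sup>2 + \<delta>))" and "z0 \<equiv> T_inv H (1 / nonzero_eig i P)"
  shows "\<P>(U in \<mu>. z0 - \<epsilon> \<le> outlier_eig M i P (W_tilde H P U) \<and> outlier_eig M i P (W_tilde H P U) \<le> z0 + \<epsilon>)
    \<ge> 1 - 4 * exp (- (m\<^sup>2 / (4800 * (2 * B / \<delta>)\<^sup>2)) * real n * \<epsilon>\<^sup>2 + 517 * real M)"
proof -
  interpret prob_space \<mu> using haar by (simp add: haar_law_def)
  have H: "H \<in> carrier_mat n n" "psd H" "H \<noteq> 0\<^sub>m n n" "op_norm H \<le> B"
    and P: "P \<in> carrier_mat n n" "hermitian P" and rk: "vec_space.rank n P = M"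
    and Pgt: "\<And>k. 1 \<le> k \<Longrightarrow> k \<le> n \<Longrightarrow> eig k P > - 1" and PB: "op_norm P \<le> B"
    using model by (auto simp: spiked_model_def)
  have hH: "hermitian H" using H by (simp add: psd_def)
  obtain Q where Q: "Q \<in> unitary_group n" and HQ: "H = Q * diag_real n (\<lambda>l. eig (Suc l) H) * mat_adjoint Q"
    using hermitian_spectral[OF H(1) hH] .
  obtain E where E: "E \<in> unitary_group n" and PE: "P = E * diag_real n (\<lambda>j. eig (Suc j) P) * mat_adjoint E"
    using hermitian_spectral[OF P] .
  define h where "h = (\<lambda>l. eig (Suc l) H)"
  define p where "p = (\<lambda>j. eig (Suc j) P)"
  note HQ' = HQ[folded h_def] and PE' = PE[folded p_def]
  have p: "p j > - 1" if "j < n" for j using Pgt[of "Suc j"] that by (simp add: p_def)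
  have pmono: "p j \<le> p i" if "i \<le> j" "j < n" for i j using eig_antimono[OF P that] by (simp add: p_def)
  have h: "0 \<le> h l" "h l \<le> eig 1 H" "eig n H \<le> h l" if "l < n" for l
    using psd_eig_nonneg[OF H(1,2,3) n that] eig_le_top[OF H(1,2,3) n that] eig_ge_bottom[OF H(1,2,3) n that]
    by (auto simp: h_def)
  have top: "0 < eig 1 H" "eig 1 H \<le> B"
    using eig_top_pos[OF H(1,2,3) n] abs_eig_le_op_norm[OF H(1) hH, of 1] n H(4) by auto
  have hB: "h l \<le> B" if "l < n" for l using h(2)[OF that] top by simp
  define J where "J = {j. j < n \<and> p j \<noteq> 0}"
  have cardJ: "card J = M" using rank_unitary_diag[OF E, of p] PE' rk by (simp add: J_def)
  have J: "J \<subseteq> {..<n}" by (auto simp: J_def)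
  obtain k where k: "1 \<le> k" "k \<le> n" and pk: "eig k P = nonzero_eig i P" and nz: "nonzero_eig i P \<noteq> 0"
    and out: "\<And>W :: 'a mat. W \<in> carrier_mat n n \<Longrightarrow> outlier_eig M i P W = eig k W"
    using outlier_eig_index[OF P rk i] by metis
  define \<theta> where "\<theta> = nonzero_eig i P"
  have pk': "p (k - 1) = \<theta>" using pk k by (simp add: p_def \<theta>_def)
  have pk'': "p (k - Suc 0) = \<theta>" using pk' by simp
  have \<theta>: "\<theta> \<noteq> 0" "- 1 < \<theta>" "\<theta> \<le> B"
    using nz Pgt[OF k] abs_eig_le_op_norm[OF P k] PB pk by (auto simp: \<theta>_def)
  have "k - 1 \<in> J" using k pk' \<theta> by (simp add: J_def)
  then have J0: "J \<noteq> {}" by auto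
  define \<sigma> :: real where "\<sigma> = (if \<theta> > 0 then 1 else - 1)"
  have \<sigma>: "\<sigma> = 1 \<or> \<sigma> = - 1" by (simp add: \<sigma>_def)
  have spike: "\<sigma> * p (k - 1) > 0" using \<theta> by (simp add: pk'' \<sigma>_def)
  let ?T = "T_transform H"
  \<comment> \<open>Bounds h / (z - h) - T(z): both h / (z - h) and its mean are at most B /
    \<delta> in absolute value.\<close>
  define D where "D = 2 * B / \<delta>"
  have D: "D > 0" using B \<delta> by (simp add: D_def)
  have m: "m > 0" unfolding m_def using B \<delta> by (intro divide_pos_pos mult_pos_pos add_pos_pos) auto
  \<comment> \<open>\<open>m\<close> lies below both rates obtained from the margin lemmas: 1 / B
    for a negative spike and 1 / ((B + B^2 + \<delta>) \<theta>) for a positive one.\<close>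
  have mB: "m * B \<le> 1"
  proof -
    have "1 * B \<le> (1 + B) * (B + B\<^sup>2 + \<delta>)" using B \<delta> by (intro mult_mono) auto
    then show ?thesis using B \<delta> by (simp add: m_def pos_divide_le_eq add_pos_pos)
  qed
  have mC: "m * ((B + B\<^sup>2 + \<delta>) * \<theta>) \<le> 1"
  proof -
    have "(B + B\<^sup>2 + \<delta>) * \<theta> \<le> (B + B\<^sup>2 + \<delta>) * (1 + B)" using \<theta> B \<delta> by (intro mult_left_mono) auto
    then show ?thesis using B \<delta> by (simp add: m_def pos_divide_le_eq add_pos_pos mult.commute)
  qed
  have gap2: "\<sigma> * (z0 - h l) \<ge> 2 * \<delta>" if "l < n" for l
    using sep \<theta>(1) h[OF that] H(1) by (auto simp: separated_def \<sigma>_def z0_def \<theta>_def)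
  have Tz: "?T z = (\<Sum>l<n. h l / (z - h l)) / n" for z
    by (simp add: T_transform_eq[OF H(1)] h_def)
  have T0: "?T z0 = 1 / \<theta>"
    using T_inv_right(2)[OF H(1,2,3) n, of \<theta>] T_inv_left(2)[OF H(1,2,3) n, of "1 / \<theta>"] sep \<theta>(1) H(1)
    by (cases "\<theta> > 0") (auto simp: separated_def z0_def \<theta>_def)
  \<comment> \<open>If z0 <= 0, the spike is negative and every h / (z0 - h) is at least -1, hence
    so is T(z0); but 1 / \<theta> < -1 because \<theta> > -1.\<close>
  have z0pos: "z0 > 0"
  proof (rule ccontr)
    assume neg: "\<not> z0 > 0"
    have "\<theta> < 0"
    proof (rule ccontr)
      assume "\<not> \<theta> < 0"
      then have "\<theta> > 0" using \<theta> by simp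
      then show False using T_inv_right(1)[OF H(1,2,3) n] top neg by (fastforce simp: z0_def \<theta>_def)
    qed
    then have gt: "h l - z0 \<ge> 2 * \<delta>" if "l < n" for l using gap2[OF that] by (simp add: \<sigma>_def)
    have "- 1 \<le> h l / (z0 - h l)" if "l < n" for l
    proof -
      have "z0 - h l < 0" using gt[OF that] \<delta> by simp
      then show ?thesis using h(1)[OF that] neg by (simp add: neg_le_divide_eq)
    qed
    then have "(\<Sum>l<n. - 1) \<le> (\<Sum>l<n. h l / (z0 - h l))" by (intro sum_mono) auto
    then have "- 1 \<le> ?T z0"
      unfolding Tz using n by (simp add: pos_le_divide_eq)
    moreover have "1 / \<theta> < - 1" using \<open>\<theta> < 0\<close> \<theta> by (simp add: neg_divide_less_eq)
    ultimately show False using T0 by simp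
  qed
  \<comment> \<open>T is at most its largest term, so z0 exceeds the top eigenvalue of
    \<open>H\<close> by at most that eigenvalue times \<theta>, which is at most B^2. This bounds
    the distances in the margin lemma.\<close>
  have z0C: "z0 \<le> B + B\<^sup>2" if pos: "\<theta> > 0"
  proof -
    have gt: "2 * \<delta> \<le> z0 - h l" if "l < n" for l using gap2[OF that] pos by (simp add: \<sigma>_def)
    have n0: "0 < n" using n by simp
    have d0: "0 < z0 - eig 1 H" using gt[OF n0] \<delta> by (simp add: h_def)
    have "h l / (z0 - h l) \<le> eig 1 H / (z0 - eig 1 H)" if "l < n" for l
      using h[OF that] d0 by (intro frac_le) auto
    then have "(\<Sum>l<n. h l / (z0 - h l)) \<le> (\<Sum>l<n. eig 1 H / (z0 - eig 1 H))" by (intro sum_mono) auto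
    then have "?T z0 \<le> eig 1 H / (z0 - eig 1 H)"
      unfolding Tz using n by (simp add: pos_divide_le_eq mult.commute)
    then have "1 / \<theta> \<le> eig 1 H / (z0 - eig 1 H)" using T0 by simp
    then have "z0 - eig 1 H \<le> eig 1 H * \<theta>" using d0 pos by (simp add: divide_simps mult.commute)
    also have "\<dots> \<le> B * B" using top \<theta> pos by (intro mult_mono) auto
    finally show ?thesis using top by (simp add: power2_eq_square)
  qed
  have margin_plus: "?T (z0 + \<epsilon>) + m * \<epsilon> \<le> 1 / \<theta>"
  proof (cases "\<theta> > 0")
    case True
    have C: "z0 + \<epsilon> \<le> B + B\<^sup>2 + \<delta>" using z0C[OF True] \<epsilon> by simp
    have x: "eig 1 H < z0" using T_inv_right(1)[OF H(1,2,3) n True] by (simp add: z0_def \<theta>_def)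
    have "\<epsilon> / (B + B\<^sup>2 + \<delta>) * (1 / \<theta>) \<le> 1 / \<theta> - ?T (z0 + \<epsilon>)"
      using T_transform_margin_right[OF H(1,2,3) n top(2) x _ C, of z0] \<epsilon> T0 by simp
    moreover have "m * \<epsilon> \<le> \<epsilon> / (B + B\<^sup>2 + \<delta>) * (1 / \<theta>)"
    proof -
      have "0 < (B + B\<^sup>2 + \<delta>) * \<theta>" using B \<delta> True by (simp add: add_pos_pos)
      then have "m \<le> 1 / ((B + B\<^sup>2 + \<delta>) * \<theta>)" using mC by (simp add: pos_le_divide_eq)
      then have "\<epsilon> * m \<le> \<epsilon> * (1 / ((B + B\<^sup>2 + \<delta>) * \<theta>))" using \<epsilon> by (intro mult_left_mono) auto
      then show ?thesis by (simp add: mult.commute)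
    qed
    ultimately show ?thesis by simp
  next
    case False
    then have neg: "\<theta> < 0" using \<theta> by simp
    have n1: "n - 1 < n" using n by simp
    have y: "z0 + \<epsilon> < eig n H" using gap2[OF n1] neg \<epsilon> \<delta> n by (simp add: \<sigma>_def h_def)
    have "\<epsilon> / B * (- (1 / \<theta>)) \<le> 1 / \<theta> - ?T (z0 + \<epsilon>)"
      using T_transform_margin_left[OF H(1,2,3) n top(2) _ _ y, of z0 z0] \<epsilon> T0 z0pos by simp
    moreover have "m * \<epsilon> \<le> \<epsilon> / B * (- (1 / \<theta>))"
    proof -
      have "1 \<le> - (1 / \<theta>)" using neg \<theta> by (simp add: divide_simps)
      then have "\<epsilon> / B * 1 \<le> \<epsilon> / B * (- (1 / \<theta>))" using \<epsilon> B by (intro mult_left_mono) auto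
      moreover have "m * \<epsilon> \<le> \<epsilon> / B"
        using mult_right_mono[OF mB, of \<epsilon>] \<epsilon> B by (simp add: pos_le_divide_eq mult_ac)
      ultimately show ?thesis by simp
    qed
    ultimately show ?thesis by simp
  qed
  \<comment> \<open>Positivity of z0 - \<epsilon> is needed for the left margin; the opposite case
    is settled separately at the end.\<close>
  have margin_minus: "1 / \<theta> + m * \<epsilon> \<le> ?T (z0 - \<epsilon>)" if pos: "z0 - \<epsilon> > 0"
  proof (cases "\<theta> > 0")
    case True
    have C: "z0 \<le> B + B\<^sup>2 + \<delta>" using z0C[OF True] \<delta> by simp
    have n0: "0 < n" using n by simp
    have x: "eig 1 H < z0 - \<epsilon>" using gap2[OF n0] True \<epsilon> \<delta> by (simp add: \<sigma>_def h_def)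
    have "\<epsilon> / (B + B\<^sup>2 + \<delta>) * (1 / \<theta>) \<le> ?T (z0 - \<epsilon>) - 1 / \<theta>"
      using T_transform_margin_right[OF H(1,2,3) n top(2) x _ C, of z0] \<epsilon> T0 by simp
    moreover have "m * \<epsilon> \<le> \<epsilon> / (B + B\<^sup>2 + \<delta>) * (1 / \<theta>)"
    proof -
      have "0 < (B + B\<^sup>2 + \<delta>) * \<theta>" using B \<delta> True by (simp add: add_pos_pos)
      then have "m \<le> 1 / ((B + B\<^sup>2 + \<delta>) * \<theta>)" using mC by (simp add: pos_le_divide_eq)
      then have "\<epsilon> * m \<le> \<epsilon> * (1 / ((B + B\<^sup>2 + \<delta>) * \<theta>))" using \<epsilon> by (intro mult_left_mono) auto
      then show ?thesis by (simp add: mult.commute)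
    qed
    ultimately show ?thesis by simp
  next
    case False
    then have neg: "\<theta> < 0" using \<theta> by simp
    have n1: "n - 1 < n" using n by simp
    have y: "z0 < eig n H" using gap2[OF n1] neg \<epsilon> \<delta> n by (simp add: \<sigma>_def h_def)
    have "\<epsilon> / B * (- (1 / \<theta>)) \<le> ?T (z0 - \<epsilon>) - 1 / \<theta>"
      using T_transform_margin_left[OF H(1,2,3) n top(2) _ _ y, of "z0 - \<epsilon>" z0] \<epsilon> T0 pos by simp
    moreover have "m * \<epsilon> \<le> \<epsilon> / B * (- (1 / \<theta>))"
    proof -
      have "1 \<le> - (1 / \<theta>)" using neg \<theta> by (simp add: divide_simps)
      then have "\<epsilon> / B * 1 \<le> \<epsilon> / B * (- (1 / \<theta>))" using \<epsilon> B by (intro mult_left_mono) auto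
      moreover have "m * \<epsilon> \<le> \<epsilon> / B"
        using mult_right_mono[OF mB, of \<epsilon>] \<epsilon> B by (simp add: pos_le_divide_eq mult_ac)
      ultimately show ?thesis by simp
    qed
    ultimately show ?thesis by simp
  qed
  define d where "d = (\<lambda>z l. h l / (z - h l) - ?T z)"
  have dD: "\<bar>d z l\<bar> \<le> D" and d0: "(\<Sum>l<n. d z l) = 0"
    if z: "\<And>l. l < n \<Longrightarrow> \<sigma> * (z - h l) \<ge> \<delta>" and l: "l < n" for z l
  proof -
    have f: "\<bar>h l / (z - h l)\<bar> \<le> B / \<delta>" if l: "l < n" for l
    proof -
      have "\<delta> \<le> \<bar>z - h l\<bar>" using z[OF l] \<sigma> by auto
      then show ?thesis using h(1)[OF l] hB[OF l] \<delta> by (simp add: abs_divide frac_le)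
    qed
    have "\<bar>\<Sum>l<n. h l / (z - h l)\<bar> \<le> (\<Sum>l<n. B / \<delta>)"
      by (rule order.trans[OF sum_abs sum_mono]) (use f in auto)
    then have "\<bar>?T z\<bar> \<le> B / \<delta>"
      unfolding Tz using n by (simp add: abs_divide pos_divide_le_eq mult.commute)
    then have "\<bar>d z l\<bar> \<le> B / \<delta> + B / \<delta>" using f[OF l] unfolding d_def by linarith
    then show "\<bar>d z l\<bar> \<le> D" by (simp add: D_def)
    show "(\<Sum>l<n. d z l) = 0"
      using n by (simp add: d_def sum_subtractf Tz)
  qed
  \<comment> \<open>The separation 2 \<delta> leaves \<delta> after moving by \<epsilon> <=
    \<delta>.\<close>
  have gap: "\<sigma> * (z - h l) \<ge> \<delta>" if "z = z0 + \<epsilon> \<or> z = z0 - \<epsilon>" "l < n" for z l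
    using gap2[OF that(2)] that(1) \<sigma> \<epsilon> by auto
  have n0: "0 < n" using n by simp
  have m\<epsilon>: "m * \<epsilon> > 0" using m \<epsilon> by simp
  \<comment> \<open>Two exceptional sets suffice, one for each endpoint of the interval. The
    tolerance m \<epsilon> is the margin by which T differs from 1 / \<theta> there.\<close>
  have bad: "\<exists>S\<in>sets \<mu>. prob S \<le> 2 * exp (517 * card J - (m * \<epsilon>)\<^sup>2 * n / (4800 * D\<^sup>2)) \<and>
    (\<forall>U\<in>space \<mu> - S. \<forall>c. supported n J c \<longrightarrow>
      \<bar>weighted_norm_sq n (d z) (\<lambda>l. (mat_adjoint Q *\<^sub>v (U *\<^sub>v (E *\<^sub>v c))) $ l)\<bar> \<le> m * \<epsilon> * norm_sq c)"
    if z: "z = z0 + \<epsilon> \<or> z = z0 - \<epsilon>" for z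
    using haar_uniform_bound[OF haar unitary_group_adjoint[OF Q] E J J0, of "d z" D "m * \<epsilon>"]
      dD[OF gap[OF z]] d0[OF gap[OF z] n0] D m\<epsilon> by blast
  define ex where "ex = exp (- (m\<^sup>2 / (4800 * D\<^sup>2)) * real n * \<epsilon>\<^sup>2 + 517 * real M)"
  have ex: "exp (517 * card J - (m * \<epsilon>)\<^sup>2 * n / (4800 * D\<^sup>2)) = ex"
    by (simp add: ex_def cardJ power_mult_distrib algebra_simps)
  obtain S1 where S1: "S1 \<in> sets \<mu>" "prob S1 \<le> 2 * ex"
    "\<And>U c. U \<in> space \<mu> \<Longrightarrow> U \<notin> S1 \<Longrightarrow> supported n J c \<Longrightarrow>
      \<bar>weighted_norm_sq n (d (z0 + \<epsilon>)) (\<lambda>l. (mat_adjoint Q *\<^sub>v (U *\<^sub>v (E *\<^sub>v c))) $ l)\<bar> \<le> m * \<epsilon> * norm_sq c"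
    using bad[of "z0 + \<epsilon>"] unfolding ex by auto
  obtain S2 where S2: "S2 \<in> sets \<mu>" "prob S2 \<le> 2 * ex"
    "\<And>U c. U \<in> space \<mu> \<Longrightarrow> U \<notin> S2 \<Longrightarrow> supported n J c \<Longrightarrow>
      \<bar>weighted_norm_sq n (d (z0 - \<epsilon>)) (\<lambda>l. (mat_adjoint Q *\<^sub>v (U *\<^sub>v (E *\<^sub>v c))) $ l)\<bar> \<le> m * \<epsilon> * norm_sq c"
    using bad[of "z0 - \<epsilon>"] unfolding ex by auto
  let ?ev = "{U \<in> space \<mu>. z0 - \<epsilon> \<le> outlier_eig M i P (W_tilde H P U) \<and> outlier_eig M i P (W_tilde H P U) \<le> z0 + \<epsilon>}"
  have outside: "z0 - \<epsilon> \<le> eig k (W_tilde H P U) \<and> eig k (W_tilde H P U) \<le> z0 + \<epsilon>"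
    if U: "U \<in> space \<mu>" "U \<notin> S1" "U \<notin> S2" for U
  proof
    have UU: "U \<in> unitary_group n" using U haar_space[OF haar] by simp
    have th1: "1 + \<theta> > 0" using \<theta> by simp
    define r where "r = \<theta> / (1 + \<theta>)"
    have r: "p (k - 1) / (1 + p (k - 1)) = r" by (simp only: pk' r_def)
    \<comment> \<open>The outlier equation at z0. Replacing 1 / \<theta> by T at a shifted point
      changes the value by more than r m \<epsilon> can undo, which is what the hypotheses of the
      outer and inner bounds ask for.\<close>
    have key: "r * (1 + 1 / \<theta>) = 1"
    proof -
      have "1 + 1 / \<theta> = (1 + \<theta>) / \<theta>" using \<theta> by (simp add: add_divide_distrib)
      moreover have "1 + \<theta> \<noteq> 0" using th1 by simp
      ultimately show ?thesis using \<theta> by (simp add: r_def)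
    qed
    have rpos: "0 \<le> r" if "\<theta> > 0" using that by (simp add: r_def)
    have rneg: "r \<le> 0" if "\<not> \<theta> > 0" using that th1 by (simp add: r_def divide_nonpos_pos)
    have gapp: "\<sigma> * (z - h l) > 0" if "z = z0 + \<epsilon> \<or> z = z0 - \<epsilon>" "l < n" for z l
      using gap[OF that] \<delta> by simp
    have good1: "\<bar>weighted_norm_sq n (\<lambda>l. h l / (z0 + \<epsilon> - h l) - ?T (z0 + \<epsilon>)) (\<lambda>l. (mat_adjoint Q *\<^sub>v (U *\<^sub>v (E *\<^sub>v c))) $ l)\<bar>
        \<le> m * \<epsilon> * norm_sq c" if "supported n J c" for c
      using S1(3)[OF U(1,2) that] by (simp add: d_def)
    have good2: "\<bar>weighted_norm_sq n (\<lambda>l. h l / (z0 - \<epsilon> - h l) - ?T (z0 - \<epsilon>)) (\<lambda>l. (mat_adjoint Q *\<^sub>v (U *\<^sub>v (E *\<^sub>v c))) $ l)\<bar>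
        \<le> m * \<epsilon> * norm_sq c" if "supported n J c" for c
      using S2(3)[OF U(1,3) that] by (simp add: d_def)
    have zp: "z0 + \<epsilon> > 0" using z0pos \<epsilon> by simp
    have outer1: "\<sigma> * (p (k - 1) / (1 + p (k - 1))) * (\<sigma> * (1 + ?T (z0 + \<epsilon>)) + m * \<epsilon>) \<le> 1" if pos: "\<theta> > 0"
    proof -
      have "r * (1 + ?T (z0 + \<epsilon>) + m * \<epsilon>) \<le> r * (1 + 1 / \<theta>)"
        using margin_plus rpos[OF pos] by (intro mult_left_mono) auto
      also note key
      finally show ?thesis unfolding r using pos by (simp add: \<sigma>_def)
    qed
    have inner1: "1 \<le> \<sigma> * (p (k - 1) / (1 + p (k - 1))) * (\<sigma> * (1 + ?T (z0 + \<epsilon>)) - m * \<epsilon>)" if neg: "\<not> \<theta> > 0"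
    proof -
      have "r * (1 + 1 / \<theta>) \<le> r * (1 + ?T (z0 + \<epsilon>) + m * \<epsilon>)"
        using margin_plus rneg[OF neg] by (intro mult_left_mono_neg) auto
      also have "\<dots> = - r * (- (1 + ?T (z0 + \<epsilon>)) - m * \<epsilon>)" by (simp add: algebra_simps)
      finally show ?thesis unfolding r key using neg by (simp add: \<sigma>_def)
    qed
    show "eig k (W_tilde H P U) \<le> z0 + \<epsilon>"
    proof (cases "\<theta> > 0")
      case True
      show ?thesis
        by (rule outlier_outer_bound(1)[OF Q E UU HQ' PE' p zp \<sigma> gapp J_def pmono good1 k spike outer1[OF True]])
          (auto simp: \<sigma>_def True)
    next
      case False
      show ?thesis
        by (rule outlier_inner_bound(2)[OF Q E UU HQ' PE' p zp \<sigma> gapp J_def pmono good1 k spike inner1[OF False]])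
          (auto simp: \<sigma>_def False)
    qed
    show "z0 - \<epsilon> \<le> eig k (W_tilde H P U)"
    proof (cases "z0 - \<epsilon> > 0")
      case False
      \<comment> \<open>When z0 - \<epsilon> <= 0 the lower bound holds because the deformed matrix
        is positive semidefinite.\<close>
      have "0 \<le> eig k (W_tilde H P U)"
      proof (rule eig_nonneg[OF W_tilde_carrier[OF Q E UU HQ' PE' p] W_tilde_hermitian[OF Q E UU HQ' PE' p] k])
        fix x :: "'a vec" assume x: "x \<in> carrier_vec n"
        have "0 \<le> (\<Sum>l<n. h l * (norm (v l))\<^sup>2)" for v :: "nat \<Rightarrow> 'a"
          using h(1) by (intro sum_nonneg mult_nonneg_nonneg) auto
        then show "0 \<le> quad_form (W_tilde H P U) x"
          by (subst W_tilde_form[OF Q E UU HQ' PE' p x]) (assumption | simp)+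
      qed auto
      then show ?thesis using False by simp
    next
      case zm: True
      have outer2: "\<sigma> * (p (k - 1) / (1 + p (k - 1))) * (\<sigma> * (1 + ?T (z0 - \<epsilon>)) + m * \<epsilon>) \<le> 1" if neg: "\<not> \<theta> > 0"
      proof -
        have "- r * (- (1 + ?T (z0 - \<epsilon>)) + m * \<epsilon>) = r * (1 + ?T (z0 - \<epsilon>) - m * \<epsilon>)"
          by (simp add: algebra_simps)
        also have "\<dots> \<le> r * (1 + 1 / \<theta>)"
          using margin_minus[OF zm] rneg[OF neg] by (intro mult_left_mono_neg) auto
        also note key
        finally show ?thesis unfolding r using neg by (simp add: \<sigma>_def)
      qed
      have inner2: "1 \<le> \<sigma> * (p (k - 1) / (1 + p (k - 1))) * (\<sigma> * (1 + ?T (z0 - \<epsilon>)) - m * \<epsilon>)" if pos: "\<theta> > 0"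
      proof -
        have "r * (1 + 1 / \<theta>) \<le> r * (1 + ?T (z0 - \<epsilon>) - m * \<epsilon>)"
          using margin_minus[OF zm] rpos[OF pos] by (intro mult_left_mono) auto
        then show ?thesis unfolding r key using pos by (simp add: \<sigma>_def)
      qed
      show ?thesis
      proof (cases "\<theta> > 0")
        case True
        show ?thesis
          by (rule outlier_inner_bound(1)[OF Q E UU HQ' PE' p zm \<sigma> gapp J_def pmono good2 k spike inner2[OF True]])
            (auto simp: \<sigma>_def True)
      next
        case False
        show ?thesis
          by (rule outlier_outer_bound(2)[OF Q E UU HQ' PE' p zm \<sigma> gapp J_def pmono good2 k spike outer2[OF False]])
            (auto simp: \<sigma>_def False)
      qed
    qed
  qed
  have outW: "outlier_eig M i P (W_tilde H P U) = eig k (W_tilde H P U)" if "U \<in> space \<mu>" for U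
    using out W_tilde_carrier[OF Q E _ HQ' PE' p] that haar_space[OF haar] by simp
  have evm: "?ev \<in> sets \<mu>"
  proof -
    have [measurable]: "(\<lambda>U. eig k (W_tilde H P U)) \<in> borel_measurable \<mu>"
      by (rule W_tilde_measurable_eig[OF haar Q E HQ' PE' p k])
    have "?ev = {U \<in> space \<mu>. z0 - \<epsilon> \<le> eig k (W_tilde H P U) \<and> eig k (W_tilde H P U) \<le> z0 + \<epsilon>}"
      using outW by auto
    also have "\<dots> \<in> sets \<mu>" by measurable
    finally show ?thesis .
  qed
  \<comment> \<open>Each exceptional set has probability at most 2 \<open>ex\<close>; their union
    gives the constant 4.\<close>
  have "1 - 4 * ex \<le> 1 - prob (S1 \<union> S2)"
    using measure_Un_le[OF S1(1) S2(1)] S1(2) S2(2) by linarith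
  also have "\<dots> = prob (space \<mu> - (S1 \<union> S2))"
    using S1 S2 by (intro prob_compl[symmetric]) auto
  also have "\<dots> \<le> prob ?ev"
    using outside outW evm by (intro finite_measure_mono) auto
  finally show ?thesis unfolding ex_def D_def .
qed

theorem theorem3p1:
  fixes \<delta> B :: real
  assumes "\<delta> > 0" and "B > 0"
  shows "\<exists>c1 c2 C :: real. c1 > 0 \<and> c2 > 0 \<and> C > 0 \<and>
        (\<forall>(H :: nat \<Rightarrow> real mat) (P :: nat \<Rightarrow> real mat) (M :: nat \<Rightarrow> nat).
          (\<lambda>N. real (M N)) \<in> o(\<lambda>N. real N) \<longrightarrow>
          (\<forall>N\<ge>1. spiked_model B N (M N) (H N) (P N)) \<longrightarrow>
          (\<forall>N\<ge>1. \<forall>\<mu> \<epsilon> i.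
             haar_law N \<mu> \<longrightarrow> 0 < \<epsilon> \<longrightarrow> \<epsilon> \<le> \<delta> \<longrightarrow> 1 \<le> i \<longrightarrow> i \<le> M N \<longrightarrow>
             separated \<delta> (H N) (nonzero_eig i (P N)) \<longrightarrow>
             \<P>(U in \<mu>.
                T_inv (H N) (1 / nonzero_eig i (P N)) - \<epsilon>
                  \<le> outlier_eig (M N) i (P N) (W_tilde (H N) (P N) U) \<and>
                outlier_eig (M N) i (P N) (W_tilde (H N) (P N) U)
                  \<le> T_inv (H N) (1 / nonzero_eig i (P N)) + \<epsilon>)
             \<ge> 1 - C * exp (- c1 * real N * \<epsilon>\<^sup>2 + c2 * real (M N)))) \<and>
        (\<forall>(H :: nat \<Rightarrow> complex mat) (P :: nat \<Rightarrow> complex mat) (M :: nat \<Rightarrow> nat).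
          (\<lambda>N. real (M N)) \<in> o(\<lambda>N. real N) \<longrightarrow>
          (\<forall>N\<ge>1. spiked_model B N (M N) (H N) (P N)) \<longrightarrow>
          (\<forall>N\<ge>1. \<forall>\<mu> \<epsilon> i.
             haar_law N \<mu> \<longrightarrow> 0 < \<epsilon> \<longrightarrow> \<epsilon> \<le> \<delta> \<longrightarrow> 1 \<le> i \<longrightarrow> i \<le> M N \<longrightarrow>
             separated \<delta> (H N) (nonzero_eig i (P N)) \<longrightarrow>
             \<P>(U in \<mu>.
                T_inv (H N) (1 / nonzero_eig i (P N)) - \<epsilon>
                  \<le> outlier_eig (M N) i (P N) (W_tilde (H N) (P N) U) \<and>
                outlier_eig (M N) i (P N) (W_tilde (H N) (P N) U)
                  \<le> T_inv (H N) (1 / nonzero_eig i (P N)) + \<epsilon>)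
             \<ge> 1 - C * exp (- c1 * real N * \<epsilon>\<^sup>2 + c2 * real (M N))))"
proof -
  define m where "m = 1 / ((1 + B) * (B + B\<^sup>2 + \<delta>))"
  define c1 where "c1 = m\<^sup>2 / (4800 * (2 * B / \<delta>)\<^sup>2)"
  have "B + B\<^sup>2 + \<delta> > 0" using assms by (intro add_pos_pos) auto
  then have "m > 0" using assms by (simp add: m_def)
  then have "c1 > 0" using assms by (simp add: c1_def)
  \<comment> \<open>The bound holds for each dimension separately with the same constants, for any
    real or complex scalar type; the sequences in the statement are evaluated at
    \<open>N\<close>.\<close>
  note bound = outlier_concentration[OF assms, folded m_def, folded c1_def]
  show ?thesis
    by (rule exI[of _ c1], rule exI[of _ "517::real"], rule exI[of _ "4::real"], intro conjI allI impI)
      (use \<open>c1 > 0\<close> in simp, simp, simp, (rule bound; simp)+)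
qed

end
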